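(* Let $n\ge 5$ and let $P_n$ be the right-angled Coxeter group with generating set $S=\{s_1,\dots,s_n\}$ and presentation $$P_n=\langle s_1,\dots,s_n \mid s_i^2=1\ (1\le i\le n),\ (s_js_{j+1})^2=1\ (1\le j\le n-1),\ (s_ns_1)^2=1\rangle .$$ The left cells of $P_n$ other than the unit cell $\{1\}$ are exactly the following: (i) $n$ cells corresponding to the $1$-dimensional left precells of $P_n$ defined by the generators, i.e. to the left precells $\Gamma(s_i)$, $i=1,\dots,n$; (ii) infinitely many cells, which are the equivalence classes (under $\sim_L$) of left precells having as canonical representatives the left precells $\Gamma(w_L)$ such that $w_L=t_1t_2w_L'$ (reduced), with $t_1\ne t_2$ in $S$, $t_1t_2=t_2t_1$, and $w_L'$ either trivial or a segment in $w_L$. (Each cell of this type contains exactly one such $\Gamma(w_L)$, and each such $\Gamma(w_L)$ lies in a cell of this type.)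
   Context: Let $(W,S)$ be a Coxeter system with length function $l$ and Bruhat order $\le$. Kazhdan--Lusztig theory. Let $\mathcal A=\mathbb Z[q^{1/2},q^{-1/2}]$. The Hecke algebra $\mathcal H$ is the free $\mathcal A$-module with basis $T_w$ ($w\in W$) and multiplication $T_wT_{w'}=T_{ww'}$ if $l(ww')=l(w)+l(w')$, $T_s^2=q+(q-1)T_s$ for $s\in S$. The bar involution is $\overline{q^{1/2}}=q^{-1/2}$, $\overline{\sum a_wT_w}=\sum\overline{a_w}\,T_{w^{-1}}^{-1}$. Put $q_w=q^{l(w)}$, $\epsilon_w=(-1)^{l(w)}$. For each $w$ there is a unique $C_w\in\mathcal H$ with $\overline{C_w}=C_w$ and $C_w=\epsilon_wq_w^{1/2}\sum_{y\le w}\epsilon_yq_y^{-1}\overline{P_{y,w}}\,T_y$, where $P_{w,w}=1$ and, for $y<w$, $P_{y,w}$ is a polynomial in $q$ of degree $\le\frac12(l(w)-l(y)-1)$ (Kazhdan--Lusztig polynomials). If $y<w$ and $P_{y,w}$ has degree exactly $\frac12(l(w)-l(y)-1)$, write $y\prec w$ and let $\mu(y,w)=\mu(w,y)$ be the coefficient of the highest power of $q$ in $P_{y,w}$; if neither $y\prec w$ nor $w\prec y$, put $\mu(y,w)=\mu(w,y)=0$. Write $y - w$ if $\mu(y,w)\ne0$. Put $\mathcal L(w)=\{s\in S\mid sw<w\}$, $\mathcal R(w)=\{s\in S\mid ws<w\}$. Write $y\le_L w$ if there is a chain $y=y_0,y_1,\dots,y_m=w$ with $y_i - y_{i+1}$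 and $\mathcal L(y_i)\not\subset\mathcal L(y_{i+1})$ for $0\le i<m$. Let $\sim_L$ be the equivalence relation associated to the preorder $\le_L$; its classes are the left cells. Lines and segments. A line is an element of $W$ having a unique reduced expression. A subword $u$ of a reduced word $w_0uw_1$ representing $w$ is a segment of $w$ if $u$ represents a maximal line such that every reduced expression of $w$ has the form $w_0'uw_1'$ with $w_0=w_0'$, $w_1=w_1'$ as elements of $W$ (maximal: $u$ is not contained in any other subword with the same properties). Left precells. For $w_1,w_2\in W$ write $w_1\sim_{lp}w_2$ if there is $w_L\ne1$ such that $w_1,w_2$ have reduced expressions $w_1'w_L$, $w_2'w_L$ respectively, and: (a) if $l(w_L)>1$, then each of $w_1'$, $w_2'$ is trivial or a segment in $w_1$, resp. $w_2$; (b) if $l(w_L)=1$, then $w_1$ and $w_2$ are lines (with $\mathcal R(w_1)=\mathcal R(w_2)=\{w_L\}$). Also $1\sim_{lp}1$. This is an equivalence relation; its classes are called left precells. Each left precell $\Gamma$ contains a unique shortest element, denoted $w_L(\Gamma)$; the left precell with shortest element $w_L$ is denoted $\Gamma(w_L)$. The dimension of a left precell $\Gamma\neq\{1\}$ is $\#\mathcal L(w_L(\Gamma))$. For left precells, $\Gamma_1\sim_L\Gamma_2$ means $w_L(\Gamma_1)\sim_L w_L(\Gamma_2)$; every left cell is a union of left precells that are $\sim_L$-equivalent to each other. *)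

theory Defs
  imports
    "HOL-Algebra.Ring"
    "HOL-Library.Poly_Mapping"
    "HOL-Computational_Algebra.Polynomial"
begin

section \<open>Groups given by generators and relations\<close>

text \<open>
  A letter \<open>(x, False)\<close> stands for the generator \<open>x\<close> and \<open>(x, True)\<close> for its formal inverse.
\<close>

type_synonym 'g gword = "('g \<times> bool) list"

inductive_set pres_rel :: "'g set \<Rightarrow> 'g gword set \<Rightarrow> ('g gword \<times> 'g gword) set"
  for X :: "'g set" and R :: "'g gword set"
where
  pres_refl: "u \<in> lists (X \<times> UNIV) \<Longrightarrow> (u, u) \<in> pres_rel X R"
| pres_sym: "(u, v) \<in> pres_rel X R \<Longrightarrow> (v, u) \<in> pres_rel X R"
| pres_trans: "(u, v) \<in> pres_rel X R \<Longrightarrow> (v, w) \<in> pres_rel X R \<Longrightarrow> (u, w) \<in> pres_rel X R"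
| pres_ctxt: "(u, v) \<in> pres_rel X R \<Longrightarrow> a \<in> lists (X \<times> UNIV) \<Longrightarrow> b \<in> lists (X \<times> UNIV)
    \<Longrightarrow> (a @ u @ b, a @ v @ b) \<in> pres_rel X R"
| pres_cancel: "x \<in> X \<Longrightarrow> ([(x, e), (x, \<not> e)], []) \<in> pres_rel X R"
| pres_relator: "r \<in> R \<Longrightarrow> r \<in> lists (X \<times> UNIV) \<Longrightarrow> (r, []) \<in> pres_rel X R"

definition presented_group :: "'g set \<Rightarrow> 'g gword set \<Rightarrow> 'g gword set monoid" where
  "presented_group X R =
     \<lparr>carrier = lists (X \<times> UNIV) // pres_rel X R,
      monoid.mult = (\<lambda>A B. \<Union>a\<in>A. \<Union>b\<in>B. pres_rel X R `` {a @ b}),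
      monoid.one = pres_rel X R `` {[]}\<rparr>"

definition pres_gen :: "'g set \<Rightarrow> 'g gword set \<Rightarrow> 'g \<Rightarrow> 'g gword set" where
  "pres_gen X R x = pres_rel X R `` {[(x, False)]}"


section \<open>Laurent polynomials\<close>

text \<open>
  The ring \<open>\<int>[q\<^sup>1\<^sup>/\<^sup>2, q\<^sup>-\<^sup>1\<^sup>/\<^sup>2]\<close> is the group ring of \<open>\<int>\<close> over \<open>\<int>\<close> (multiplication on the type below is
  convolution), the exponent \<open>k\<close> standing for \<open>q\<^sup>k\<^sup>/\<^sup>2\<close>.
\<close>

type_synonym laurent = "int \<Rightarrow>\<^sub>0 int"

definition qhalf_pow :: "int \<Rightarrow> laurent" where
  "qhalf_pow k = Poly_Mapping.single k 1"

definition q_var :: laurent where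
  "q_var = qhalf_pow 2"

definition laurent_bar :: "laurent \<Rightarrow> laurent" where
  "laurent_bar a = Poly_Mapping.map_key uminus a"

definition eval_q :: "int poly \<Rightarrow> laurent" where
  "eval_q p = poly (map_poly of_int p) q_var"

definition scale :: "laurent \<Rightarrow> ('a \<Rightarrow>\<^sub>0 laurent) \<Rightarrow> ('a \<Rightarrow>\<^sub>0 laurent)" where
  "scale a h = Poly_Mapping.map ((*) a) h"


section \<open>Cells and precells\<close>

text \<open>
  The locale carries no assumptions; the notions are meant for a Coxeter system \<open>(W, S)\<close>.
\<close>

locale coxeter =
  fixes W :: "('a, 'm) monoid_scheme" (structure) and S :: "'a set"
begin

subsection \<open>Length, Bruhat order, descent sets\<close>

definition word_prod :: "'a list \<Rightarrow> 'a" where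
  "word_prod ws = foldr (\<otimes>) ws \<one>"

definition len :: "'a \<Rightarrow> nat" where
  "len w = (LEAST k. \<exists>ws \<in> lists S. length ws = k \<and> word_prod ws = w)"

definition reduced :: "'a list \<Rightarrow> bool" where
  "reduced ws \<longleftrightarrow> ws \<in> lists S \<and> length ws = len (word_prod ws)"

definition reflections :: "'a set" where
  "reflections = {w \<otimes> s \<otimes> inv w | w s. w \<in> carrier W \<and> s \<in> S}"

definition bruhat_le :: "'a \<Rightarrow> 'a \<Rightarrow> bool" where
  "bruhat_le y w \<longleftrightarrow> y \<in> carrier W \<and> w \<in> carrier W \<and>
     (\<lambda>u v. \<exists>t \<in> reflections. v = u \<otimes> t \<and> len u < len v)\<^sup>*\<^sup>* y w"

definition bruhat_less :: "'a \<Rightarrow> 'a \<Rightarrow> bool" where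
  "bruhat_less y w \<longleftrightarrow> bruhat_le y w \<and> y \<noteq> w"

definition left_descents :: "'a \<Rightarrow> 'a set" where
  "left_descents w = {s \<in> S. bruhat_less (s \<otimes> w) w}"

definition right_descents :: "'a \<Rightarrow> 'a set" where
  "right_descents w = {s \<in> S. bruhat_less (w \<otimes> s) w}"

subsection \<open>Hecke algebra and Kazhdan--Lusztig polynomials\<close>

abbreviation T :: "'a \<Rightarrow> ('a \<Rightarrow>\<^sub>0 laurent)" where
  "T w \<equiv> Poly_Mapping.single w 1"

text \<open>
  The free module on \<open>W\<close> consists of the finitely supported functions \<open>W \<rightarrow> \<A>\<close>. The conditions below
  determine the product on it uniquely, so the choice in \<open>hecke\<close> is immaterial on the carrier.
\<close>

definition is_hecke_algebra :: "('a \<Rightarrow>\<^sub>0 laurent) ring \<Rightarrow> bool" where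
  "is_hecke_algebra H \<longleftrightarrow>
     ring H \<and>
     carrier H = {h. Poly_Mapping.keys h \<subseteq> carrier W} \<and>
     zero H = 0 \<and> add H = (+) \<and>
     (\<forall>a. \<forall>x \<in> carrier H. \<forall>y \<in> carrier H.
        scale a x \<otimes>\<^bsub>H\<^esub> y = scale a (x \<otimes>\<^bsub>H\<^esub> y) \<and>
        x \<otimes>\<^bsub>H\<^esub> scale a y = scale a (x \<otimes>\<^bsub>H\<^esub> y)) \<and>
     (\<forall>w \<in> carrier W. \<forall>w' \<in> carrier W. len (w \<otimes> w') = len w + len w' \<longrightarrow>
        T w \<otimes>\<^bsub>H\<^esub> T w' = T (w \<otimes> w')) \<and>
     (\<forall>s \<in> S. T s \<otimes>\<^bsub>H\<^esub> T s = scale q_var (T \<one>) + scale (q_var - 1) (T s))"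

definition hecke :: "('a \<Rightarrow>\<^sub>0 laurent) ring" where
  "hecke = (SOME H. is_hecke_algebra H)"

definition hecke_bar :: "('a \<Rightarrow>\<^sub>0 laurent) \<Rightarrow> ('a \<Rightarrow>\<^sub>0 laurent)" where
  "hecke_bar h = (\<Sum>w \<in> Poly_Mapping.keys h.
     scale (laurent_bar (Poly_Mapping.lookup h w)) (inv\<^bsub>hecke\<^esub> T (inv w)))"

text \<open>
  The element \<open>\<epsilon>\<^sub>w q\<^sub>w\<^sup>1\<^sup>/\<^sup>2 \<Sum>\<^bsub>y \<le> w\<^esub> \<epsilon>\<^sub>y q\<^sub>y\<^sup>-\<^sup>1 \<open>bar\<close>(P\<^sub>y) T\<^sub>y\<close>, for a family \<open>P\<close> of polynomials in \<open>q\<close>.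
\<close>

definition kl_element :: "'a \<Rightarrow> ('a \<Rightarrow> int poly) \<Rightarrow> ('a \<Rightarrow>\<^sub>0 laurent)" where
  "kl_element w P =
     scale ((-1) ^ len w * qhalf_pow (int (len w)))
       (\<Sum>y \<in> {y. bruhat_le y w}.
          scale ((-1) ^ len y * qhalf_pow (- 2 * int (len y)) * laurent_bar (eval_q (P y))) (T y))"

text \<open>
  \<open>P\<close> is normalised to vanish outside the Bruhat interval below \<open>w\<close>, which makes it unique. Since
  \<open>len y < len w\<close> for \<open>y < w\<close>, the degree bound makes sense for the zero polynomial, too.
\<close>

definition is_kl_family :: "'a \<Rightarrow> ('a \<Rightarrow> int poly) \<Rightarrow> bool" where
  "is_kl_family w P \<longleftrightarrow>
     P w = 1 \<and>
     (\<forall>y. bruhat_less y w \<longrightarrow> 2 * degree (P y) + len y + 1 \<le> len w) \<and>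
     (\<forall>y. \<not> bruhat_le y w \<longrightarrow> P y = 0) \<and>
     hecke_bar (kl_element w P) = kl_element w P"

definition kl_poly :: "'a \<Rightarrow> 'a \<Rightarrow> int poly" where
  "kl_poly y w = (THE P. is_kl_family w P) y"

definition kl_prec :: "'a \<Rightarrow> 'a \<Rightarrow> bool" where
  "kl_prec y w \<longleftrightarrow> bruhat_less y w \<and> 2 * degree (kl_poly y w) + len y + 1 = len w"

definition mu :: "'a \<Rightarrow> 'a \<Rightarrow> int" where
  "mu y w = (if kl_prec y w then lead_coeff (kl_poly y w)
             else if kl_prec w y then lead_coeff (kl_poly w y)
             else 0)"

subsection \<open>Left cells\<close>

definition left_le :: "'a \<Rightarrow> 'a \<Rightarrow> bool" where
  "left_le y w \<longleftrightarrow> y \<in> carrier W \<and> w \<in> carrier W \<and>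
     (\<lambda>u v. u \<in> carrier W \<and> v \<in> carrier W \<and> mu u v \<noteq> 0
        \<and> \<not> left_descents u \<subseteq> left_descents v)\<^sup>*\<^sup>* y w"

definition left_equiv :: "'a \<Rightarrow> 'a \<Rightarrow> bool" where
  "left_equiv y w \<longleftrightarrow> left_le y w \<and> left_le w y"

definition left_cells :: "'a set set" where
  "left_cells = carrier W // {(y, w). left_equiv y w}"

subsection \<open>Lines and segments\<close>

definition is_line :: "'a \<Rightarrow> bool" where
  "is_line w \<longleftrightarrow> w \<in> carrier W \<and> (\<exists>!ws. reduced ws \<and> word_prod ws = w)"

text \<open>
  The subword \<open>u\<close> is given together with its position in the reduced word \<open>w0 @ u @ w1\<close>.
\<close>

definition fixed_line :: "'a list \<Rightarrow> 'a list \<Rightarrow> 'a list \<Rightarrow> bool" where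
  "fixed_line w0 u w1 \<longleftrightarrow>
     reduced (w0 @ u @ w1) \<and> is_line (word_prod u) \<and>
     (\<forall>ws. reduced ws \<and> word_prod ws = word_prod (w0 @ u @ w1) \<longrightarrow>
        (\<exists>w0' w1'. ws = w0' @ u @ w1' \<and>
           word_prod w0' = word_prod w0 \<and> word_prod w1' = word_prod w1))"

definition segment :: "'a list \<Rightarrow> 'a list \<Rightarrow> 'a list \<Rightarrow> bool" where
  "segment w0 u w1 \<longleftrightarrow>
     fixed_line w0 u w1 \<and>
     (\<forall>a x y b. w0 = a @ x \<and> w1 = y @ b \<and> fixed_line a (x @ u @ y) b \<longrightarrow> x = [] \<and> y = [])"

subsection \<open>Left precells\<close>

text \<open>Here \<open>v\<close> is a reduced word for \<open>w\<^sub>L\<close>, and \<open>u1\<close>, \<open>u2\<close> are words for \<open>w\<^sub>1'\<close>, \<open>w\<^sub>2'\<close>.\<close>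

definition lp_rel :: "'a \<Rightarrow> 'a \<Rightarrow> bool" where
  "lp_rel w1 w2 \<longleftrightarrow>
     w1 = \<one> \<and> w2 = \<one> \<or>
     (\<exists>u1 u2 v. word_prod v \<noteq> \<one> \<and>
        reduced (u1 @ v) \<and> word_prod (u1 @ v) = w1 \<and>
        reduced (u2 @ v) \<and> word_prod (u2 @ v) = w2 \<and>
        (len (word_prod v) > 1 \<longrightarrow>
           (u1 = [] \<or> segment [] u1 v) \<and> (u2 = [] \<or> segment [] u2 v)) \<and>
        (len (word_prod v) = 1 \<longrightarrow>
           is_line w1 \<and> is_line w2 \<and>
           right_descents w1 = {word_prod v} \<and> right_descents w2 = {word_prod v}))"

definition left_precells :: "'a set set" where
  "left_precells = carrier W // {(w1, w2). lp_rel w1 w2}"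

definition shortest :: "'a set \<Rightarrow> 'a" where
  "shortest \<Gamma> = (THE w. w \<in> \<Gamma> \<and> (\<forall>v \<in> \<Gamma>. v \<noteq> w \<longrightarrow> len w < len v))"

text \<open>The precell \<open>\<Gamma>(w)\<close>, defined only for those \<open>w\<close> that are shortest in their left precell.\<close>

definition precell :: "'a \<Rightarrow> 'a set" where
  "precell w = (THE \<Gamma>. \<Gamma> \<in> left_precells \<and> shortest \<Gamma> = w)"

definition dimension :: "'a set \<Rightarrow> nat" where
  "dimension \<Gamma> = card (left_descents (shortest \<Gamma>))"

definition precell_equiv :: "('a set \<times> 'a set) set" where
  "precell_equiv = {(\<Gamma>1, \<Gamma>2). \<Gamma>1 \<in> left_precells \<and> \<Gamma>2 \<in> left_precells \<and>
     left_equiv (shortest \<Gamma>1) (shortest \<Gamma>2)}"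

definition canonical_word :: "'a list \<Rightarrow> bool" where
  "canonical_word ws \<longleftrightarrow>
     (\<exists>t1 \<in> S. \<exists>t2 \<in> S. \<exists>u. ws = t1 # t2 # u \<and> t1 \<noteq> t2 \<and> t1 \<otimes> t2 = t2 \<otimes> t1 \<and>
        reduced ws \<and> (u = [] \<or> segment [t1, t2] u []))"

definition canonical_precells :: "'a set set" where
  "canonical_precells = {\<Gamma> \<in> left_precells. \<exists>ws. canonical_word ws \<and> shortest \<Gamma> = word_prod ws}"

text \<open>
  An equivalence class \<open>\<G>\<close> of left precells is identified with the union of its members.
\<close>

definition canonical_cells :: "'a set set" where
  "canonical_cells =
     {\<Union>\<G> | \<G>. \<G> \<in> left_precells // precell_equiv \<and> (\<exists>\<Gamma> \<in> \<G>. \<Gamma> \<in> canonical_precells)}"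

end


section \<open>The groups \<open>P\<^sub>n\<close>\<close>

definition P_relators :: "nat \<Rightarrow> nat gword set" where
  "P_relators n = map (\<lambda>i. (i, False)) `
     ({[i, i] | i. 1 \<le> i \<and> i \<le> n} \<union>
      {[j, j + 1, j, j + 1] | j. 1 \<le> j \<and> j \<le> n - 1} \<union>
      {[n, 1, n, 1]})"

definition P_group :: "nat \<Rightarrow> nat gword set monoid" where
  "P_group n = presented_group {1..n} (P_relators n)"

definition P_gen :: "nat \<Rightarrow> nat \<Rightarrow> nat gword set" where
  "P_gen n i = pres_gen {1..n} (P_relators n) i"

definition P_gens :: "nat \<Rightarrow> nat gword set set" where
  "P_gens n = P_gen n ` {1..n}"

end

theory Submission
  imports Defs
begin

text \<open>
  Let \<open>X(A)\<close> be the set of all \<open>x\<close> with right descent set \<open>A = {t\<^sub>1, t\<^sub>2}\<close>, a pair of commuting generators.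
  If \<open>u\<close> is a line whose first letter commutes with neither of \<open>t\<^sub>1, t\<^sub>2\<close>, then \<open>C\<^sub>x \<mapsto> C\<^bsub>xu\<^esub>\<close> is given, on all
  of \<open>X(A)\<close>, by right multiplication with one element of the Hecke algebra. The \<open>C\<^sub>x\<close> with \<open>x \<in> X(A)\<close> span
  a left ideal, hence so do the \<open>C\<^bsub>xu\<^esub>\<close>: the sets \<open>X(A) u\<close> are closed under \<open>\<le>\<^sub>L\<close>, and the preorder is
  carried over from \<open>X(A)\<close> to \<open>X(A) u\<close>.

  Within \<open>X(A)\<close> all elements are \<open>\<le>\<^sub>L t\<^sub>1t\<^sub>2\<close>. For the converse let \<open>w = aby \<in> X(A)\<close> be reduced with
  \<open>\<L>(w) = {a, b}\<close>. Since products of basis elements have coefficients of degree at most two in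
  \<open>q\<^sup>1\<^sup>/\<^sup>2 - q\<^sup>-\<^sup>1\<^sup>/\<^sup>2\<close>, the element \<open>T\<^bsub>y\<^sup>-\<^sup>1\<^esub> C\<^sub>w\<close> is an integral combination, without negative powers of \<open>q\<^sup>1\<^sup>/\<^sup>2\<close>,
  of elements \<open>C\<^sub>z\<close> with \<open>z \<le>\<^sub>L w\<close>, and its normalised coefficient of \<open>T\<^sub>1\<close> is \<open>q\<close>. Only \<open>C\<^bsub>t\<^sub>1t\<^sub>2\<^esub>\<close> can
  contribute this term, so \<open>t\<^sub>1t\<^sub>2 \<le>\<^sub>L w\<close>.

  Every element is either \<open>1\<close>, or a line, or lies in exactly one \<open>X(A) u\<close>. Lines with the same last
  letter are equivalent by removing letters on the left one by one.
\<close>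


section \<open>Coxeter systems and right-angled systems\<close>

text \<open>The delicate point is that one operator has to serve all of X(A). Multiplying C_w by C_d
  on the right produces, if wd > w, the element C_{wd} and corrections C_z with d in R(z) and
  \<mu>(z,w) nonzero. As d does not commute with a right descent t of w, this t is not in R(z), and
  then \<mu>(z,w) \<noteq> 0 forces z = wt. If w has two right descents, the two resulting equations
  exclude each other. If w has a single one, at most one correction survives; it lies two letters
  back, and whether it occurs depends on A and u alone.

  The bound two on the degrees reflects that no three distinct generators commute pairwise; for the
  same reason pairs are the largest descent sets.

  Facts about P_n that a presentation hides, such as distinctness of generators and infinite
  dihedral subgroups, come from letting words act on the integers and on group elements. The bound n
  >= 5 excludes three pairwise adjacent generators and supplies s_4, which commutes with neither s_1
  nor s_2; its alternating products with s_2 give infinitely many tails u.\<close>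

declare in_listsD [rule del] in_listsI [rule del]

lemma rev_in_lists_iff [simp]: "rev ws \<in> lists A \<longleftrightarrow> ws \<in> lists A"
  by (simp add: in_lists_conv_set)

text \<open>
  For a reflection \<open>x\<close>, the condition \<open>\<eta> w x\<close> means \<open>l(w x) < l(w)\<close>. The existence of such a cocycle is
  equivalent to the exchange condition and, unlike the latter, can be checked on a presentation.
\<close>

locale coxeter_system = coxeter W S + group W
  for W :: "('a, 'm) monoid_scheme" (structure) and S :: "'a set" +
  fixes \<eta> :: "'a \<Rightarrow> 'a \<Rightarrow> bool"
  assumes gens_closed: "S \<subseteq> carrier W"
    and generated: "w \<in> carrier W \<Longrightarrow> \<exists>ws \<in> lists S. word_prod ws = w"
    and gen_sq: "s \<in> S \<Longrightarrow> s \<otimes> s = \<one>"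
    and eta_one: "x \<in> carrier W \<Longrightarrow> \<not> \<eta> \<one> x"
    and eta_gen: "s \<in> S \<Longrightarrow> w \<in> carrier W \<Longrightarrow> x \<in> carrier W \<Longrightarrow>
      \<eta> (s \<otimes> w) x \<longleftrightarrow> \<eta> w x \<noteq> (w \<otimes> x \<otimes> inv w = s)"
begin

section \<open>Words, length and the exchange condition\<close>

lemma gen_closed [simp]: "s \<in> S \<Longrightarrow> s \<in> carrier W"
  using gens_closed by auto

lemma gen_inv [simp]: "s \<in> S \<Longrightarrow> inv s = s"
  by (metis gen_closed gen_sq inv_equality)

lemma inv_cancel [simp]:
  "x \<in> carrier W \<Longrightarrow> y \<in> carrier W \<Longrightarrow> inv x \<otimes> (x \<otimes> y) = y"
  "x \<in> carrier W \<Longrightarrow> y \<in> carrier W \<Longrightarrow> x \<otimes> (inv x \<otimes> y) = y"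
  by (simp_all flip: m_assoc)

lemma gen_cancel [simp]: "s \<in> S \<Longrightarrow> w \<in> carrier W \<Longrightarrow> s \<otimes> (s \<otimes> w) = w"
  by (metis gen_closed gen_sq l_one m_assoc)

lemma gen_cancel_right [simp]: "s \<in> S \<Longrightarrow> w \<in> carrier W \<Longrightarrow> w \<otimes> s \<otimes> s = w"
  by (simp add: m_assoc gen_sq)

lemma word_prod_Nil [simp]: "word_prod [] = \<one>"
  by (simp add: word_prod_def)

lemma word_prod_Cons [simp]: "word_prod (a # ws) = a \<otimes> word_prod ws"
  by (simp add: word_prod_def)

lemma word_prod_closed [simp]: "ws \<in> lists S \<Longrightarrow> word_prod ws \<in> carrier W"
  by (induction ws) auto

lemma word_prod_append [simp]:
  "us \<in> lists S \<Longrightarrow> ws \<in> lists S \<Longrightarrow> word_prod (us @ ws) = word_prod us \<otimes> word_prod ws"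
  by (induction us) (auto simp: m_assoc)

lemma word_prod_rev: "ws \<in> lists S \<Longrightarrow> word_prod (rev ws) = inv (word_prod ws)"
  by (induction ws) (auto simp: inv_mult_group)

lemma len_word_prod_le: "ws \<in> lists S \<Longrightarrow> len (word_prod ws) \<le> length ws"
  unfolding len_def by (rule Least_le) auto

lemma reduced_exists:
  assumes "w \<in> carrier W" obtains ws where "reduced ws" "word_prod ws = w"
proof -
  from generated[OF assms] have "\<exists>k. \<exists>ws \<in> lists S. length ws = k \<and> word_prod ws = w" by auto
  from LeastI_ex[OF this] obtain ws where "ws \<in> lists S" "length ws = len w" "word_prod ws = w"
    unfolding len_def by auto
  then show thesis using that unfolding reduced_def by auto
qed

lemma reduced_lists: "reduced ws \<Longrightarrow> ws \<in> lists S"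
  by (simp add: reduced_def)

lemma len_one [simp]: "len \<one> = 0"
  using len_word_prod_le[of "[]"] by auto

lemma len_eq_0 [simp]: "w \<in> carrier W \<Longrightarrow> len w = 0 \<longleftrightarrow> w = \<one>"
  by (metis len_one length_0_conv reduced_def reduced_exists word_prod_Nil)

lemma len_inv [simp]:
  assumes "w \<in> carrier W" shows "len (inv w) = len w"
proof -
  have *: "len (inv x) \<le> len x" if "x \<in> carrier W" for x
  proof -
    obtain ws where ws: "reduced ws" "word_prod ws = x" using reduced_exists \<open>x \<in> carrier W\<close> by blast
    then have "word_prod (rev ws) = inv x" using word_prod_rev reduced_lists by auto
    moreover have "rev ws \<in> lists S" using reduced_lists[OF ws(1)] by auto
    ultimately show ?thesis using len_word_prod_le[of "rev ws"] ws by (auto simp: reduced_def)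
  qed
  show ?thesis using *[OF assms] *[of "inv w"] assms by auto
qed

lemma len_mult_le:
  assumes "u \<in> carrier W" "w \<in> carrier W" shows "len (u \<otimes> w) \<le> len u + len w"
proof -
  obtain us ws where "reduced us" "word_prod us = u" "reduced ws" "word_prod ws = w"
    using reduced_exists assms by metis
  then show ?thesis
    using len_word_prod_le[of "us @ ws"] by (auto simp: reduced_def)
qed

lemma len_gen_le: "s \<in> S \<Longrightarrow> len s \<le> 1"
  using len_word_prod_le[of "[s]"] by auto

text \<open>The axiom for generators is the case of a one-letter left factor; induction along a word
  for u gives the full cocycle rule.\<close>

lemma eta_mult:
  assumes "u \<in> carrier W" "w \<in> carrier W" "x \<in> carrier W"
  shows "\<eta> (u \<otimes> w) x \<longleftrightarrow> \<eta> w x \<noteq> \<eta> u (w \<otimes> x \<otimes> inv w)"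
proof -
  have "\<eta> (word_prod us \<otimes> w) x \<longleftrightarrow> \<eta> w x \<noteq> \<eta> (word_prod us) (w \<otimes> x \<otimes> inv w)"
    if "us \<in> lists S" for us using that
  proof (induction us)
    case Nil then show ?case using assms by (simp add: eta_one)
  next
    case (Cons s us)
    have "word_prod us \<otimes> w \<otimes> x \<otimes> inv (word_prod us \<otimes> w)
        = word_prod us \<otimes> (w \<otimes> x \<otimes> inv w) \<otimes> inv (word_prod us)"
      using Cons assms by (simp add: inv_mult_group m_assoc)
    then show ?case using Cons assms by (simp add: m_assoc eta_gen) blast
  qed
  then show ?thesis using generated[OF assms(1)] by metis
qed

text \<open>Among the suffixes of ws there is a place where the value of \<eta> at x changes from
  false to true. The letter added there is the one that x deletes. This is the strong exchange
  condition.\<close>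

lemma eta_exchange:
  assumes "ws \<in> lists S" "x \<in> carrier W" "\<eta> (word_prod ws) x"
  shows "\<exists>a s b. ws = a @ s # b \<and> word_prod ws \<otimes> x = word_prod (a @ b)
    \<and> x = inv (word_prod b) \<otimes> s \<otimes> word_prod b"
  using assms
proof (induction ws)
  case Nil then show ?case by (simp add: eta_one)
next
  case (Cons s ws)
  let ?w = "word_prod ws"
  have [simp]: "s \<in> S" "ws \<in> lists S" "?w \<in> carrier W" using Cons by auto
  show ?case
  proof (cases "\<eta> ?w x")
    case True
    then obtain a r b where "ws = a @ r # b" "?w \<otimes> x = word_prod (a @ b)"
      "x = inv (word_prod b) \<otimes> r \<otimes> word_prod b" using Cons by auto
    moreover have "word_prod (s # ws) \<otimes> x = s \<otimes> (?w \<otimes> x)"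
      using Cons.prems by (simp add: m_assoc)
    ultimately have "s # ws = (s # a) @ r # b \<and> word_prod (s # ws) \<otimes> x = word_prod ((s # a) @ b)
        \<and> x = inv (word_prod b) \<otimes> r \<otimes> word_prod b"
      by simp
    then show ?thesis by blast
  next
    case False
    then have e: "?w \<otimes> x \<otimes> inv ?w = s" using Cons by (auto simp: eta_gen)
    have "inv ?w \<otimes> (?w \<otimes> x \<otimes> inv ?w) \<otimes> ?w = x"
      using Cons.prems by (simp add: m_assoc)
    then have x: "x = inv ?w \<otimes> s \<otimes> ?w" using e by simp
    have "?w \<otimes> x = s \<otimes> ?w"
      unfolding x by (simp flip: m_assoc)
    then have "word_prod (s # ws) \<otimes> x = word_prod ([] @ ws)"
      using Cons.prems by (simp add: m_assoc)
    then have "s # ws = [] @ s # ws \<and> word_prod (s # ws) \<otimes> x = word_prod ([] @ ws)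
        \<and> x = inv (word_prod ws) \<otimes> s \<otimes> word_prod ws"
      using x by simp
    then show ?thesis by blast
  qed
qed

lemma eta_len:
  assumes "w \<in> carrier W" "x \<in> carrier W" "\<eta> w x" shows "len (w \<otimes> x) < len w"
proof -
  obtain ws where ws: "reduced ws" "word_prod ws = w" using reduced_exists[OF assms(1)] by blast
  then obtain a s b where ab: "ws = a @ s # b" "w \<otimes> x = word_prod (a @ b)"
    using eta_exchange[of ws x] assms reduced_lists by metis
  have "a @ b \<in> lists S" using ws ab reduced_lists[of ws] by auto
  from len_word_prod_le[OF this] show ?thesis using ws ab by (auto simp: reduced_def)
qed

lemma reflections_closed [simp]: "x \<in> reflections \<Longrightarrow> x \<in> carrier W"
  by (auto simp: reflections_def)

lemma gen_reflection [simp]: "s \<in> S \<Longrightarrow> s \<in> reflections"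
proof -
  assume "s \<in> S"
  then have "s = \<one> \<otimes> s \<otimes> inv \<one>" by simp
  then show ?thesis using \<open>s \<in> S\<close> one_closed unfolding reflections_def by blast
qed

lemma conj_reflection [simp]:
  assumes "x \<in> reflections" "w \<in> carrier W"
  shows "w \<otimes> x \<otimes> inv w \<in> reflections" "inv w \<otimes> x \<otimes> w \<in> reflections"
proof -
  obtain u s where us: "u \<in> carrier W" "s \<in> S" "x = u \<otimes> s \<otimes> inv u"
    using assms unfolding reflections_def by blast
  have "w \<otimes> x \<otimes> inv w = (w \<otimes> u) \<otimes> s \<otimes> inv (w \<otimes> u)"
    using us(1,2) assms(2) unfolding us(3) by (simp add: inv_mult_group m_assoc)
  then show "w \<otimes> x \<otimes> inv w \<in> reflections" using us(1,2) assms(2)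
    unfolding reflections_def by blast
  have "inv w \<otimes> x \<otimes> w = (inv w \<otimes> u) \<otimes> s \<otimes> inv (inv w \<otimes> u)"
    using us(1,2) assms(2) unfolding us(3) by (simp add: inv_mult_group m_assoc)
  then show "inv w \<otimes> x \<otimes> w \<in> reflections" using us(1,2) assms(2)
    unfolding reflections_def by blast
qed

lemma reflection_sq:
  assumes "x \<in> reflections" shows "x \<otimes> x = \<one>"
proof -
  obtain u s where us: "u \<in> carrier W" "s \<in> S" "x = u \<otimes> s \<otimes> inv u"
    using assms unfolding reflections_def by blast
  show ?thesis using us(1,2) unfolding us(3) by (simp add: m_assoc)
qed

text \<open>For x = u s u^{-1} the factors u and u^{-1} contribute the same truth value, so they
  cancel and only the contribution of s at s is left.\<close>

lemma eta_self:
  assumes "x \<in> reflections" shows "\<eta> x x"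
proof -
  obtain u s where us: "u \<in> carrier W" "s \<in> S" "x = u \<otimes> s \<otimes> inv u"
    using assms unfolding reflections_def by blast
  have x: "x \<in> carrier W" using assms by simp
  have s: "inv u \<otimes> x \<otimes> inv (inv u) = s"
    using us(1,2) unfolding us(3) by (simp add: m_assoc)
  have "\<eta> (u \<otimes> inv u) x \<longleftrightarrow> \<eta> (inv u) x \<noteq> \<eta> u s"
    using eta_mult[of u "inv u" x] us(1) x s by simp
  then have 1: "\<eta> (inv u) x \<longleftrightarrow> \<eta> u s" using us x by (simp add: eta_one)
  have ss: "\<eta> s s" using eta_gen[of s \<one> s] us eta_one by simp
  have "s \<otimes> s \<otimes> inv s = s" using us by simp
  then have "\<eta> (u \<otimes> s) s \<longleftrightarrow> \<eta> s s \<noteq> \<eta> u s" using eta_mult[of u s s] us by simp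
  moreover have "\<eta> (u \<otimes> s \<otimes> inv u) x \<longleftrightarrow> \<eta> (inv u) x \<noteq> \<eta> (u \<otimes> s) s"
    using eta_mult[of "u \<otimes> s" "inv u" x] us(1,2) x s by simp
  ultimately show ?thesis using 1 ss us(3) by simp
qed

text \<open>Passing from w to w \<otimes> x flips \<eta> at x, so \<open>eta_len\<close> applies to
  exactly one of the two elements.\<close>

lemma len_reflection:
  assumes "w \<in> carrier W" "x \<in> reflections"
  shows "len (w \<otimes> x) < len w \<longleftrightarrow> \<eta> w x" "len w < len (w \<otimes> x) \<longleftrightarrow> \<not> \<eta> w x"
proof -
  have "\<eta> (w \<otimes> x) x \<longleftrightarrow> \<not> \<eta> w x"
    using eta_mult[of w x x] assms eta_self[of x] reflection_sq[of x]
    by (simp add: inv_equality)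
  moreover have "w \<otimes> x \<otimes> x = w" using assms by (simp add: m_assoc reflection_sq)
  ultimately have "\<not> \<eta> w x \<Longrightarrow> len w < len (w \<otimes> x)"
    using eta_len[of "w \<otimes> x" x] assms by auto
  then show "len (w \<otimes> x) < len w \<longleftrightarrow> \<eta> w x" "len w < len (w \<otimes> x) \<longleftrightarrow> \<not> \<eta> w x"
    using eta_len[of w x] assms by fastforce+
qed

lemma gen_mult_conj:
  assumes "s \<in> S" "w \<in> carrier W"
  shows "w \<otimes> (inv w \<otimes> s \<otimes> w) = s \<otimes> w"
  using assms by (simp flip: m_assoc)

text \<open>A left factor s equals the right factor w^{-1} s w, a reflection, so the lengths of w
  and s \<otimes> w differ; subadditivity bounds the difference by one.\<close>

lemma len_gen_cases:
  assumes "s \<in> S" "w \<in> carrier W"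
  obtains "len (s \<otimes> w) = Suc (len w)" | "len w = Suc (len (s \<otimes> w))"
proof -
  have "len (s \<otimes> w) \<noteq> len w"
    using len_reflection[of w "inv w \<otimes> s \<otimes> w"] assms by (auto simp: gen_mult_conj)
  moreover have "len (s \<otimes> w) \<le> Suc (len w)" "len w \<le> Suc (len (s \<otimes> w))"
    using len_mult_le[of s w] len_mult_le[of s "s \<otimes> w"] len_gen_le[of s] assms by auto
  ultimately show thesis using that by linarith
qed

lemma len_gen_cases_right:
  assumes "s \<in> S" "w \<in> carrier W"
  obtains "len (w \<otimes> s) = Suc (len w)" | "len w = Suc (len (w \<otimes> s))"
proof -
  have "len (inv (w \<otimes> s)) = len (s \<otimes> inv w)" using assms by (simp add: inv_mult_group)
  then have "len (w \<otimes> s) = len (s \<otimes> inv w)" using assms by simp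
  then show thesis using that len_gen_cases[of s "inv w"] assms by auto
qed

lemma len_gen [simp]: "s \<in> S \<Longrightarrow> len s = 1"
  using len_gen_cases[of s \<one>] by (cases rule: len_gen_cases[of s \<one>]) auto

text \<open>The reflection that turns \<open>w\<close> into \<open>w \<otimes> t\<close> is also the one that turns it into \<open>s \<otimes> w\<close> only
  if both products agree; otherwise \<open>s\<close> does not affect whether \<open>t\<close> is a descent.\<close>

lemma descent_left_right:
  assumes "s \<in> S" "t \<in> S" "w \<in> carrier W" "s \<otimes> w \<noteq> w \<otimes> t"
  shows "len (s \<otimes> w \<otimes> t) < len (s \<otimes> w) \<longleftrightarrow> len (w \<otimes> t) < len w"
    and "len (s \<otimes> (w \<otimes> t)) < len (w \<otimes> t) \<longleftrightarrow> len (s \<otimes> w) < len w"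
proof -
  have 1: "len (s \<otimes> w \<otimes> t) < len (s \<otimes> w) \<longleftrightarrow> len (w \<otimes> t) < len w"
    if "s \<in> S" "t \<in> S" "w \<in> carrier W" "s \<otimes> w \<noteq> w \<otimes> t" for s t w
  proof -
    have "w \<otimes> t \<otimes> inv w \<noteq> s"
    proof
      assume "w \<otimes> t \<otimes> inv w = s"
      then have "w \<otimes> t \<otimes> inv w \<otimes> w = s \<otimes> w" by simp
      then show False using that by (simp add: m_assoc)
    qed
    then show ?thesis using that by (simp add: len_reflection eta_gen)
  qed
  show "len (s \<otimes> w \<otimes> t) < len (s \<otimes> w) \<longleftrightarrow> len (w \<otimes> t) < len w" using 1 assms by blast
  have "inv (s \<otimes> w) \<noteq> inv (w \<otimes> t)" using assms by (metis gen_closed inv_inv m_closed)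
  then have "t \<otimes> inv w \<noteq> inv w \<otimes> s" using assms by (simp add: inv_mult_group)
  from 1[OF assms(2,1) inv_closed[OF assms(3)] this]
  have "len (inv (t \<otimes> inv w \<otimes> s)) < len (inv (t \<otimes> inv w)) \<longleftrightarrow> len (inv (inv w \<otimes> s)) < len (inv (inv w))"
    using assms by (simp del: inv_inv)
  then show "len (s \<otimes> (w \<otimes> t)) < len (w \<otimes> t) \<longleftrightarrow> len (s \<otimes> w) < len w"
    using assms by (simp add: inv_mult_group)
qed

section \<open>Bruhat order\<close>

definition bruhat_edge :: "'a \<Rightarrow> 'a \<Rightarrow> bool" where
  "bruhat_edge u v \<longleftrightarrow> (\<exists>t \<in> reflections. v = u \<otimes> t \<and> len u < len v)"

lemma bruhat_le_edge:
  "bruhat_le y w \<longleftrightarrow> y \<in> carrier W \<and> w \<in> carrier W \<and> bruhat_edge\<^sup>*\<^sup>* y w"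
  by (simp add: bruhat_le_def bruhat_edge_def[abs_def])

lemma bruhat_edge_closed: "bruhat_edge u v \<Longrightarrow> u \<in> carrier W \<Longrightarrow> v \<in> carrier W"
  by (auto simp: bruhat_edge_def)

lemma bruhat_le_refl [simp]: "w \<in> carrier W \<Longrightarrow> bruhat_le w w"
  by (simp add: bruhat_le_edge)

lemma bruhat_le_trans: "bruhat_le x y \<Longrightarrow> bruhat_le y z \<Longrightarrow> bruhat_le x z"
  by (auto simp: bruhat_le_edge)

lemma bruhat_edge_le: "bruhat_edge u v \<Longrightarrow> u \<in> carrier W \<Longrightarrow> bruhat_le u v"
  using bruhat_edge_closed by (auto simp: bruhat_le_edge)

lemma bruhat_le_closed: "bruhat_le y w \<Longrightarrow> y \<in> carrier W \<and> w \<in> carrier W"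
  by (auto simp: bruhat_le_edge)

lemma bruhat_le_len: "bruhat_le y w \<Longrightarrow> y = w \<or> len y < len w"
proof -
  have "bruhat_edge\<^sup>*\<^sup>* y w \<Longrightarrow> y = w \<or> len y < len w"
    by (induction rule: rtranclp_induct) (auto simp: bruhat_edge_def)
  then show "bruhat_le y w \<Longrightarrow> y = w \<or> len y < len w" by (auto simp: bruhat_le_edge)
qed

lemma bruhat_edge_left:
  assumes "s \<in> S" "w \<in> carrier W" "len w < len (s \<otimes> w)"
  shows "bruhat_edge w (s \<otimes> w)"
  using assms unfolding bruhat_edge_def
  by (intro bexI[of _ "inv w \<otimes> s \<otimes> w"]) (auto simp: gen_mult_conj)

lemma bruhat_edge_right:
  assumes "s \<in> S" "w \<in> carrier W" "len w < len (w \<otimes> s)"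
  shows "bruhat_edge w (w \<otimes> s)"
  using assms unfolding bruhat_edge_def by (intro bexI[of _ s]) auto

text \<open>Unless the reflection t of the edge is the one with s u = u t, multiplying by s on the
  left does not change the value of \<eta> at t, so the edge keeps its direction.\<close>

lemma bruhat_edge_mult_left:
  assumes "s \<in> S" "u \<in> carrier W" "bruhat_edge u v"
  shows "s \<otimes> u = v \<or> bruhat_edge (s \<otimes> u) (s \<otimes> v)"
proof -
  obtain t where t: "t \<in> reflections" "v = u \<otimes> t" "len u < len v"
    using assms by (auto simp: bruhat_edge_def)
  show ?thesis
  proof (cases "u \<otimes> t \<otimes> inv u = s")
    case True
    then have "u \<otimes> t \<otimes> inv u \<otimes> u = s \<otimes> u" by simp
    then show ?thesis using t assms by (simp add: m_assoc)
  next
    case False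
    then have "\<not> \<eta> (s \<otimes> u) t" using t assms by (simp add: eta_gen len_reflection)
    then have "len (s \<otimes> u) < len (s \<otimes> u \<otimes> t)" using t assms by (simp add: len_reflection)
    then show ?thesis using t assms unfolding bruhat_edge_def by (auto simp: m_assoc)
  qed
qed

lemma bruhat_edge_mult_right:
  assumes "s \<in> S" "u \<in> carrier W" "bruhat_edge u v"
  shows "u \<otimes> s = v \<or> bruhat_edge (u \<otimes> s) (v \<otimes> s)"
proof -
  obtain t where t: "t \<in> reflections" "v = u \<otimes> t" "len u < len v"
    using assms by (auto simp: bruhat_edge_def)
  show ?thesis
  proof (cases "t = s")
    case False
    \<comment> \<open>Multiplying the edge from u to u t by s on the right conjugates its
      reflection: u t s = (u s)(s t s).\<close>
    let ?r = "s \<otimes> t \<otimes> s"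
    have r: "?r \<in> reflections" using conj_reflection(1)[of t s] t assms by simp
    have c: "s \<otimes> ?r \<otimes> s = t" using t assms by (simp add: m_assoc)
    have "?r \<noteq> s"
    proof
      assume "?r = s"
      then have "s \<otimes> ?r \<otimes> s = s" using assms by (simp add: gen_sq)
      then show False using c False by simp
    qed
    then have "\<not> \<eta> s ?r" using eta_gen[of s \<one> ?r] eta_one assms r by auto
    then have "\<not> \<eta> (u \<otimes> s) ?r" using eta_mult[of u s ?r] t r c assms by (simp add: len_reflection)
    then have "len (u \<otimes> s) < len (u \<otimes> s \<otimes> ?r)" using r assms by (simp add: len_reflection)
    moreover have "u \<otimes> s \<otimes> ?r = v \<otimes> s" using t assms by (simp add: m_assoc)
    ultimately show ?thesis using r unfolding bruhat_edge_def by metis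
  qed (use t in simp)
qed

section \<open>Descent sets\<close>

lemma left_descents_iff:
  assumes "w \<in> carrier W"
  shows "s \<in> left_descents w \<longleftrightarrow> s \<in> S \<and> len (s \<otimes> w) < len w"
proof (cases "s \<in> S")
  case s: True
  have "bruhat_le (s \<otimes> w) w" if "len (s \<otimes> w) < len w"
    using bruhat_edge_le bruhat_edge_left[of s "s \<otimes> w"] that s assms by simp
  then show ?thesis using s bruhat_le_len[of "s \<otimes> w" w]
    by (auto simp: left_descents_def bruhat_less_def)
qed (simp add: left_descents_def)

lemma right_descents_iff:
  assumes "w \<in> carrier W"
  shows "s \<in> right_descents w \<longleftrightarrow> s \<in> S \<and> len (w \<otimes> s) < len w"
proof (cases "s \<in> S")
  case s: True
  have "bruhat_le (w \<otimes> s) w" if "len (w \<otimes> s) < len w"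
    using bruhat_edge_le bruhat_edge_right[of s "w \<otimes> s"] that s assms by simp
  then show ?thesis using s bruhat_le_len[of "w \<otimes> s" w]
    by (auto simp: right_descents_def bruhat_less_def)
qed (simp add: right_descents_def)

lemma left_descents_inv: "w \<in> carrier W \<Longrightarrow> left_descents (inv w) = right_descents w"
proof -
  assume w: "w \<in> carrier W"
  have "len (s \<otimes> inv w) = len (w \<otimes> s)" if "s \<in> S" for s
    using len_inv[of "w \<otimes> s"] that w by (simp add: inv_mult_group)
  then show ?thesis using w by (auto simp: left_descents_iff right_descents_iff)
qed

lemma right_descents_inv: "w \<in> carrier W \<Longrightarrow> right_descents (inv w) = left_descents w"
  using left_descents_inv[of "inv w"] by simp

lemma left_descents_one [simp]: "left_descents \<one> = {}"
  by (auto simp: left_descents_iff)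

lemma right_descents_one [simp]: "right_descents \<one> = {}"
  by (auto simp: right_descents_iff)

lemma left_descents_gens: "left_descents w \<subseteq> S"
  by (auto simp: left_descents_def)

lemma right_descents_gens: "right_descents w \<subseteq> S"
  by (auto simp: right_descents_def)

lemma reduced_ConsI:
  assumes "w \<in> carrier W" "s \<in> left_descents w" "reduced ws" "word_prod ws = s \<otimes> w"
  shows "reduced (s # ws)" "word_prod (s # ws) = w"
proof -
  have s: "s \<in> S" "len (s \<otimes> w) < len w" using assms by (auto simp: left_descents_iff)
  then show "word_prod (s # ws) = w" using assms by simp
  moreover have "len w = Suc (len (s \<otimes> w))" using s assms by (auto elim: len_gen_cases)
  ultimately show "reduced (s # ws)" using assms s by (simp add: reduced_def)
qed

lemma left_descents_nonempty:
  assumes "w \<in> carrier W" "w \<noteq> \<one>" shows "left_descents w \<noteq> {}"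
proof -
  obtain ws where ws: "reduced ws" "word_prod ws = w" using reduced_exists assms by blast
  then obtain s us where us: "ws = s # us" using assms by (cases ws) auto
  then have "len (s \<otimes> w) < len w" 
    using ws len_word_prod_le[of us] by (auto simp: reduced_def)
  then have "s \<in> left_descents w"
    using ws us assms by (simp add: left_descents_iff reduced_def)
  then show ?thesis by blast
qed

lemma right_descents_nonempty:
  "w \<in> carrier W \<Longrightarrow> w \<noteq> \<one> \<Longrightarrow> right_descents w \<noteq> {}"
  using left_descents_nonempty[of "inv w"] inv_eq_1_iff[of w] by (simp add: left_descents_inv)

lemma eta_gen_self: "s \<in> S \<Longrightarrow> x \<in> carrier W \<Longrightarrow> \<eta> s x \<longleftrightarrow> x = s"
  using eta_gen[of s \<one> x] eta_one[of x] by auto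

end

text \<open>The maps \<open>uminus\<close> and \<open>1 - x\<close> are the reflections of the
  integers in 0 and 1/2; their composite is a translation. Thus \<open>dihedral\<close> expresses
  that two noncommuting generators have a product of infinite order, in a form that a presentation
  can supply. The axiom \<open>no_triangle\<close> limits sets of pairwise commuting generators to
  two elements.\<close>

locale right_angled_system = coxeter_system W S \<eta>
  for W :: "('a, 'm) monoid_scheme" (structure) and S :: "'a set" and \<eta> +
  assumes finite_gens: "finite S"
    and dihedral: "s \<in> S \<Longrightarrow> t \<in> S \<Longrightarrow> s \<otimes> t \<noteq> t \<otimes> s \<Longrightarrow>
      \<exists>\<psi> :: 'a \<Rightarrow> int \<Rightarrow> int. (\<forall>u \<in> carrier W. \<forall>w \<in> carrier W. \<psi> (u \<otimes> w) = \<psi> u \<circ> \<psi> w)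
        \<and> \<psi> s = uminus \<and> \<psi> t = (\<lambda>x. 1 - x)"
    and no_triangle: "s \<in> S \<Longrightarrow> t \<in> S \<Longrightarrow> r \<in> S \<Longrightarrow>
      s \<otimes> t = t \<otimes> s \<Longrightarrow> t \<otimes> r = r \<otimes> t \<Longrightarrow> s \<otimes> r = r \<otimes> s \<Longrightarrow> s = t \<or> t = r \<or> s = r"
begin

text \<open>In the dihedral group of s and t, \<open>palindrome s t k\<close> is the reflection
  given by the alternating word of length 2k + 1 that begins and ends with s;
  \<open>alternating s t k\<close> is the alternating product of k letters that ends in s.\<close>

fun palindrome :: "'a \<Rightarrow> 'a \<Rightarrow> nat \<Rightarrow> 'a" where
  "palindrome s t 0 = s"
| "palindrome s t (Suc k) = s \<otimes> palindrome t s k \<otimes> s"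

fun alternating :: "'a \<Rightarrow> 'a \<Rightarrow> nat \<Rightarrow> 'a" where
  "alternating s t 0 = \<one>"
| "alternating s t (Suc k) = alternating t s k \<otimes> s"

lemma palindrome_closed [simp]: "s \<in> S \<Longrightarrow> t \<in> S \<Longrightarrow> palindrome s t k \<in> carrier W"
  by (induction s t k rule: palindrome.induct) auto

lemma alternating_closed [simp]: "s \<in> S \<Longrightarrow> t \<in> S \<Longrightarrow> alternating s t k \<in> carrier W"
  by (induction s t k rule: alternating.induct) auto

text \<open>On the integers the two palindromes act as the reflections in -k/2 and (k+1)/2, while t
  and s are the reflections in 1/2 and 0. Evaluation at 0 separates them.\<close>

lemma palindrome_neq:
  assumes "s \<in> S" "t \<in> S" "s \<otimes> t \<noteq> t \<otimes> s"
  shows "palindrome s t k \<noteq> t" "palindrome t s k \<noteq> s"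
proof -
  obtain \<psi> :: "'a \<Rightarrow> int \<Rightarrow> int" where \<psi>:
    "\<And>u w. u \<in> carrier W \<Longrightarrow> w \<in> carrier W \<Longrightarrow> \<psi> (u \<otimes> w) = \<psi> u \<circ> \<psi> w"
    "\<psi> s = uminus" "\<psi> t = (\<lambda>x. 1 - x)"
    using dihedral[OF assms] by blast
  have "\<psi> (palindrome s t k) = (\<lambda>x. - int k - x) \<and> \<psi> (palindrome t s k) = (\<lambda>x. int k + 1 - x)"
  proof (induction k)
    case (Suc k) then show ?case using assms by (simp add: \<psi> fun_eq_iff)
  qed (simp add: \<psi> fun_eq_iff)
  then have "\<psi> (palindrome s t k) 0 \<noteq> \<psi> t 0" "\<psi> (palindrome t s k) 0 \<noteq> \<psi> s 0"
    by (simp_all add: \<psi>)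
  then show "palindrome s t k \<noteq> t" "palindrome t s k \<noteq> s" by auto
qed

text \<open>Conjugating a palindrome by the next letter of the alternating word only lengthens it,
  so it never equals the letter being multiplied and \<eta> never changes its value.\<close>

lemma not_eta_alternating:
  assumes "s \<in> S" "t \<in> S" "s \<otimes> t \<noteq> t \<otimes> s"
  shows "\<not> \<eta> (alternating t s k) (palindrome s t j)"
  using assms
proof (induction k arbitrary: s t j)
  case 0 then show ?case by (simp add: eta_one)
next
  case (Suc k)
  have "\<not> \<eta> t (palindrome s t j)" using Suc.prems palindrome_neq by (simp add: eta_gen_self)
  moreover have "\<not> \<eta> (alternating s t k) (palindrome t s (Suc j))"
    using Suc.IH[of t s "Suc j"] Suc.prems by simp
  ultimately show ?case using Suc.prems eta_mult[of "alternating s t k" t "palindrome s t j"] by simp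
qed

text \<open>If \<open>s\<close>, \<open>t\<close> did not commute, alternating words in them of any length could be split off from
  the right of \<open>w\<close>.\<close>

lemma right_descents_commute:
  assumes "w \<in> carrier W" "s \<in> right_descents w" "t \<in> right_descents w"
  shows "s \<otimes> t = t \<otimes> s"
proof (rule ccontr)
  assume nc: "s \<otimes> t \<noteq> t \<otimes> s"
  have st: "s \<in> S" "t \<in> S" "\<eta> w s" "\<eta> w t"
    using assms by (auto simp: right_descents_iff len_reflection)
  \<comment> \<open>The letter a shortens w, but not its alternating factor \<open>?d\<close>. By
    the cocycle rule the conjugate of a by \<open>?d\<close> shortens x, and moving a through
    \<open>?d\<close> makes the alternating factor longer by one letter.\<close>
  have step: "\<exists>y \<in> carrier W. len y + Suc k \<le> len w \<and> w = y \<otimes> alternating a b (Suc k)"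
    if "a \<in> S" "b \<in> S" "a \<otimes> b \<noteq> b \<otimes> a" "\<eta> w a" 
      "x \<in> carrier W" "len x + k \<le> len w" "w = x \<otimes> alternating b a k" for a b k x
  proof -
    let ?d = "alternating b a k" and ?y = "x \<otimes> (alternating b a k \<otimes> a \<otimes> inv (alternating b a k))"
    have "\<not> \<eta> ?d a" using not_eta_alternating[of a b k 0] that by simp
    then have "\<eta> x (?d \<otimes> a \<otimes> inv ?d)" using that eta_mult[of x ?d a] by simp
    then have "len ?y < len x" using that by (simp add: len_reflection)
    moreover have "?y \<otimes> alternating a b (Suc k) = w" using that by (simp add: m_assoc gen_sq)
    ultimately show ?thesis using that by (intro bexI[of _ ?y]) auto
  qed
  have "(\<exists>x \<in> carrier W. len x + k \<le> len w \<and> w = x \<otimes> alternating s t k) \<and>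
    (\<exists>x \<in> carrier W. len x + k \<le> len w \<and> w = x \<otimes> alternating t s k)" for k
  proof (induction k)
    case 0 then show ?case using assms by auto
  next
    case (Suc k) then show ?case using step[of s t] step[of t s] st nc by metis
  qed
  from this[of "Suc (len w)"] show False by auto
qed

lemma left_descents_commute:
  "w \<in> carrier W \<Longrightarrow> s \<in> left_descents w \<Longrightarrow> t \<in> left_descents w \<Longrightarrow> s \<otimes> t = t \<otimes> s"
  using right_descents_commute[of "inv w" s t] by (simp add: right_descents_inv)

text \<open>If t commutes with s, then conjugation by s fixes t and its value of \<eta> is
  unchanged. If it does not, it cannot be a right descent alongside s by
  \<open>right_descents_commute\<close>.\<close>

lemma right_descents_mult:
  assumes "w \<in> carrier W" "s \<in> S" "s \<notin> right_descents w"
  shows "right_descents (w \<otimes> s) = insert s {t \<in> right_descents w. s \<otimes> t = t \<otimes> s}"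
proof -
  have s: "s \<in> right_descents (w \<otimes> s)"
    using assms by (auto simp: right_descents_iff elim: len_gen_cases_right)
  have "t \<in> right_descents (w \<otimes> s) \<longleftrightarrow> t \<in> right_descents w \<and> s \<otimes> t = t \<otimes> s"
    if t: "t \<noteq> s" "t \<in> S" for t
  proof (cases "s \<otimes> t = t \<otimes> s")
    case True
    then have "s \<otimes> t \<otimes> s = t" using assms t by (simp add: m_assoc gen_sq)
    then have "\<eta> (w \<otimes> s) t \<longleftrightarrow> \<eta> w t"
      using eta_mult[of w s t] assms t by (simp add: eta_gen_self)
    then show ?thesis using True assms t by (simp add: right_descents_iff len_reflection)
  next
    case False
    then show ?thesis using right_descents_commute[of "w \<otimes> s" s t] s assms by auto
  qed
  then have "x \<in> right_descents (w \<otimes> s) \<longleftrightarrow> x \<in> insert s {t \<in> right_descents w. s \<otimes> t = t \<otimes> s}" for x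
    using s right_descents_gens[of w] right_descents_gens[of "w \<otimes> s"] by (cases "x = s") auto
  then show ?thesis by blast
qed

lemma left_descents_mult:
  assumes "w \<in> carrier W" "s \<in> S" "s \<notin> left_descents w"
  shows "left_descents (s \<otimes> w) = insert s {t \<in> left_descents w. s \<otimes> t = t \<otimes> s}"
  using right_descents_mult[of "inv w" s] right_descents_inv[of "s \<otimes> w"] assms
  by (simp add: right_descents_inv inv_mult_group)

lemma pairwise_commuting_cases:
  assumes "A \<subseteq> S" "\<And>s t. s \<in> A \<Longrightarrow> t \<in> A \<Longrightarrow> s \<otimes> t = t \<otimes> s"
  obtains "A = {}" | s where "A = {s}" | s t where "A = {s, t}" "s \<noteq> t"
proof (cases "\<exists>s t. s \<in> A \<and> t \<in> A \<and> s \<noteq> t")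
  case True
  then obtain s t where st: "s \<in> A" "t \<in> A" "s \<noteq> t" by blast
  have "r \<in> {s, t}" if "r \<in> A" for r
    using no_triangle[of s t r] assms st that by blast
  then show thesis using that(3)[of s t] st by blast
next
  case False
  then show thesis using that(1,2) by blast
qed

lemma left_descents_cases:
  assumes "w \<in> carrier W"
  obtains "w = \<one>" | s where "left_descents w = {s}" 
  | s t where "left_descents w = {s, t}" "s \<noteq> t" "s \<in> S" "t \<in> S" "s \<otimes> t = t \<otimes> s"
proof (rule pairwise_commuting_cases[of "left_descents w"])
  show "left_descents w \<subseteq> S" by (rule left_descents_gens)
  show "\<And>s t. s \<in> left_descents w \<Longrightarrow> t \<in> left_descents w \<Longrightarrow> s \<otimes> t = t \<otimes> s"
    using left_descents_commute assms by blast
next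
  assume "left_descents w = {}" then show thesis using that(1) left_descents_nonempty assms by blast
next
  fix s assume "left_descents w = {s}" then show thesis using that(2) by blast
next
  fix s t assume "left_descents w = {s, t}" "s \<noteq> t"
  then show thesis using that(3)[of s t] left_descents_commute[OF assms, of s t] left_descents_gens[of w]
    by auto
qed

lemma right_descents_cases:
  assumes "w \<in> carrier W"
  obtains "w = \<one>" | s where "right_descents w = {s}" 
  | s t where "right_descents w = {s, t}" "s \<noteq> t" "s \<in> S" "t \<in> S" "s \<otimes> t = t \<otimes> s"
  using left_descents_cases[of "inv w"] assms inv_eq_1_iff[of w] by (simp add: left_descents_inv) metis

end

section \<open>The Hecke algebra\<close>

abbreviation "lookup \<equiv> Poly_Mapping.lookup"
abbreviation "keys \<equiv> Poly_Mapping.keys"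

section \<open>Laurent polynomials in the square root of q\<close>

lemma qhalf_pow_0 [simp]: "qhalf_pow 0 = 1"
  by (simp add: qhalf_pow_def)

lemma qhalf_pow_mult [simp]: "qhalf_pow a * qhalf_pow b = qhalf_pow (a + b)"
  by (simp add: qhalf_pow_def mult_single)

lemma qhalf_pow_mult_left [simp]: "qhalf_pow a * (qhalf_pow b * x) = qhalf_pow (a + b) * x"
  by (simp flip: mult.assoc)

lemma lookup_qhalf_pow_mult [simp]: "lookup (qhalf_pow a * x) k = lookup x (k - a)"
proof (induction x arbitrary: k rule: update_induct)
  case (update f b c)
  have e: "Poly_Mapping.update b c f = f + Poly_Mapping.single b c"
    using update by (intro poly_mapping_eqI)
      (auto simp: lookup_update lookup_add lookup_single in_keys_iff when_def)
  show ?case using update.IH unfolding e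
    by (simp add: distrib_left lookup_add qhalf_pow_def mult_single lookup_single)
      (auto simp: when_def)
qed simp

lemma lookup_laurent_bar [simp]: "lookup (laurent_bar a) k = lookup a (- k)"
  by (simp add: laurent_bar_def map_key.rep_eq)

lemma laurent_bar_add [simp]: "laurent_bar (a + b) = laurent_bar a + laurent_bar b"
  by (rule poly_mapping_eqI) (simp add: lookup_add)

lemma laurent_bar_qhalf_pow [simp]: "laurent_bar (qhalf_pow k) = qhalf_pow (- k)"
  by (rule poly_mapping_eqI) (auto simp: qhalf_pow_def lookup_single when_def)

lemma laurent_bar_one [simp]: "laurent_bar 1 = 1"
  using laurent_bar_qhalf_pow[of 0] by simp

lemma laurent_bar_zero [simp]: "laurent_bar 0 = 0"
  by (rule poly_mapping_eqI) simp

lemma laurent_bar_bar [simp]: "laurent_bar (laurent_bar a) = a"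
  by (rule poly_mapping_eqI) simp

lemma laurent_induct [case_names zero monomial add]:
  assumes "P 0" "\<And>k c. P (Poly_Mapping.single k c)" "\<And>a b. P a \<Longrightarrow> P b \<Longrightarrow> P (a + b)"
  shows "P (a :: laurent)"
proof (induction a rule: update_induct)
  case (update f b c)
  have e: "Poly_Mapping.update b c f = f + Poly_Mapping.single b c"
    using update by (intro poly_mapping_eqI)
      (auto simp: lookup_update lookup_add lookup_single in_keys_iff when_def)
  show ?case unfolding e using update assms by simp
qed (rule assms)

lemma laurent_bar_single: "laurent_bar (Poly_Mapping.single k c) = Poly_Mapping.single (- k) c"
  by (rule poly_mapping_eqI) (auto simp: lookup_single when_def)

lemma laurent_bar_mult [simp]: "laurent_bar (a * b) = laurent_bar a * laurent_bar b"
proof (induction a rule: laurent_induct)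
  case (monomial k c)
  show ?case
  proof (induction b rule: laurent_induct)
    case (monomial l d) then show ?case by (simp add: laurent_bar_single mult_single)
  qed (simp_all add: distrib_left)
qed (simp_all add: distrib_right)

lemma lookup_scale [simp]: "lookup (scale a h) w = a * lookup h w"
  by (auto simp: scale_def Poly_Mapping.map.rep_eq when_def)

lemma scale_add: "scale a (g + h) = scale a g + scale a h"
  by (rule poly_mapping_eqI) (simp add: lookup_add distrib_left)

lemma scale_diff: "scale a (g - h) = scale a g - scale a h"
  by (rule poly_mapping_eqI) (simp add: lookup_minus right_diff_distrib)

lemma scale_scale [simp]: "scale a (scale b h) = scale (a * b) h"
  by (rule poly_mapping_eqI) (simp add: mult.assoc)

lemma scale_one [simp]: "scale 1 h = h"
  by (rule poly_mapping_eqI) simp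

lemma scale_zero [simp]: "scale 0 h = 0" "scale a 0 = 0"
  by (rule poly_mapping_eqI; simp)+

lemma scale_sum: "scale a (sum f A) = (\<Sum>x\<in>A. scale a (f x))"
  by (induction A rule: infinite_finite_induct) (auto simp: scale_add)

lemma scale_add_left: "scale (a + b) h = scale a h + scale b h"
  by (rule poly_mapping_eqI) (simp add: lookup_add distrib_right)

lemma keys_scale: "keys (scale a h) \<subseteq> keys h"
  by (auto simp: in_keys_iff)

lemma expand_support:
  assumes "finite A" "keys h \<subseteq> A"
  shows "h = (\<Sum>w\<in>A. scale (lookup h w) (Poly_Mapping.single w 1))"
proof (rule poly_mapping_eqI)
  fix k
  have "(\<Sum>w\<in>A. lookup h w * (1 when w = k)) = (\<Sum>w\<in>A. if w = k then lookup h w else 0)"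
    by (rule sum.cong) (auto simp: when_def)
  also have "\<dots> = lookup h k" using assms by (auto simp: in_keys_iff)
  finally show "lookup h k = lookup (\<Sum>w\<in>A. scale (lookup h w) (Poly_Mapping.single w 1)) k"
    by (simp add: lookup_sum lookup_single)
qed

section \<open>Linear maps between free modules\<close>

definition linear_op :: "(('a \<Rightarrow>\<^sub>0 laurent) \<Rightarrow> ('b \<Rightarrow>\<^sub>0 laurent)) \<Rightarrow> bool" where
  "linear_op F \<longleftrightarrow> (\<forall>g h. F (g + h) = F g + F h) \<and> (\<forall>a h. F (scale a h) = scale a (F h))"

definition linear_ext :: "('a \<Rightarrow> ('b \<Rightarrow>\<^sub>0 laurent)) \<Rightarrow> ('a \<Rightarrow>\<^sub>0 laurent) \<Rightarrow> ('b \<Rightarrow>\<^sub>0 laurent)" where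
  "linear_ext f h = (\<Sum>w\<in>keys h. scale (lookup h w) (f w))"

lemma linear_opD:
  assumes "linear_op F"
  shows "F (g + h) = F g + F h" "F (scale a h) = scale a (F h)" "F 0 = 0"
    "F (- h) = - F h" "F (g - h) = F g - F h" "F (sum k A) = (\<Sum>x\<in>A. F (k x))"
proof -
  show *: "F (g + h) = F g + F h" "F (scale a h) = scale a (F h)" for g h a
    using assms by (auto simp: linear_op_def)
  show 0: "F 0 = 0" using *(2)[of 0 0] by simp
  show m: "F (- h) = - F h" for h using *(1)[of h "- h"] 0 by (simp add: eq_neg_iff_add_eq_0 add.commute)
  show "F (g - h) = F g - F h" using *(1)[of g "- h"] m by simp
  show "F (sum k A) = (\<Sum>x\<in>A. F (k x))"
    by (induction A rule: infinite_finite_induct) (auto simp: * 0)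
qed

lemma linear_ext_superset:
  assumes "finite A" "keys h \<subseteq> A"
  shows "linear_ext f h = (\<Sum>w\<in>A. scale (lookup h w) (f w))"
  unfolding linear_ext_def using assms by (intro sum.mono_neutral_left) (auto simp: in_keys_iff)

lemma linear_ext_linear [simp]: "linear_op (linear_ext f)"
proof -
  have "linear_ext f (g + h) = linear_ext f g + linear_ext f h" for g h
    using linear_ext_superset[of "keys g \<union> keys h" g f] linear_ext_superset[of "keys g \<union> keys h" h f]
      linear_ext_superset[of "keys g \<union> keys h" "g + h" f] keys_add[of g h]
    by (simp add: lookup_add scale_add_left sum.distrib)
  moreover have "linear_ext f (scale a h) = scale a (linear_ext f h)" for a h
    using linear_ext_superset[of "keys h" h f] linear_ext_superset[of "keys h" "scale a h" f]
      keys_scale[of a h] by (simp add: scale_sum)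
  ultimately show ?thesis by (simp add: linear_op_def)
qed

lemma linear_ext_single [simp]: "linear_ext f (Poly_Mapping.single w 1) = f w"
  by (simp add: linear_ext_def)

lemma linear_op_id [simp]: "linear_op (\<lambda>h. h)"
  by (simp add: linear_op_def)

lemma linear_op_comp: "linear_op F \<Longrightarrow> linear_op G \<Longrightarrow> linear_op (\<lambda>h. F (G h))"
  by (simp add: linear_op_def)

lemma linear_op_scale: "linear_op F \<Longrightarrow> linear_op (\<lambda>h. scale a (F h))"
  by (simp add: linear_op_def scale_add mult.commute)

lemma linear_op_add: "linear_op F \<Longrightarrow> linear_op G \<Longrightarrow> linear_op (\<lambda>h. F h + G h)"
  by (simp add: linear_op_def scale_add add_ac)

lemma linear_op_diff: "linear_op F \<Longrightarrow> linear_op G \<Longrightarrow> linear_op (\<lambda>h. F h - G h)"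
  by (simp add: linear_op_def scale_diff)

lemma linear_op_sum: "(\<And>x. x \<in> A \<Longrightarrow> linear_op (F x)) \<Longrightarrow> linear_op (\<lambda>h. \<Sum>x\<in>A. F x h)"
  by (simp add: linear_op_def sum.distrib scale_sum)

lemma linear_op_eqI:
  assumes "linear_op F" "linear_op G" 
    "\<And>w. w \<in> keys h \<Longrightarrow> F (Poly_Mapping.single w 1) = G (Poly_Mapping.single w 1)"
  shows "F h = G h"
proof -
  have "F h = (\<Sum>w\<in>keys h. scale (lookup h w) (F (Poly_Mapping.single w 1)))"
    by (subst expand_support[of "keys h" h]) (simp_all add: linear_opD[OF assms(1)])
  moreover have "G h = (\<Sum>w\<in>keys h. scale (lookup h w) (G (Poly_Mapping.single w 1)))"
    by (subst expand_support[of "keys h" h]) (simp_all add: linear_opD[OF assms(2)])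
  ultimately show ?thesis using assms(3) by (simp cong: sum.cong)
qed

definition free_on :: "'a set \<Rightarrow> ('a \<Rightarrow>\<^sub>0 laurent) set" where
  "free_on A = {h. keys h \<subseteq> A}"

lemma free_on_iff: "h \<in> free_on A \<longleftrightarrow> (\<forall>w. w \<notin> A \<longrightarrow> lookup h w = 0)"
  by (auto simp: free_on_def in_keys_iff)

lemma free_on_0 [simp]: "0 \<in> free_on A"
  by (simp add: free_on_def)

lemma free_on_single [simp]: "w \<in> A \<Longrightarrow> Poly_Mapping.single w c \<in> free_on A"
  by (auto simp: free_on_iff lookup_single when_def)

lemma free_on_scale [simp]: "h \<in> free_on A \<Longrightarrow> scale a h \<in> free_on A"
  by (simp add: free_on_iff)

lemma free_on_add [simp]: "g \<in> free_on A \<Longrightarrow> h \<in> free_on A \<Longrightarrow> g + h \<in> free_on A"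
  by (simp add: free_on_iff lookup_add)

lemma free_on_uminus [simp]: "h \<in> free_on A \<Longrightarrow> - h \<in> free_on A"
  by (simp add: free_on_iff)

lemma free_on_diff [simp]: "g \<in> free_on A \<Longrightarrow> h \<in> free_on A \<Longrightarrow> g - h \<in> free_on A"
  by (simp add: free_on_iff lookup_minus)

lemma free_on_sum [simp]: "(\<And>x. x \<in> B \<Longrightarrow> f x \<in> free_on A) \<Longrightarrow> sum f B \<in> free_on A"
  by (induction B rule: infinite_finite_induct) auto

lemma linear_op_closed:
  assumes "linear_op F" "\<And>w. w \<in> A \<Longrightarrow> F (Poly_Mapping.single w 1) \<in> free_on B" "h \<in> free_on A"
  shows "F h \<in> free_on B"
proof -
  have "F h = (\<Sum>w\<in>keys h. scale (lookup h w) (F (Poly_Mapping.single w 1)))"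
    by (subst expand_support[of "keys h" h]) (simp_all add: linear_opD[OF assms(1)])
  moreover have "F (Poly_Mapping.single w 1) \<in> free_on B" if "w \<in> keys h" for w
    using assms that by (auto simp: free_on_def)
  ultimately show ?thesis by simp
qed

text \<open>Multiplication by T_s in the standard basis, where a is multiplication by s on either
  side and l is the length. Keeping the side open allows one proof for left and right.\<close>

definition elementary_op :: "('a \<Rightarrow> nat) \<Rightarrow> ('a \<Rightarrow> 'a) \<Rightarrow> ('a \<Rightarrow>\<^sub>0 laurent) \<Rightarrow> ('a \<Rightarrow>\<^sub>0 laurent)" where
  "elementary_op l a = linear_ext (\<lambda>w. if l w < l (a w) then Poly_Mapping.single (a w) 1
     else scale q_var (Poly_Mapping.single (a w) 1) + scale (q_var - 1) (Poly_Mapping.single w 1))"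

lemma elementary_op_linear [simp]: "linear_op (elementary_op l a)"
  by (simp add: elementary_op_def)

lemma elementary_op_single: "elementary_op l a (Poly_Mapping.single w 1) = 
  (if l w < l (a w) then Poly_Mapping.single (a w) 1
     else scale q_var (Poly_Mapping.single (a w) 1) + scale (q_var - 1) (Poly_Mapping.single w 1))"
  by (simp add: elementary_op_def)

section \<open>Construction of the Hecke algebra\<close>

context coxeter_system
begin

abbreviation "H \<equiv> free_on (carrier W)"

abbreviation "L s \<equiv> elementary_op len (\<lambda>w. s \<otimes> w)"
abbreviation "R s \<equiv> elementary_op len (\<lambda>w. w \<otimes> s)"

lemma L_T: "s \<in> S \<Longrightarrow> L s (T w) = (if len w < len (s \<otimes> w) then T (s \<otimes> w)
     else scale q_var (T (s \<otimes> w)) + scale (q_var - 1) (T w))"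
  by (rule elementary_op_single)

lemma R_T: "s \<in> S \<Longrightarrow> R s (T w) = (if len w < len (w \<otimes> s) then T (w \<otimes> s)
     else scale q_var (T (w \<otimes> s)) + scale (q_var - 1) (T w))"
  by (rule elementary_op_single)

lemma L_closed [simp]: "s \<in> S \<Longrightarrow> h \<in> H \<Longrightarrow> L s h \<in> H"
  by (rule linear_op_closed[of _ "carrier W"]) (auto simp: L_T)

lemma R_closed [simp]: "s \<in> S \<Longrightarrow> h \<in> H \<Longrightarrow> R s h \<in> H"
  by (rule linear_op_closed[of _ "carrier W"]) (auto simp: R_T)

text \<open>
  Since \<open>L s\<close> and \<open>R t\<close> commute, an operator composed of the former is determined by its value at
  \<open>T\<^sub>1\<close>; the Hecke algebra can therefore be built without knowing that \<open>L_word\<close> depends on the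
  product of the word only.
\<close>

lemma L_R_commute:
  assumes "s \<in> S" "t \<in> S" "h \<in> H" shows "L s (R t h) = R t (L s h)"
proof (rule linear_op_eqI[where h = h])
  fix w assume "w \<in> keys h"
  then have w: "w \<in> carrier W" using assms by (auto simp: free_on_def)
  have sd: "len w < len (s \<otimes> w) \<longleftrightarrow> \<not> len (s \<otimes> w) < len w" if "w \<in> carrier W" for w
    using assms that by (auto elim: len_gen_cases)
  have td: "len w < len (w \<otimes> t) \<longleftrightarrow> \<not> len (w \<otimes> t) < len w" if "w \<in> carrier W" for w
    using assms that by (auto elim: len_gen_cases_right)
  show "L s (R t (T w)) = R t (L s (T w))"
  \<comment> \<open>If s w = w t, the operators \<open>L s\<close> and \<open>R t\<close> agree on
    the span of T_w and T_{sw}, so they commute there. Otherwise left ascents by s and right ascents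
    by t are independent of each other, and both composites have the same four-case value.\<close>
  proof (cases "s \<otimes> w = w \<otimes> t")
    case True
    have "s \<otimes> (w \<otimes> t) = w" using w assms True[symmetric] by simp
    then show ?thesis using assms w True
      by (simp add: L_T R_T linear_opD)
  next
    case False
    note d = descent_left_right[OF assms(1,2) w False] 
    have m: "s \<otimes> w \<otimes> t = s \<otimes> (w \<otimes> t)" using w assms by (simp add: m_assoc)
    show ?thesis using assms w d
      by (simp add: L_T R_T linear_opD sd td td[of "s \<otimes> w", unfolded m] m scale_add mult.commute)
  qed
qed (simp_all add: linear_op_comp[of "L s" "R t"] linear_op_comp[of "R t" "L s"])

definition L_word :: "'a list \<Rightarrow> ('a \<Rightarrow>\<^sub>0 laurent) \<Rightarrow> ('a \<Rightarrow>\<^sub>0 laurent)" where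
  "L_word ws h = foldr L ws h"

lemma L_word_simps [simp]: "L_word [] h = h" "L_word (s # ws) h = L s (L_word ws h)"
  by (simp_all add: L_word_def)

lemma L_word_linear [simp]: "linear_op (L_word ws)"
proof (induction ws)
  case (Cons s ws)
  have "linear_op (\<lambda>h. L s (L_word ws h))" using linear_op_comp[of "L s" "L_word ws"] Cons by simp
  then show ?case by (simp add: L_word_def linear_op_def)
qed (simp add: L_word_def linear_op_def)

lemma L_word_closed [simp]: "ws \<in> lists S \<Longrightarrow> h \<in> H \<Longrightarrow> L_word ws h \<in> H"
  by (induction ws) auto

lemma L_word_R: "ws \<in> lists S \<Longrightarrow> t \<in> S \<Longrightarrow> h \<in> H \<Longrightarrow> L_word ws (R t h) = R t (L_word ws h)"
  by (induction ws) (auto simp: L_R_commute)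

lemma reduced_ConsD: 
  assumes "reduced (s # ws)" 
  shows "reduced ws" "len (word_prod ws) < len (s \<otimes> word_prod ws)"
  using assms len_word_prod_le[of ws] len_mult_le[of s "word_prod ws"] len_gen_le[of s]
  by (auto simp: reduced_def)

lemma L_word_T:
  assumes "ws \<in> lists S" "w \<in> carrier W" "len (word_prod ws \<otimes> w) = length ws + len w"
  shows "L_word ws (T w) = T (word_prod ws \<otimes> w)"
  using assms
proof (induction ws)
  case (Cons s ws)
  have "len (s \<otimes> (word_prod ws \<otimes> w)) = Suc (length ws) + len w" using Cons by (simp add: m_assoc)
  moreover have "len (word_prod ws \<otimes> w) \<le> length ws + len w"
    using len_mult_le[of "word_prod ws" w] len_word_prod_le[of ws] Cons by auto
  moreover have "len (s \<otimes> (word_prod ws \<otimes> w)) \<le> 1 + len (word_prod ws \<otimes> w)"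
    using len_mult_le[of s "word_prod ws \<otimes> w"] len_gen_le[of s] Cons by auto
  ultimately show ?case using Cons by (simp add: L_T m_assoc)
qed simp

definition red_word :: "'a \<Rightarrow> 'a list" where
  "red_word w = (SOME ws. reduced ws \<and> word_prod ws = w)"

lemma red_word:
  assumes "w \<in> carrier W"
  shows "reduced (red_word w)" "word_prod (red_word w) = w" "red_word w \<in> lists S"
    "length (red_word w) = len w"
proof -
  have "\<exists>ws. reduced ws \<and> word_prod ws = w" using reduced_exists assms by metis
  from someI_ex[OF this] show "reduced (red_word w)" "word_prod (red_word w) = w"
    unfolding red_word_def by auto
  then show "red_word w \<in> lists S" "length (red_word w) = len w" by (auto simp: reduced_def)
qed

definition hecke_prod :: "('a \<Rightarrow>\<^sub>0 laurent) \<Rightarrow> ('a \<Rightarrow>\<^sub>0 laurent) \<Rightarrow> ('a \<Rightarrow>\<^sub>0 laurent)" where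
  "hecke_prod x y = linear_ext (\<lambda>w. L_word (red_word w) y) x"

lemma hecke_prod_linear_left: "linear_op (\<lambda>x. hecke_prod x y)"
  by (simp add: hecke_prod_def)

lemma hecke_prod_linear_right: "linear_op (hecke_prod x)"
proof -
  have "linear_op (\<lambda>y. \<Sum>w\<in>keys x. scale (lookup x w) (L_word (red_word w) y))"
    by (intro linear_op_sum linear_op_scale L_word_linear)
  then show ?thesis by (simp add: hecke_prod_def linear_op_def linear_ext_def)
qed

lemma hecke_prod_T: "hecke_prod (T w) y = L_word (red_word w) y"
  by (simp add: hecke_prod_def)

lemma hecke_prod_closed [simp]: "x \<in> H \<Longrightarrow> y \<in> H \<Longrightarrow> hecke_prod x y \<in> H"
  by (rule linear_op_closed[OF hecke_prod_linear_left, where A = "carrier W"])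
    (simp_all add: hecke_prod_T red_word)

lemma hecke_prod_R:
  assumes "x \<in> H" "y \<in> H" "t \<in> S" shows "hecke_prod x (R t y) = R t (hecke_prod x y)"
proof (rule linear_op_eqI[where h = x])
  fix w assume "w \<in> keys x"
  then show "hecke_prod (T w) (R t y) = R t (hecke_prod (T w) y)"
    using assms by (auto simp: hecke_prod_T free_on_def L_word_R red_word)
next
  show "linear_op (\<lambda>x. R t (hecke_prod x y))"
    by (rule linear_op_comp[of "R t"]) (simp_all add: hecke_prod_linear_left)
qed (rule hecke_prod_linear_left)

lemma hecke_prod_T_T:
  assumes "u \<in> carrier W" "w \<in> carrier W" "len (u \<otimes> w) = len u + len w"
  shows "hecke_prod (T u) (T w) = T (u \<otimes> w)"
  using assms L_word_T[of "red_word u" w] by (simp add: hecke_prod_T red_word)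

lemma hecke_prod_one: "x \<in> H \<Longrightarrow> hecke_prod x (T \<one>) = x" "x \<in> H \<Longrightarrow> hecke_prod (T \<one>) x = x"
proof -
  assume x: "x \<in> H"
  show "hecke_prod x (T \<one>) = x"
    by (rule linear_op_eqI[where h = x, OF hecke_prod_linear_left linear_op_id])
      (use x in \<open>auto simp: free_on_def hecke_prod_T_T\<close>)
  show "hecke_prod (T \<one>) x = x"
    using red_word[of \<one>] by (simp add: hecke_prod_T)
qed

lemma carrier_right_induct [consumes 1, case_names one mult]:
  assumes "w \<in> carrier W" "P \<one>"
    "\<And>w s. w \<in> carrier W \<Longrightarrow> s \<in> S \<Longrightarrow> len (w \<otimes> s) = Suc (len w) \<Longrightarrow> P w \<Longrightarrow> P (w \<otimes> s)"
  shows "P w"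
  using assms(1)
proof (induction "len w" arbitrary: w)
  case 0 then show ?case using assms(2) by simp
next
  case (Suc n)
  then have "w \<noteq> \<one>" by auto
  then obtain s where "s \<in> right_descents w" using right_descents_nonempty[of w] Suc by auto
  then have s: "s \<in> S" "len (w \<otimes> s) < len w" using Suc by (auto simp: right_descents_iff)
  then have "len w = Suc (len (w \<otimes> s))" using len_gen_cases_right[of s w] Suc by force
  then show ?case using assms(3)[of "w \<otimes> s" s] Suc s by simp
qed

lemma carrier_left_induct [consumes 1, case_names one mult]:
  assumes "w \<in> carrier W" "P \<one>"
    "\<And>w s. w \<in> carrier W \<Longrightarrow> s \<in> S \<Longrightarrow> len (s \<otimes> w) = Suc (len w) \<Longrightarrow> P w \<Longrightarrow> P (s \<otimes> w)"
  shows "P w"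
proof -
  have "P (inv u)" if "u \<in> carrier W" for u using that
  proof (induction u rule: carrier_right_induct)
    case (mult w s)
    have "len (s \<otimes> inv w) = len (w \<otimes> s)" 
      using len_inv[of "w \<otimes> s"] mult by (simp add: inv_mult_group del: len_inv)
    then show ?case using assms(3)[of "inv w" s] mult by (simp add: inv_mult_group)
  qed (simp add: assms)
  from this[of "inv w"] show ?thesis using assms by simp
qed

text \<open>In the last argument both sides commute with every \<open>R s\<close>, and at T_1 they
  agree; building the last factor up from the right then proves equality.\<close>

lemma hecke_prod_assoc:
  assumes "x \<in> H" "y \<in> H" "z \<in> H"
  shows "hecke_prod (hecke_prod x y) z = hecke_prod x (hecke_prod y z)"
proof (rule linear_op_eqI[where h = z])
  fix w assume "w \<in> keys z"
  then have "w \<in> carrier W" using assms by (auto simp: free_on_def)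
  then show "hecke_prod (hecke_prod x y) (T w) = hecke_prod x (hecke_prod y (T w))"
  proof (induction rule: carrier_right_induct)
    case one then show ?case using assms by (simp add: hecke_prod_one)
  next
    case (mult w s)
    then have "T (w \<otimes> s) = R s (T w)" by (simp add: R_T)
    then show ?case using mult assms by (simp add: hecke_prod_R)
  qed
next
  show "linear_op (\<lambda>z. hecke_prod x (hecke_prod y z))"
    by (rule linear_op_comp[of "hecke_prod x"]) (rule hecke_prod_linear_right)+
qed (rule hecke_prod_linear_right)

lemma is_hecke_algebra_exists: "\<exists>A. is_hecke_algebra A"
proof -
  let ?A = "\<lparr>carrier = H, monoid.mult = hecke_prod, one = T \<one>, zero = 0, add = (+)\<rparr>"
  have "ring ?A"
  proof (rule ringI)
    show "abelian_group ?A"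
      by (rule abelian_groupI) (auto simp: add_ac intro: bexI[of _ "- x" for x])
    show "Group.monoid ?A"
      by (rule monoidI) (auto simp: hecke_prod_assoc hecke_prod_one)
  qed (simp_all add: linear_opD[OF hecke_prod_linear_left] linear_opD[OF hecke_prod_linear_right])
  moreover have "hecke_prod (T s) (T s) = scale q_var (T \<one>) + scale (q_var - 1) (T s)" if s: "s \<in> S" for s
  proof -
    have r: "red_word s = [s]"
      using red_word[of s] s by (cases "red_word s") auto
    show ?thesis using s unfolding hecke_prod_T r by (simp add: L_T gen_sq)
  qed
  ultimately have "is_hecke_algebra ?A"
    unfolding is_hecke_algebra_def using hecke_prod_T_T
    by (auto simp: linear_opD[OF hecke_prod_linear_left] linear_opD[OF hecke_prod_linear_right] free_on_def)
  then show ?thesis by blast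
qed

section \<open>Properties of the chosen Hecke algebra\<close>

lemma is_hecke_algebra_hecke: "is_hecke_algebra hecke"
  unfolding hecke_def by (rule someI_ex[OF is_hecke_algebra_exists])

lemma hecke_ring: "ring hecke"
  using is_hecke_algebra_hecke by (simp add: is_hecke_algebra_def)

lemma hecke_simps [simp]:
  "carrier hecke = H" "zero hecke = 0" "add hecke = (+)"
  using is_hecke_algebra_hecke by (simp_all add: is_hecke_algebra_def free_on_def)

lemma hecke_scale:
  "x \<in> H \<Longrightarrow> y \<in> H \<Longrightarrow> scale a x \<otimes>\<^bsub>hecke\<^esub> y = scale a (x \<otimes>\<^bsub>hecke\<^esub> y)"
  "x \<in> H \<Longrightarrow> y \<in> H \<Longrightarrow> x \<otimes>\<^bsub>hecke\<^esub> scale a y = scale a (x \<otimes>\<^bsub>hecke\<^esub> y)"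
  using is_hecke_algebra_hecke by (simp_all add: is_hecke_algebra_def free_on_def)

lemma hecke_T_T: 
  "u \<in> carrier W \<Longrightarrow> w \<in> carrier W \<Longrightarrow> len (u \<otimes> w) = len u + len w \<Longrightarrow>
    T u \<otimes>\<^bsub>hecke\<^esub> T w = T (u \<otimes> w)"
  "s \<in> S \<Longrightarrow> T s \<otimes>\<^bsub>hecke\<^esub> T s = scale q_var (T \<one>) + scale (q_var - 1) (T s)"
  using is_hecke_algebra_hecke by (simp_all add: is_hecke_algebra_def)

lemma H_induct [consumes 1, case_names zero T scale add]:
  assumes "h \<in> H" "P 0" "\<And>w. w \<in> carrier W \<Longrightarrow> P (T w)" 
    "\<And>a h. h \<in> H \<Longrightarrow> P h \<Longrightarrow> P (scale a h)"
    "\<And>g h. g \<in> H \<Longrightarrow> h \<in> H \<Longrightarrow> P g \<Longrightarrow> P h \<Longrightarrow> P (g + h)"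
  shows "P h"
proof -
  have "A \<subseteq> carrier W \<Longrightarrow> (\<Sum>w\<in>A. scale (lookup h w) (T w)) \<in> H \<and> P (\<Sum>w\<in>A. scale (lookup h w) (T w))"
    if "finite A" for A using that
    by (induction A) (auto intro!: assms)
  from this[of "keys h"] expand_support[of "keys h" h] assms(1) show ?thesis
    by (simp add: free_on_def)
qed

lemma hecke_one: "\<one>\<^bsub>hecke\<^esub> = T \<one>"
proof -
  interpret A: ring hecke by (rule hecke_ring)
  have "T \<one> \<otimes>\<^bsub>hecke\<^esub> h = h" if "h \<in> H" for h using that
  proof (induction rule: H_induct)
    case zero show ?case using A.r_null[of "T \<one>"] by simp
  next
    case (add g h) then show ?case using A.r_distr[of g h "T \<one>"] by simp
  qed (auto simp: hecke_T_T hecke_scale)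
  from this[of "\<one>\<^bsub>hecke\<^esub>"] show ?thesis using A.r_one[of "T \<one>"] A.one_closed by simp
qed

text \<open>The ring \<open>hecke\<close> is chosen abstractly, so its product must be tied to the
  explicit operators. For s a left descent of w, writing T_w = T_s T_{sw} reduces the product to the
  quadratic relation.\<close>

lemma hecke_L:
  assumes "s \<in> S" "h \<in> H" shows "T s \<otimes>\<^bsub>hecke\<^esub> h = L s h"
proof -
  interpret A: ring hecke by (rule hecke_ring)
  show ?thesis using assms(2)
  proof (induction rule: H_induct)
    case zero show ?case using A.r_null[of "T s"] assms by (simp add: linear_opD)
  next
    case (add g h) then show ?case using A.r_distr[of g h "T s"] assms by (simp add: linear_opD)
  next
    case (scale a h) then show ?case using assms by (simp add: linear_opD hecke_scale)
  next
    case (T w)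
    show ?case
    proof (rule len_gen_cases[OF assms(1) T])
      assume "len (s \<otimes> w) = Suc (len w)"
      then show ?thesis using T assms by (simp add: hecke_T_T L_T)
    next
      assume l: "len w = Suc (len (s \<otimes> w))"
      then have "T w = T s \<otimes>\<^bsub>hecke\<^esub> T (s \<otimes> w)"
        using hecke_T_T(1)[of s "s \<otimes> w"] T assms by simp
      then have "T s \<otimes>\<^bsub>hecke\<^esub> T w = (T s \<otimes>\<^bsub>hecke\<^esub> T s) \<otimes>\<^bsub>hecke\<^esub> T (s \<otimes> w)"
        using A.m_assoc[of "T s" "T s" "T (s \<otimes> w)"] T assms by simp
      also have "\<dots> = scale q_var (T \<one> \<otimes>\<^bsub>hecke\<^esub> T (s \<otimes> w)) + scale (q_var - 1) (T s \<otimes>\<^bsub>hecke\<^esub> T (s \<otimes> w))"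
        using A.l_distr[of "scale q_var (T \<one>)" "scale (q_var - 1) (T s)" "T (s \<otimes> w)"] T assms
        by (simp add: hecke_T_T hecke_scale)
      also have "\<dots> = L s (T w)"
        using T assms l by (simp add: hecke_T_T L_T)
      finally show ?thesis .
    qed
  qed
qed

lemma hecke_R:
  assumes "s \<in> S" "h \<in> H" shows "h \<otimes>\<^bsub>hecke\<^esub> T s = R s h"
proof -
  interpret A: ring hecke by (rule hecke_ring)
  show ?thesis using assms(2)
  proof (induction rule: H_induct)
    case zero show ?case using A.l_null[of "T s"] assms by (simp add: linear_opD)
  next
    case (add g h) then show ?case using A.l_distr[of g h "T s"] assms by (simp add: linear_opD)
  next
    case (scale a h) then show ?case using assms by (simp add: linear_opD hecke_scale)
  next
    case (T w)
    show ?case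
    proof (rule len_gen_cases_right[OF assms(1) T])
      assume "len (w \<otimes> s) = Suc (len w)"
      then show ?thesis using T assms by (simp add: hecke_T_T R_T)
    next
      assume l: "len w = Suc (len (w \<otimes> s))"
      then have "T w = T (w \<otimes> s) \<otimes>\<^bsub>hecke\<^esub> T s"
        using hecke_T_T(1)[of "w \<otimes> s" s] T assms by simp
      then have "T w \<otimes>\<^bsub>hecke\<^esub> T s = T (w \<otimes> s) \<otimes>\<^bsub>hecke\<^esub> (T s \<otimes>\<^bsub>hecke\<^esub> T s)"
        using A.m_assoc[of "T (w \<otimes> s)" "T s" "T s"] T assms by simp
      also have "\<dots> = scale q_var (T (w \<otimes> s) \<otimes>\<^bsub>hecke\<^esub> T \<one>) + scale (q_var - 1) (T (w \<otimes> s) \<otimes>\<^bsub>hecke\<^esub> T s)"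
        using A.r_distr[of "scale q_var (T \<one>)" "scale (q_var - 1) (T s)" "T (w \<otimes> s)"] T assms
        by (simp add: hecke_T_T hecke_scale)
      also have "\<dots> = R s (T w)"
        using T assms l by (simp add: hecke_T_T R_T)
      finally show ?thesis .
    qed
  qed
qed

end

section \<open>The bar involution\<close>

lemma lookup_of_int_mult [simp]: "lookup (of_int c * (x :: laurent)) k = c * lookup x k"
proof -
  have e: "(of_int c :: laurent) = Poly_Mapping.single 0 c" unfolding single_of_int[symmetric] by simp
  show ?thesis unfolding e
    by (induction x rule: laurent_induct)
      (auto simp: distrib_left lookup_add mult_single lookup_single when_def)
qed

lemma laurent_bar_of_int [simp]: "laurent_bar (of_int c) = of_int c"
proof -
  have "(of_int c :: laurent) = Poly_Mapping.single 0 c" unfolding single_of_int[symmetric] by simp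
  then show ?thesis by (simp add: laurent_bar_single)
qed

lemma qhalf_pow_mult_right [simp]: "qhalf_pow a * (x * qhalf_pow b) = x * qhalf_pow (a + b)"
  by (metis mult.left_commute qhalf_pow_mult)

lemma q_var_eq: "q_var = qhalf_pow 2" by (simp add: q_var_def)

lemma lookup_one_laurent: "lookup (1 :: laurent) k = (if k = 0 then 1 else 0)"
  by (simp add: lookup_one when_def)

context coxeter_system
begin

text \<open>Left and right multiplication by generators are treated simultaneously.\<close>

definition acts :: "('a \<Rightarrow> 'a) set" where
  "acts = {\<lambda>w. s \<otimes> w | s. s \<in> S} \<union> {\<lambda>w. w \<otimes> s | s. s \<in> S}"

lemma actsE [consumes 1, case_names left right]:
  assumes "a \<in> acts"
  obtains s where "s \<in> S" "a = (\<lambda>w. s \<otimes> w)" | s where "s \<in> S" "a = (\<lambda>w. w \<otimes> s)"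
  using assms by (auto simp: acts_def)

lemma acts_left [simp]: "s \<in> S \<Longrightarrow> (\<lambda>w. s \<otimes> w) \<in> acts"
  and acts_right [simp]: "s \<in> S \<Longrightarrow> (\<lambda>w. w \<otimes> s) \<in> acts"
  by (auto simp: acts_def)

lemma act_closed [simp]: "a \<in> acts \<Longrightarrow> w \<in> carrier W \<Longrightarrow> a w \<in> carrier W"
  by (erule actsE) auto

lemma act_act [simp]: "a \<in> acts \<Longrightarrow> w \<in> carrier W \<Longrightarrow> a (a w) = w"
  by (erule actsE) auto

lemma act_len_cases:
  assumes "a \<in> acts" "w \<in> carrier W"
  obtains "len (a w) = Suc (len w)" | "len w = Suc (len (a w))"
  using assms by (cases rule: actsE) (auto elim: len_gen_cases len_gen_cases_right)

lemma act_len_neq: "a \<in> acts \<Longrightarrow> w \<in> carrier W \<Longrightarrow> \<not> len w < len (a w) \<longleftrightarrow> len (a w) < len w"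
  by (rule act_len_cases[of a w]) auto

lemma act_bruhat_le: 
  assumes "a \<in> acts" "w \<in> carrier W" "len w < len (a w)" shows "bruhat_le w (a w)"
  using assms bruhat_edge_le bruhat_edge_left bruhat_edge_right by (auto elim!: actsE)

lemma act_bruhat_edge:
  "a \<in> acts \<Longrightarrow> u \<in> carrier W \<Longrightarrow> bruhat_edge u v \<Longrightarrow> a u = v \<or> bruhat_edge (a u) (a v)"
  by (erule actsE) (simp_all add: bruhat_edge_mult_left bruhat_edge_mult_right)

lemma act_bruhat_mono:
  assumes "a \<in> acts" "bruhat_le y w" "len w < len (a w)" shows "bruhat_le (a y) (a w)"
proof -
  have cl: "y \<in> carrier W" "w \<in> carrier W" using bruhat_le_closed assms by auto
  have "bruhat_edge\<^sup>*\<^sup>* y w" using assms by (simp add: bruhat_le_edge)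
  then have "bruhat_le y w \<and> (bruhat_le (a y) w \<or> bruhat_le (a y) (a w))"
  proof (induction rule: rtranclp_induct)
    case base then show ?case using cl assms by simp
  next
    case (step u v)
    then have u: "u \<in> carrier W" and v: "v \<in> carrier W"
      using bruhat_le_closed bruhat_edge_closed by blast+
    have uv: "bruhat_le u v" using step u bruhat_edge_le by simp
    consider "a u = v" | "bruhat_le (a u) (a v)"
      using act_bruhat_edge[OF assms(1) u step(2)] bruhat_edge_le assms u by auto
    then show ?case using step.IH uv bruhat_le_trans by cases blast+
  qed
  then show ?thesis using act_bruhat_le[OF assms(1) cl(2) assms(3)] bruhat_le_trans by blast
qed

abbreviation "E a \<equiv> elementary_op len a"

lemma E_closed [simp]: "a \<in> acts \<Longrightarrow> h \<in> H \<Longrightarrow> E a h \<in> H"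
  by (erule actsE) auto

lemma E_sq:
  assumes "a \<in> acts" "h \<in> H" shows "E a (E a h) = scale q_var h + scale (q_var - 1) (E a h)"
proof (rule linear_op_eqI[where h = h])
  show "linear_op (\<lambda>h. E a (E a h))" by (rule linear_op_comp[of "E a"]) auto
  show "linear_op (\<lambda>h. scale q_var h + scale (q_var - 1) (E a h))"
    by (intro linear_op_add linear_op_scale) auto
  fix w assume "w \<in> keys h"
  then have w: "w \<in> carrier W" using assms by (auto simp: free_on_def)
  show "E a (E a (T w)) = scale q_var (T w) + scale (q_var - 1) (E a (T w))"
    by (rule act_len_cases[OF assms(1) w]) 
      (simp_all add: elementary_op_single linear_opD[OF elementary_op_linear] scale_add mult.commute assms w)
qed

lemma lookup_E:
  assumes "a \<in> acts" "h \<in> H" "y \<in> carrier W"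
  shows "lookup (E a h) y = (if len y < len (a y) then q_var * lookup h (a y)
     else lookup h (a y) + (q_var - 1) * lookup h y)"
  using assms(2)
proof (induction rule: H_induct)
  case (T w)
  have "a w = y \<longleftrightarrow> w = a y" using assms T by auto
  moreover have "len (a y) < len y \<longleftrightarrow> \<not> len y < len (a y)" using act_len_neq[OF assms(1,3)] by simp
  moreover have "a (a y) = y" "y \<noteq> a y" using assms by (auto elim: act_len_cases[of a y])
  ultimately show ?case 
    by (cases "w = y"; cases "w = a y")
      (auto simp: elementary_op_single lookup_add lookup_single when_def)
qed (auto simp: linear_opD[OF elementary_op_linear] lookup_add algebra_simps)

text \<open>The inverse of T_s, found by solving the quadratic relation for it.\<close>

definition Ti :: "'a \<Rightarrow> 'a \<Rightarrow>\<^sub>0 laurent" where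
  "Ti s = scale (qhalf_pow (-2)) (T s) + scale (qhalf_pow (-2) - 1) (T \<one>)"

abbreviation \<beta> :: "'a \<Rightarrow> 'a \<Rightarrow>\<^sub>0 laurent" where "\<beta> w \<equiv> inv\<^bsub>hecke\<^esub> T (inv w)"

lemma Ti_closed [simp]: "s \<in> S \<Longrightarrow> Ti s \<in> H"
  by (simp add: Ti_def)

lemma Ti_L: "s \<in> S \<Longrightarrow> h \<in> H \<Longrightarrow>
    Ti s \<otimes>\<^bsub>hecke\<^esub> h = scale (qhalf_pow (-2)) (L s h) + scale (qhalf_pow (-2) - 1) h"
  and Ti_R: "s \<in> S \<Longrightarrow> h \<in> H \<Longrightarrow>
    h \<otimes>\<^bsub>hecke\<^esub> Ti s = scale (qhalf_pow (-2)) (R s h) + scale (qhalf_pow (-2) - 1) h"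
proof -
  interpret A: ring hecke by (rule hecke_ring)
  assume *: "s \<in> S" "h \<in> H"
  show "Ti s \<otimes>\<^bsub>hecke\<^esub> h = scale (qhalf_pow (-2)) (L s h) + scale (qhalf_pow (-2) - 1) h"
    using A.l_distr[of "scale (qhalf_pow (-2)) (T s)" "scale (qhalf_pow (-2) - 1) (T \<one>)" h] *
      A.l_one[of h] by (simp add: Ti_def hecke_scale hecke_L hecke_one)
  show "h \<otimes>\<^bsub>hecke\<^esub> Ti s = scale (qhalf_pow (-2)) (R s h) + scale (qhalf_pow (-2) - 1) h"
    using A.r_distr[of "scale (qhalf_pow (-2)) (T s)" "scale (qhalf_pow (-2) - 1) (T \<one>)" h] *
      A.r_one[of h] by (simp add: Ti_def hecke_scale hecke_R hecke_one)
qed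

lemma Ti_inverse:
  assumes "s \<in> S"
  shows "T s \<otimes>\<^bsub>hecke\<^esub> Ti s = \<one>\<^bsub>hecke\<^esub>" "Ti s \<otimes>\<^bsub>hecke\<^esub> T s = \<one>\<^bsub>hecke\<^esub>"
  using assms unfolding Ti_L[OF assms free_on_single[OF gen_closed[OF assms]]] 
    Ti_R[OF assms free_on_single[OF gen_closed[OF assms]]] hecke_one
  by (simp_all add: L_T R_T gen_sq q_var_eq scale_add left_diff_distrib right_diff_distrib scale_add_left[symmetric] add.assoc)

lemma T_units: "w \<in> carrier W \<Longrightarrow> T w \<in> Units hecke"
proof (induction rule: carrier_left_induct)
  interpret A: ring hecke by (rule hecke_ring)
  case one show ?case using A.Units_one_closed by (simp add: hecke_one)
next
  interpret A: ring hecke by (rule hecke_ring)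
  case (mult w s)
  have "T s \<in> Units hecke"
    using Ti_inverse[OF mult(2)] mult(2) unfolding Units_def by (auto intro!: bexI[of _ "Ti s"])
  moreover have "T (s \<otimes> w) = T s \<otimes>\<^bsub>hecke\<^esub> T w" using mult by (simp add: hecke_T_T)
  ultimately show ?case using mult A.Units_m_closed by simp
qed

lemma \<beta>_closed [simp]: "w \<in> carrier W \<Longrightarrow> \<beta> w \<in> H"
  using monoid.Units_inv_closed[of hecke "T (inv w)"] ring.is_monoid[OF hecke_ring] T_units[of "inv w"] by simp

lemma \<beta>_one [simp]: "inv\<^bsub>hecke\<^esub> T \<one> = T \<one>"
  using monoid.inv_one[of hecke] ring.is_monoid[OF hecke_ring] by (simp add: hecke_one)

lemma hecke_inv_mult:
  assumes "x \<in> Units hecke" "y \<in> Units hecke"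
  shows "inv\<^bsub>hecke\<^esub> (x \<otimes>\<^bsub>hecke\<^esub> y) = inv\<^bsub>hecke\<^esub> y \<otimes>\<^bsub>hecke\<^esub> inv\<^bsub>hecke\<^esub> x"
proof -
  interpret A: ring hecke by (rule hecke_ring)
  have [simp]: "x \<in> H" "y \<in> H" "inv\<^bsub>hecke\<^esub> x \<in> H" "inv\<^bsub>hecke\<^esub> y \<in> H"
    using assms A.Units_closed A.Units_inv_closed by simp_all
  have [simp]: "u \<otimes>\<^bsub>hecke\<^esub> v \<in> H" if "u \<in> H" "v \<in> H" for u v using A.m_closed[of u v] that by simp
  show ?thesis
  proof (rule A.inv_char)
    show "x \<otimes>\<^bsub>hecke\<^esub> y \<otimes>\<^bsub>hecke\<^esub> (inv\<^bsub>hecke\<^esub> y \<otimes>\<^bsub>hecke\<^esub> inv\<^bsub>hecke\<^esub> x) = \<one>\<^bsub>hecke\<^esub>"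
      using assms A.m_assoc[of x y "inv\<^bsub>hecke\<^esub> y \<otimes>\<^bsub>hecke\<^esub> inv\<^bsub>hecke\<^esub> x"]
        A.m_assoc[of y "inv\<^bsub>hecke\<^esub> y" "inv\<^bsub>hecke\<^esub> x", symmetric] A.Units_inv_closed by simp
    show "inv\<^bsub>hecke\<^esub> y \<otimes>\<^bsub>hecke\<^esub> inv\<^bsub>hecke\<^esub> x \<otimes>\<^bsub>hecke\<^esub> (x \<otimes>\<^bsub>hecke\<^esub> y) = \<one>\<^bsub>hecke\<^esub>"
      using assms A.m_assoc[of "inv\<^bsub>hecke\<^esub> y" "inv\<^bsub>hecke\<^esub> x" "x \<otimes>\<^bsub>hecke\<^esub> y"]
        A.m_assoc[of "inv\<^bsub>hecke\<^esub> x" x y, symmetric] A.Units_inv_closed by simp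
  qed (use assms A.Units_inv_closed in auto)
qed

lemma inv_T_gen: "s \<in> S \<Longrightarrow> inv\<^bsub>hecke\<^esub> T s = Ti s"
  using monoid.inv_char[of hecke "T s" "Ti s"] ring.is_monoid[OF hecke_ring] Ti_inverse by simp

text \<open>Extending w on one side extends w^{-1} on the other, and inversion in the Hecke algebra
  turns this round again: the new factor T_s^{-1} appears on the side on which a acts.\<close>

lemma \<beta>_act:
  assumes "a \<in> acts" "w \<in> carrier W" "len w < len (a w)"
  shows "\<beta> (a w) = scale (qhalf_pow (-2)) (E a (\<beta> w)) + scale (qhalf_pow (-2) - 1) (\<beta> w)"
  using assms(1)
proof (cases rule: actsE)
  case (left s)
  have l: "len (s \<otimes> w) = Suc (len w)" using left assms by (auto elim: len_gen_cases)
  have "len (inv w \<otimes> s) = len (s \<otimes> w)" 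
    using len_inv[of "s \<otimes> w"] left assms by (simp add: inv_mult_group del: len_inv)
  then have "T (inv (s \<otimes> w)) = T (inv w) \<otimes>\<^bsub>hecke\<^esub> T s"
    using hecke_T_T(1)[of "inv w" s] left assms l by (simp add: inv_mult_group)
  then have "\<beta> (s \<otimes> w) = Ti s \<otimes>\<^bsub>hecke\<^esub> \<beta> w"
    using hecke_inv_mult[of "T (inv w)" "T s"] T_units left assms by (simp add: inv_T_gen)
  then show ?thesis using left assms by (simp add: Ti_L)
next
  case (right s)
  have l: "len (w \<otimes> s) = Suc (len w)" using right assms by (auto elim: len_gen_cases_right)
  have "len (s \<otimes> inv w) = len (w \<otimes> s)" 
    using len_inv[of "w \<otimes> s"] right assms by (simp add: inv_mult_group del: len_inv)
  then have "T (inv (w \<otimes> s)) = T s \<otimes>\<^bsub>hecke\<^esub> T (inv w)"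
    using hecke_T_T(1)[of s "inv w"] right assms l by (simp add: inv_mult_group)
  then have "\<beta> (w \<otimes> s) = \<beta> w \<otimes>\<^bsub>hecke\<^esub> Ti s"
    using hecke_inv_mult[of "T s" "T (inv w)"] T_units right assms by (simp add: inv_T_gen)
  then show ?thesis using right assms by (simp add: Ti_R)
qed

lemma hecke_bar_superset:
  assumes "finite A" "keys h \<subseteq> A"
  shows "hecke_bar h = (\<Sum>w\<in>A. scale (laurent_bar (lookup h w)) (\<beta> w))"
  unfolding hecke_bar_def using assms by (intro sum.mono_neutral_left) (auto simp: in_keys_iff)

lemma hecke_bar_add: "hecke_bar (g + h) = hecke_bar g + hecke_bar h"
  using hecke_bar_superset[of "keys g \<union> keys h" g] hecke_bar_superset[of "keys g \<union> keys h" h]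
    hecke_bar_superset[of "keys g \<union> keys h" "g + h"] keys_add[of g h]
  by (simp add: lookup_add scale_add_left sum.distrib)

lemma hecke_bar_scale: "hecke_bar (scale a h) = scale (laurent_bar a) (hecke_bar h)"
  using hecke_bar_superset[of "keys h" h] hecke_bar_superset[of "keys h" "scale a h"]
    keys_scale[of a h] by (simp add: scale_sum)

lemma hecke_bar_T [simp]: "hecke_bar (T w) = \<beta> w"
  by (simp add: hecke_bar_def)

lemma hecke_bar_zero [simp]: "hecke_bar 0 = 0"
  by (simp add: hecke_bar_def)

lemma hecke_bar_uminus: "hecke_bar (- h) = - hecke_bar h"
  using hecke_bar_add[of h "- h"] by (simp add: eq_neg_iff_add_eq_0 add.commute)

lemma hecke_bar_diff: "hecke_bar (g - h) = hecke_bar g - hecke_bar h"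
  using hecke_bar_add[of g "- h"] by (simp add: hecke_bar_uminus)

lemma hecke_bar_sum: "hecke_bar (sum f A) = (\<Sum>x\<in>A. hecke_bar (f x))"
  by (induction A rule: infinite_finite_induct) (auto simp: hecke_bar_add)

text \<open>\<open>F (\<lambda>w. s \<otimes> w)\<close> and \<open>F (\<lambda>w. w \<otimes> s)\<close> are left and right multiplication by
  \<open>C\<^sub>s = q\<^sup>-\<^sup>1\<^sup>/\<^sup>2 T\<^sub>s - q\<^sup>1\<^sup>/\<^sup>2\<close>.\<close>

definition F :: "('a \<Rightarrow> 'a) \<Rightarrow> ('a \<Rightarrow>\<^sub>0 laurent) \<Rightarrow> ('a \<Rightarrow>\<^sub>0 laurent)" where
  "F a h = scale (qhalf_pow (-1)) (E a h) - scale (qhalf_pow 1) h"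

lemma F_linear [simp]: "linear_op (F a)"
proof -
  have "linear_op (\<lambda>h. scale (qhalf_pow (-1)) (E a h) - scale (qhalf_pow 1) h)"
    by (intro linear_op_diff linear_op_scale) auto
  then show ?thesis by (simp add: F_def linear_op_def)
qed

lemmas F_simps = linear_opD[OF F_linear]

lemma F_closed [simp]: "a \<in> acts \<Longrightarrow> h \<in> H \<Longrightarrow> F a h \<in> H"
  by (simp add: F_def)

lemma F_sq: 
  assumes "a \<in> acts" "h \<in> H" 
  shows "F a (F a h) = scale (- (qhalf_pow 1 + qhalf_pow (-1))) (F a h)"
  using assms by (intro poly_mapping_eqI)
    (simp add: F_def linear_opD[OF elementary_op_linear] E_sq lookup_minus lookup_add scale_add scale_diff
       q_var_eq algebra_simps)

lemma F_left_right:
  assumes "s \<in> S" "t \<in> S" "h \<in> H"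
  shows "F (\<lambda>w. s \<otimes> w) (F (\<lambda>w. w \<otimes> t) h) = F (\<lambda>w. w \<otimes> t) (F (\<lambda>w. s \<otimes> w) h)"
  using L_R_commute[OF assms] assms
  by (intro poly_mapping_eqI)
    (simp add: F_def linear_opD[OF elementary_op_linear] lookup_minus scale_diff algebra_simps)

text \<open>The bar involution is given on a basis, without any multiplicativity. Compatibility with
  multiplication by the bar-invariant C_s is what the construction of the basis requires. It comes
  from \<open>\<beta>_act\<close> for ascents, and descents are reduced to ascents by
  \<open>F_sq\<close>.\<close>

lemma hecke_bar_F:
  assumes "a \<in> acts" "h \<in> H" shows "hecke_bar (F a h) = F a (hecke_bar h)"
proof -
  have up: "hecke_bar (F a (T w)) = F a (\<beta> w)" if "w \<in> carrier W" "len w < len (a w)" for w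
    using that assms by (intro poly_mapping_eqI)
      (simp add: F_def elementary_op_single hecke_bar_diff hecke_bar_scale \<beta>_act lookup_minus
        lookup_add scale_add scale_diff algebra_simps)
  show ?thesis using assms(2)
  proof (induction rule: H_induct)
    case (T w)
    show ?case
    proof (cases "len w < len (a w)")
      case True then show ?thesis using up T by simp
    next
      case False
      let ?u = "a w"
      have u: "?u \<in> carrier W" "len ?u < len (a ?u)" using False act_len_neq assms T by auto
      \<comment> \<open>The definition of \<open>F a (T ?u)\<close> solved for its top term, T_w
        with w = a u. Applying \<open>F a\<close> once more leaves - F a T_u, as the powers of q
        cancel.\<close>
      have Tw: "T w = scale (qhalf_pow 1) (F a (T ?u)) + scale (qhalf_pow 2) (T ?u)"
        using u assms T by (simp add: F_def elementary_op_single scale_diff)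
      have "F a (T w) = - F a (T ?u)"
        unfolding Tw using assms u by (intro poly_mapping_eqI)
          (simp add: F_simps F_sq lookup_add algebra_simps)
      then have "hecke_bar (F a (T w)) = - F a (\<beta> ?u)"
        using up u by (simp add: hecke_bar_uminus)
      moreover have "F a (hecke_bar (T w)) = - F a (\<beta> ?u)"
        unfolding Tw using assms u by (intro poly_mapping_eqI)
          (simp add: hecke_bar_add hecke_bar_scale up F_simps F_sq lookup_add algebra_simps)
      ultimately show ?thesis by simp
    qed
  qed (auto simp: F_simps hecke_bar_scale hecke_bar_add)
qed

lemma \<beta>_triangular:
  assumes "w \<in> carrier W"
  shows "lookup (\<beta> w) w = qhalf_pow (- 2 * int (len w)) \<and>
    (\<forall>y \<in> carrier W. y \<noteq> w \<longrightarrow> len w \<le> len y \<longrightarrow> lookup (\<beta> w) y = 0)"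
  using assms
proof (induction rule: carrier_left_induct)
  case one then show ?case by (auto simp: lookup_single when_def)
next
  case (mult w s)
  note e = \<beta>_act[OF acts_left[OF mult(2)] mult(1)]
  have "lookup (\<beta> (s \<otimes> w)) y = qhalf_pow (-2) * (if len y < len (s \<otimes> y) then q_var * lookup (\<beta> w) (s \<otimes> y)
     else lookup (\<beta> w) (s \<otimes> y) + (q_var - 1) * lookup (\<beta> w) y) + (qhalf_pow (-2) - 1) * lookup (\<beta> w) y"
    if "y \<in> carrier W" for y
    using e mult that by (simp add: lookup_add lookup_E)
  note l = this
  have "lookup (\<beta> (s \<otimes> w)) (s \<otimes> w) = qhalf_pow (- 2 * int (len (s \<otimes> w)))"
  proof -
    have "s \<otimes> w \<noteq> w" using mult(3) by auto
    then have "lookup (\<beta> w) (s \<otimes> w) = 0" using mult by auto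
    then show ?thesis using mult by (simp add: l)
  qed
  moreover have "lookup (\<beta> (s \<otimes> w)) y = 0" if y: "y \<in> carrier W" "y \<noteq> s \<otimes> w" "len (s \<otimes> w) \<le> len y" for y
  proof -
    have 1: "lookup (\<beta> w) y = 0" using mult y by auto
    have "s \<otimes> y \<noteq> w" using y mult by auto
    moreover have "len w \<le> len (s \<otimes> y)" 
      by (rule len_gen_cases[OF mult(2) y(1)]) (use y mult(3) in auto)
    ultimately have "lookup (\<beta> w) (s \<otimes> y) = 0" using mult y by auto
    then show ?thesis using 1 y by (simp add: l)
  qed
  ultimately show ?case by blast
qed

text \<open>\<open>nc h y\<close> is the coefficient of \<open>h\<close> at the normalised basis element \<open>q\<^sub>y\<^sup>-\<^sup>1\<^sup>/\<^sup>2 T\<^sub>y\<close>.\<close>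

definition nc :: "('a \<Rightarrow>\<^sub>0 laurent) \<Rightarrow> 'a \<Rightarrow> laurent" where
  "nc h y = qhalf_pow (int (len y)) * lookup h y"

lemma nc_simps [simp]:
  "nc (g + h) y = nc g y + nc h y" "nc (g - h) y = nc g y - nc h y" "nc (- h) y = - nc h y"
  "nc (scale a h) y = a * nc h y" "nc 0 y = 0"
  by (simp_all add: nc_def lookup_add lookup_minus algebra_simps)

lemma nc_sum: "nc (sum f A) y = (\<Sum>x\<in>A. nc (f x) y)"
  by (induction A rule: infinite_finite_induct) auto

lemma lookup_nc: "lookup h y = qhalf_pow (- int (len y)) * nc h y"
  by (simp add: nc_def)

lemma nc_eq_0_iff: "nc h y = 0 \<longleftrightarrow> lookup h y = 0"
  by (metis lookup_nc mult_zero_right nc_def)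

lemma nc_eqI: "(\<And>y. nc g y = nc h y) \<Longrightarrow> g = h"
  by (intro poly_mapping_eqI) (simp add: lookup_nc)

lemma nc_F:
  assumes "a \<in> acts" "h \<in> H" "y \<in> carrier W"
  shows "nc (F a h) y = nc h (a y) - qhalf_pow (if len y < len (a y) then 1 else -1) * nc h y"
  by (rule act_len_cases[OF assms(1,3)])
    (simp_all add: nc_def F_def lookup_minus lookup_E q_var_eq algebra_simps assms)

text \<open>At a y of maximal length in the support, only \<beta> y contributes to the coefficient
  of the conjugate, by \<open>\<beta>_triangular\<close>. Hence \<open>nc h y\<close> is symmetric
  under k -> -k, and without exponents k \<le> 0 a symmetric Laurent polynomial is zero.\<close>

lemma bar_invariant_zero:
  assumes "h \<in> H" "hecke_bar h = h" "\<And>y k. k \<le> 0 \<Longrightarrow> lookup (nc h y) k = 0"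
  shows "h = 0"
proof (rule ccontr)
  assume "h \<noteq> 0"
  then have ne: "keys h \<noteq> {}" by (metis in_keys_iff empty_iff lookup_zero poly_mapping_eqI)
  define m where "m = Max (len ` keys h)"
  have "m \<in> len ` keys h" unfolding m_def by (rule Max_in) (use ne in auto)
  then obtain y where y: "y \<in> keys h" "len y = m" by blast
  have max: "len w \<le> len y" if "w \<in> keys h" for w
    unfolding y m_def using that by simp
  have keysH: "keys h \<subseteq> carrier W" using assms by (simp add: free_on_def)
  have "lookup (hecke_bar h) y = (\<Sum>w\<in>keys h. laurent_bar (lookup h w) * lookup (\<beta> w) y)"
    by (simp add: hecke_bar_def lookup_sum)
  also have "\<dots> = (\<Sum>w\<in>keys h. if w = y then laurent_bar (lookup h w) * lookup (\<beta> w) y else 0)"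
  proof (rule sum.cong)
    fix w assume "w \<in> keys h"
    then show "laurent_bar (lookup h w) * lookup (\<beta> w) y
        = (if w = y then laurent_bar (lookup h w) * lookup (\<beta> w) y else 0)"
      using \<beta>_triangular[of w] max[of w] subsetD[OF keysH, of w] subsetD[OF keysH y(1)] by auto
  qed simp
  also have "\<dots> = laurent_bar (lookup h y) * qhalf_pow (- 2 * int (len y))"
    using y \<beta>_triangular keysH by auto
  finally have "lookup h y = laurent_bar (lookup h y) * qhalf_pow (- 2 * int (len y))"
    using assms by simp
  then have "nc h y = qhalf_pow (int (len y)) * (laurent_bar (lookup h y) * qhalf_pow (- 2 * int (len y)))"
    unfolding nc_def by (rule arg_cong)
  then have "laurent_bar (nc h y) = nc h y" by (simp add: nc_def mult.commute)
  then have "lookup (nc h y) k = lookup (nc h y) (- k)" for k by (metis lookup_laurent_bar)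
  then have "lookup (nc h y) k = 0" for k using assms(3)[of k y] assms(3)[of "-k" y] by (cases "k \<le> 0") auto
  then have "nc h y = 0" by (intro poly_mapping_eqI) simp
  then show False using y by (simp add: nc_eq_0_iff in_keys_iff)
qed

end

section \<open>The Kazhdan--Lusztig basis\<close>

lemma lookup_qhalf_pow: "lookup (qhalf_pow a) k = (if k = a then 1 else 0)"
  by (auto simp: qhalf_pow_def lookup_single when_def)

context coxeter_system
begin

text \<open>
  The conditions on the exponents say that \<open>nc h y = \<plusminus> q\<^sup>(\<^sup>l\<^sup>(\<^sup>w\<^sup>)\<^sup>-\<^sup>l\<^sup>(\<^sup>y\<^sup>)\<^sup>)\<^sup>/\<^sup>2 \<open>bar\<close>(P)\<close> for a polynomial \<open>P\<close> in \<open>q\<close>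
  satisfying the degree bound.
\<close>

definition is_kl_basis :: "'a \<Rightarrow> ('a \<Rightarrow>\<^sub>0 laurent) \<Rightarrow> bool" where
  "is_kl_basis w h \<longleftrightarrow> h \<in> H \<and> hecke_bar h = h \<and> nc h w = 1 \<and>
    (\<forall>y. lookup h y \<noteq> 0 \<longrightarrow> bruhat_le y w) \<and>
    (\<forall>y k. y \<noteq> w \<longrightarrow> k \<le> 0 \<longrightarrow> lookup (nc h y) k = 0) \<and>
    (\<forall>y k. lookup (nc h y) k \<noteq> 0 \<longrightarrow>
      k \<le> int (len w) - int (len y) \<and> even (int (len w) - int (len y) - k))"

lemma is_kl_basisD:
  assumes "is_kl_basis w h"
  shows "h \<in> H" "hecke_bar h = h" "nc h w = 1" "lookup h y \<noteq> 0 \<Longrightarrow> bruhat_le y w"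
    "y \<noteq> w \<Longrightarrow> k \<le> 0 \<Longrightarrow> lookup (nc h y) k = 0"
    "lookup (nc h y) k \<noteq> 0 \<Longrightarrow> k \<le> int (len w) - int (len y) \<and> even (int (len w) - int (len y) - k)"
    "nc h y \<noteq> 0 \<Longrightarrow> bruhat_le y w"
  using assms by (auto simp: is_kl_basis_def nc_eq_0_iff)

lemma is_kl_basis_unique:
  assumes "is_kl_basis w h" "is_kl_basis w h'" shows "h = h'"
proof -
  have "h - h' = 0"
  proof (rule bar_invariant_zero)
    show "lookup (nc (h - h') y) k = 0" if "k \<le> 0" for y k
      using is_kl_basisD(3,5)[OF assms(1)] is_kl_basisD(3,5)[OF assms(2)] that
      by (cases "y = w") (simp_all add: lookup_minus)
  qed (use assms in \<open>simp_all add: is_kl_basisD hecke_bar_diff\<close>)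
  then show ?thesis by simp
qed

text \<open>The candidate \<open>F a h\<close> is bar invariant, but at a z with a z < z the factor
  q^{-1/2} turns the exponent 1 of \<open>nc h z\<close> into a constant term, with opposite sign.
  Adding that multiple of C_z removes it, and creates no other constant term.\<close>

lemma is_kl_basis_step:
  assumes h: "is_kl_basis w h" and a: "a \<in> acts" and w: "w \<in> carrier W" "len w < len (a w)"
    and C: "\<And>z. z \<in> carrier W \<Longrightarrow> len z < len w \<Longrightarrow> is_kl_basis z (C z)"
  shows "is_kl_basis (a w) (F a h + 
    (\<Sum>z | z \<in> keys h \<and> len (a z) < len z. scale (of_int (lookup (nc h z) 1)) (C z)))"
proof -
  let ?Z = "{z \<in> keys h. len (a z) < len z}"
  let ?m = "\<lambda>z. lookup (nc h z) 1"
  let ?g = "F a h + (\<Sum>z\<in>?Z. scale (of_int (?m z)) (C z))"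
  have hH: "h \<in> H" using h by (rule is_kl_basisD)
  have law: "len (a w) = Suc (len w)" using a w by (auto elim: act_len_cases)
  have Z: "z \<in> carrier W" "len z < len w" "bruhat_le z w" "is_kl_basis z (C z)" if "z \<in> ?Z" for z
  proof -
    have "bruhat_le z w" using is_kl_basisD(4)[OF h] that by (simp add: in_keys_iff)
    moreover have "z \<noteq> w" using that w by auto
    ultimately show "z \<in> carrier W" "len z < len w" "bruhat_le z w" "is_kl_basis z (C z)"
      using bruhat_le_len bruhat_le_closed C by blast+
  qed
  have finZ: "finite ?Z" by simp
  have gH: "?g \<in> H"
    using hH a is_kl_basisD(1)[OF Z(4)] by (intro free_on_add F_closed free_on_sum free_on_scale) simp_all
  have bar: "hecke_bar ?g = ?g"
    using a hH is_kl_basisD(2)[OF h] is_kl_basisD(2)[OF Z(4)]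
    by (simp add: hecke_bar_add hecke_bar_F hecke_bar_sum hecke_bar_scale)
  have nc_g: "nc ?g y = nc h (a y) - qhalf_pow (if len y < len (a y) then 1 else -1) * nc h y
    + (\<Sum>z\<in>?Z. of_int (?m z) * nc (C z) y)" if "y \<in> carrier W" for y
    using a hH that by (simp add: nc_F nc_sum)
  have supp: "bruhat_le y (a w)" if "lookup ?g y \<noteq> 0" for y
  proof -
    have y: "y \<in> carrier W" using gH that by (auto simp: free_on_iff)
    have "nc ?g y \<noteq> 0" using that unfolding nc_eq_0_iff .
    then have "nc h (a y) \<noteq> 0 \<or> nc h y \<noteq> 0 \<or> (\<exists>z\<in>?Z. nc (C z) y \<noteq> 0)"
      unfolding nc_g[OF y] by (metis (no_types, lifting) diff_zero add_0 mult_zero_right sum.neutral)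
    then show ?thesis
    proof (elim disjE bexE)
      assume "nc h (a y) \<noteq> 0"
      then show ?thesis using act_bruhat_mono[OF a is_kl_basisD(7)[OF h]] w a y by fastforce
    next
      assume "nc h y \<noteq> 0"
      then show ?thesis using is_kl_basisD(7)[OF h] act_bruhat_le[OF a w] bruhat_le_trans by blast
    next
      fix z assume "z \<in> ?Z" "nc (C z) y \<noteq> 0"
      then show ?thesis using is_kl_basisD(7)[OF Z(4)] Z(3) act_bruhat_le[OF a w] bruhat_le_trans by blast
    qed
  qed
  have above: "nc h y = 0" if "len w < len y" for y
    using is_kl_basisD(7)[OF h, of y] bruhat_le_len[of y w] that by auto
  have one: "nc ?g (a w) = 1"
  proof -
    have "nc (C z) (a w) = 0" if "z \<in> ?Z" for z
    proof -
      have "\<not> len (a w) < len z" "a w \<noteq> z" using Z(2)[OF that] law by auto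
      then show ?thesis using is_kl_basisD(7)[OF Z(4)[OF that]] bruhat_le_len by blast
    qed
    then show ?thesis using is_kl_basisD(3)[OF h] above law a w 
      unfolding nc_g[OF act_closed[OF a w(1)]] by simp
  qed
  have pos: "lookup (nc ?g y) k = 0" if "y \<noteq> a w" "k \<le> 0" for y k
  proof (cases "y \<in> carrier W")
    case False
    then have "nc ?g y = 0" using gH by (simp add: nc_eq_0_iff free_on_iff del: nc_simps)
    then show ?thesis by (simp del: nc_simps)
  next
    case y: True
    have "(\<Sum>z\<in>?Z. lookup (of_int (?m z) * nc (C z) y) k)
        = (\<Sum>z\<in>?Z. if z = y then (if k = 0 then ?m y else 0) else 0)"
    proof (rule sum.cong)
      fix z assume "z \<in> ?Z"
      from is_kl_basisD(3,5)[OF Z(4)[OF this]] 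
      show "lookup (of_int (?m z) * nc (C z) y) k = (if z = y then (if k = 0 then ?m y else 0) else 0)"
        using \<open>k \<le> 0\<close> by (auto simp: lookup_one_laurent)
    qed simp
    also have "\<dots> = (if y \<in> ?Z \<and> k = 0 then ?m y else 0)" using finZ by simp
    finally have sum: "lookup (\<Sum>z\<in>?Z. of_int (?m z) * nc (C z) y) k = (if y \<in> ?Z \<and> k = 0 then ?m y else 0)"
      by (simp add: lookup_sum)
    have "a y \<noteq> w" using that a y by auto
    then have 1: "lookup (nc h (a y)) k = 0" using is_kl_basisD(5)[OF h] that by blast
    \<comment> \<open>If y < a y, the factor q^{1/2} only raises exponents. If a y < y, exponents
      drop by one, and the constant term that then arises is cancelled by
      \<open>sum\<close>.\<close>
    show ?thesis
    proof (cases "len y < len (a y)")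
      case True
      have "lookup (nc h y) (k - 1) = 0"
        using is_kl_basisD(3,5)[OF h] that by (cases "y = w") (auto simp: lookup_one_laurent)
      then show ?thesis using True 1 sum unfolding nc_g[OF y] by (simp add: lookup_add lookup_minus)
    next
      case False
      then have "y \<noteq> w" using w by auto
      then have "k < 0 \<Longrightarrow> lookup (nc h y) (k + 1) = 0" using is_kl_basisD(5)[OF h] by auto
      moreover have "y \<in> ?Z \<or> ?m y = 0"
        using False act_len_neq[OF a y] by (auto simp: in_keys_iff simp flip: nc_eq_0_iff)
      ultimately show ?thesis using False 1 sum that unfolding nc_g[OF y]
        by (cases "k = 0") (auto simp: lookup_add lookup_minus)
    qed
  qed
  have par: "k \<le> int (len (a w)) - int (len y) \<and> even (int (len (a w)) - int (len y) - k)"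
    if "lookup (nc ?g y) k \<noteq> 0" for y k
  proof -
    have y: "y \<in> carrier W"
    proof (rule ccontr)
      assume "y \<notin> carrier W"
      then have "nc ?g y = 0" using gH by (simp add: nc_eq_0_iff free_on_iff del: nc_simps)
      then show False using that by (simp del: nc_simps)
    qed
    let ?e = "if len y < len (a y) then 1 else -1 :: int"
    have "lookup (nc h (a y)) k \<noteq> 0 \<or> lookup (nc h y) (k - ?e) \<noteq> 0 
        \<or> (\<exists>z\<in>?Z. lookup (of_int (?m z) * nc (C z) y) k \<noteq> 0)"
    proof (rule ccontr)
      assume *: "\<not> ?thesis"
      then have "(\<Sum>z\<in>?Z. lookup (of_int (?m z) * nc (C z) y) k) = 0" by (intro sum.neutral) auto
      then have "lookup (nc ?g y) k = 0"
        using * unfolding nc_g[OF y] by (simp add: lookup_add lookup_minus lookup_sum)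
      then show False using that by simp
    qed
    then show ?thesis
    proof (elim disjE bexE)
      assume "lookup (nc h (a y)) k \<noteq> 0"
      note p = is_kl_basisD(6)[OF h this]
      show ?thesis by (rule act_len_cases[OF a y]) (use p law in auto)
    next
      assume "lookup (nc h y) (k - ?e) \<noteq> 0"
      from is_kl_basisD(6)[OF h this] show ?thesis using law by (auto split: if_splits)
    next
      fix z assume z: "z \<in> ?Z" "lookup (of_int (?m z) * nc (C z) y) k \<noteq> 0"
      then have "?m z \<noteq> 0" "lookup (nc (C z) y) k \<noteq> 0" by auto
      from is_kl_basisD(6)[OF h this(1)] is_kl_basisD(6)[OF Z(4)[OF z(1)] this(2)]
      show ?thesis using law by auto
    qed
  qed
  show ?thesis unfolding is_kl_basis_def using gH bar one supp pos par by blast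
qed

lemma is_kl_basis_exists: "w \<in> carrier W \<Longrightarrow> \<exists>h. is_kl_basis w h"
proof (induction "len w" arbitrary: w rule: less_induct)
  case less
  show ?case
  proof (cases "w = \<one>")
    case True
    have "nc (T \<one>) y = (if y = \<one> then 1 else 0)" for y
      by (auto simp: nc_def lookup_single when_def)
    then have "is_kl_basis \<one> (T \<one>)"
      by (auto simp: is_kl_basis_def lookup_single when_def lookup_one_laurent split: if_splits)
    then show ?thesis using True by blast
  next
    case False
    then obtain s where s: "s \<in> S" "len (s \<otimes> w) < len w"
      using left_descents_nonempty less by (metis ex_in_conv left_descents_iff)
    let ?C = "\<lambda>z. SOME h. is_kl_basis z h"
    have C: "is_kl_basis z (?C z)" if "z \<in> carrier W" "len z < len w" for z
      using someI_ex[of "is_kl_basis z"] less that by blast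
    show ?thesis
      using is_kl_basis_step[of "s \<otimes> w" "?C (s \<otimes> w)" "\<lambda>w. s \<otimes> w" ?C] C s less by auto
  qed
qed

definition C :: "'a \<Rightarrow> 'a \<Rightarrow>\<^sub>0 laurent" where
  "C w = (SOME h. is_kl_basis w h)"

lemma is_kl_basis_C: "w \<in> carrier W \<Longrightarrow> is_kl_basis w (C w)"
  unfolding C_def using is_kl_basis_exists by (rule someI_ex)

lemmas C_props = is_kl_basisD[OF is_kl_basis_C]

lemma C_closed [simp]: "w \<in> carrier W \<Longrightarrow> C w \<in> H"
  by (rule C_props)

text \<open>Up to sign, \<open>c1 y w\<close> is \<open>\<mu>(y, w)\<close> if \<open>y < w\<close>, and it is \<open>0\<close> otherwise.\<close>

definition c1 :: "'a \<Rightarrow> 'a \<Rightarrow> int" where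
  "c1 y w = lookup (nc (C w) y) 1"

lemma c1_bruhat: 
  assumes "w \<in> carrier W" "c1 y w \<noteq> 0" 
  shows "bruhat_le y w" "y \<noteq> w" "len y < len w" "y \<in> carrier W" "y \<in> keys (C w)"
proof -
  have "nc (C w) y \<noteq> 0" using assms(2) by (auto simp: c1_def)
  then show *: "bruhat_le y w" "y \<noteq> w" using C_props(3,7)[OF assms(1)] assms(2)
    by (auto simp: c1_def lookup_one_laurent)
  then show "len y < len w" "y \<in> carrier W" using bruhat_le_len bruhat_le_closed by blast+
  show "y \<in> keys (C w)" using assms(2) by (auto simp: c1_def in_keys_iff simp flip: nc_eq_0_iff)
qed

lemma F_C_up:
  assumes "a \<in> acts" "w \<in> carrier W" "len w < len (a w)"
  shows "F a (C w) = C (a w) - (\<Sum>z | z \<in> keys (C w) \<and> len (a z) < len z. scale (of_int (c1 z w)) (C z))"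
  using is_kl_basis_unique[OF is_kl_basis_step[OF is_kl_basis_C assms(1), of w C] is_kl_basis_C[of "a w"]]
    assms is_kl_basis_C by (simp add: c1_def eq_diff_eq)

text \<open>By \<open>F_sq\<close> this scalar is the eigenvalue of \<open>F a\<close> on its image.
  The recursion writes C_w as an element of the image plus multiples of shorter C_z with a z < z,
  which are eigenvectors by induction.\<close>

lemma F_C_down:
  assumes "a \<in> acts" "w \<in> carrier W" "len (a w) < len w"
  shows "F a (C w) = scale (- (qhalf_pow 1 + qhalf_pow (-1))) (C w)"
  using assms
proof (induction "len w" arbitrary: w rule: less_induct)
  case less
  let ?u = "a w" and ?d = "- (qhalf_pow 1 + qhalf_pow (-1))"
  have u: "?u \<in> carrier W" "len ?u < len (a ?u)" using less by auto
  let ?Z = "{z \<in> keys (C ?u). len (a z) < len z}"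
  have e: "C w = F a (C ?u) + (\<Sum>z\<in>?Z. scale (of_int (c1 z ?u)) (C z))"
    using F_C_up[OF less(2) u] less by simp
  have z: "F a (C z) = scale ?d (C z)" if "z \<in> ?Z" for z
  proof (rule less(1))
    have "bruhat_le z ?u" using that C_props(4)[OF u(1)] by (simp add: in_keys_iff)
    then show "len z < len w" "z \<in> carrier W" using bruhat_le_len[of z ?u] bruhat_le_closed less by auto
  qed (use that less in auto)
  have "F a (C w) = scale ?d (F a (C ?u)) + (\<Sum>z\<in>?Z. scale (of_int (c1 z ?u)) (F a (C z)))"
    unfolding e F_simps using F_sq[OF less(2) C_closed[OF u(1)]] by simp
  also have "(\<Sum>z\<in>?Z. scale (of_int (c1 z ?u)) (F a (C z))) = (\<Sum>z\<in>?Z. scale (of_int (c1 z ?u)) (scale ?d (C z)))"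
    using z by (intro sum.cong) auto
  also have "scale ?d (F a (C ?u)) + \<dots> = scale ?d (C w)"
    unfolding e by (simp add: scale_add scale_sum mult.commute del: minus_add_distrib)
  finally show ?case .
qed

text \<open>The eigenvector equation \<open>F_C_down\<close>, read off at the ascent y.\<close>

lemma nc_C_descent:
  assumes "a \<in> acts" "w \<in> carrier W" "len (a w) < len w" "y \<in> carrier W" "len y < len (a y)"
  shows "nc (C w) y = - qhalf_pow 1 * nc (C w) (a y)"
proof -
  have "nc (C w) (a y) - qhalf_pow 1 * nc (C w) y = - (qhalf_pow 1 + qhalf_pow (-1)) * nc (C w) y"
    using arg_cong[OF F_C_down[OF assms(1-3)], of "\<lambda>h. nc h y"] assms by (simp add: nc_F)
  then have "nc (C w) (a y) = - (qhalf_pow (-1) * nc (C w) y)"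
    by (simp add: algebra_simps eq_neg_iff_add_eq_0)
  then show ?thesis by simp
qed

text \<open>By \<open>nc_C_descent\<close> the exponent 1 at y comes from the constant term at a y,
  and constant terms of \<open>nc (C w)\<close> occur only at w. This is the classical rule that
  \<mu>(y,w) \<noteq> 0 forces w = a y if a descends from w but not from y.\<close>

lemma c1_descent:
  assumes "a \<in> acts" "w \<in> carrier W" "len (a w) < len w" "y \<in> carrier W" "len y < len (a y)" "c1 y w \<noteq> 0"
  shows "a y = w"
proof (rule ccontr)
  assume "a y \<noteq> w"
  then have "lookup (nc (C w) (a y)) 0 = 0" using C_props(5)[OF assms(2)] by simp
  then show False using assms(6) nc_C_descent[OF assms(1-5)] by (simp add: c1_def)
qed

lemma c1_act:
  assumes "a \<in> acts" "w \<in> carrier W" "len w < len (a w)"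
  shows "c1 w (a w) = -1"
  using nc_C_descent[of a "a w" w] assms C_props(3)[of "a w"]
  by (simp add: c1_def lookup_qhalf_pow)

end

section \<open>Comparison with the Kazhdan--Lusztig polynomials\<close>

lemma eval_q_pCons: "eval_q (pCons c p) = of_int c + q_var * eval_q p"
  by (simp add: eval_q_def map_poly_pCons)

lemma lookup_of_int_laurent: "lookup (of_int c :: laurent) k = (if k = 0 then c else 0)"
  using lookup_of_int_mult[of c 1 k] by (simp add: lookup_one_laurent)

lemma lookup_eval_q: "lookup (eval_q p) k = (if 0 \<le> k \<and> even k then coeff p (nat (k div 2)) else 0)"
proof (induction p arbitrary: k)
  case 0 then show ?case by (simp add: eval_q_def)
next
  case (pCons c p)
  have "nat (k div 2) = Suc (nat ((k - 2) div 2))" if "2 \<le> k" for k :: int using that by linarith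
  moreover have "k = 1 \<or> k = 0 \<or> k < 0 \<or> 2 \<le> k" by linarith
  ultimately show ?case
    using pCons.IH[of "k - 2"] by (auto simp: eval_q_pCons lookup_add lookup_of_int_laurent q_var_eq)
qed

lemma eval_q_inject: "eval_q p = eval_q p' \<longleftrightarrow> p = p'"
proof
  assume e: "eval_q p = eval_q p'"
  have "coeff p i = coeff p' i" for i
    using lookup_eval_q[of p "2 * int i"] lookup_eval_q[of p' "2 * int i"] e by simp
  then show "p = p'" by (rule poly_eqI)
qed simp

context right_angled_system
begin

text \<open>Elements below w are products of at most l(w) letters from a finite alphabet; this
  counting takes the place of the subword property.\<close>

lemma finite_bruhat_interval: "finite {y. bruhat_le y w}"
proof (rule finite_subset)
  show "{y. bruhat_le y w} \<subseteq> word_prod ` {ws. set ws \<subseteq> S \<and> length ws \<le> len w}"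
  proof
    fix y assume "y \<in> {y. bruhat_le y w}"
    then have "y \<in> carrier W" "len y \<le> len w" using bruhat_le_closed bruhat_le_len[of y w] by auto
    then show "y \<in> word_prod ` {ws. set ws \<subseteq> S \<and> length ws \<le> len w}"
      using red_word[of y] by (intro image_eqI[of _ _ "red_word y"]) (auto simp: in_lists_conv_set)
  qed
  show "finite (word_prod ` {ws. set ws \<subseteq> S \<and> length ws \<le> len w})"
    using finite_gens finite_lists_length_le by blast
qed

lemma nc_kl_element:
  "nc (kl_element w P) y = (if bruhat_le y w then 
    (-1) ^ (len w + len y) * (qhalf_pow (int (len w) - int (len y)) * laurent_bar (eval_q (P y))) else 0)"
proof -
  let ?c = "\<lambda>y. (-1) ^ len y * qhalf_pow (- 2 * int (len y)) * laurent_bar (eval_q (P y))"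
  have "lookup (\<Sum>y\<in>{y. bruhat_le y w}. scale (?c y) (T y)) y
      = (\<Sum>z\<in>{y. bruhat_le y w}. if z = y then ?c y else 0)"
    unfolding lookup_sum by (intro sum.cong) (auto simp: lookup_single when_def)
  also have "\<dots> = (if bruhat_le y w then ?c y else 0)"
    using finite_bruhat_interval by simp
  finally have "lookup (kl_element w P) y = (-1) ^ len w * qhalf_pow (int (len w)) * (if bruhat_le y w then ?c y else 0)"
    unfolding kl_element_def by simp
  then show ?thesis
    by (auto simp: nc_def power_add mult.assoc mult.left_commute[of "qhalf_pow _" "(-1) ^ _"])
qed

lemma lookup_sign_mult: "lookup ((-1) ^ n * (x :: laurent)) k = (-1) ^ n * lookup x k"
  by (cases "even n") auto

lemma lookup_nc_kl_element:
  "lookup (nc (kl_element w P) y) k = (if bruhat_le y w then 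
    (-1) ^ (len w + len y) * lookup (eval_q (P y)) (int (len w) - int (len y) - k) else 0)"
  by (simp add: nc_kl_element lookup_sign_mult)

text \<open>The exponent k at y belongs to the power (l(w) - l(y) - k)/2 of q in P_y. So the degree
  bound for y < w says exactly that k is positive, and polynomiality gives the upper bound and the
  parity of k.\<close>

lemma is_kl_family_imp_basis:
  assumes "w \<in> carrier W" "is_kl_family w P" shows "is_kl_basis w (kl_element w P)"
proof -
  have P: "P w = 1" "\<And>y. bruhat_less y w \<Longrightarrow> 2 * degree (P y) + len y + 1 \<le> len w"
    "hecke_bar (kl_element w P) = kl_element w P"
    using assms(2) by (auto simp: is_kl_family_def)
  have supp: "bruhat_le y w" if "nc (kl_element w P) y \<noteq> 0" for y
    using that by (auto simp: nc_kl_element split: if_splits)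
  have "kl_element w P \<in> H"
    using supp bruhat_le_closed by (auto simp: free_on_iff simp flip: nc_eq_0_iff)
  moreover have "nc (kl_element w P) w = 1"
    using assms P by (simp add: nc_kl_element eval_q_def)
  moreover have "lookup (nc (kl_element w P) y) k = 0" if "y \<noteq> w" "k \<le> 0" for y k
  proof (cases "bruhat_le y w")
    case True
    then have "2 * degree (P y) + len y + 1 \<le> len w" using P that by (simp add: bruhat_less_def)
    then have "degree (P y) < nat ((int (len w) - int (len y) - k) div 2)" 
      if ev: "even (int (len w) - int (len y) - k)"
    proof -
      obtain m where "int (len w) - int (len y) - k = 2 * m" using ev by (elim evenE)
      then show ?thesis using \<open>2 * degree (P y) + len y + 1 \<le> len w\<close> \<open>k \<le> 0\<close> by simp
    qed
    then show ?thesis using True by (auto simp: lookup_nc_kl_element lookup_eval_q coeff_eq_0)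
  qed (simp add: lookup_nc_kl_element)
  moreover have "k \<le> int (len w) - int (len y) \<and> even (int (len w) - int (len y) - k)"
    if "lookup (nc (kl_element w P) y) k \<noteq> 0" for y k
    using that by (auto simp: lookup_nc_kl_element lookup_eval_q split: if_splits)
  ultimately show ?thesis using P(3) supp unfolding is_kl_basis_def nc_eq_0_iff[symmetric] by blast
qed

lemma is_kl_family_exists:
  assumes w: "w \<in> carrier W" shows "\<exists>P. is_kl_family w P"
proof -
  let ?d = "\<lambda>y. int (len w) - int (len y)"
  \<comment> \<open>Coefficients are read off from \<open>C w\<close> by undoing sign, shift and
    bar. For i > l(w) the exponent \<open>?d y - 2 * int i\<close> is negative, where
    \<open>nc (C w) y\<close> vanishes, so l(w) + 1 coefficients suffice.\<close>
  define P where "P y = (if bruhat_le y w then 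
    Poly (map (\<lambda>i. (-1) ^ (len w + len y) * lookup (nc (C w) y) (?d y - 2 * int i)) [0..<Suc (len w)]) else 0)" for y
  have coeffP: "coeff (P y) i = (-1) ^ (len w + len y) * lookup (nc (C w) y) (?d y - 2 * int i)"
    if "bruhat_le y w" for y i
  proof (cases "i < Suc (len w)")
    case True then show ?thesis using that by (simp add: P_def coeff_Poly_eq nth_default_def del: upt_Suc)
  next
    case False
    then have "lookup (nc (C w) y) (?d y - 2 * int i) = 0"
      using C_props(3)[OF w] C_props(5)[OF w, of y "?d y - 2 * int i"]
      by (cases "y = w") (auto simp: lookup_one_laurent)
    then show ?thesis using that False by (simp add: P_def coeff_Poly_eq nth_default_def del: upt_Suc)
  qed
  have e: "kl_element w P = C w"
  proof (rule nc_eqI, rule poly_mapping_eqI)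
    fix y k
    show "lookup (nc (kl_element w P) y) k = lookup (nc (C w) y) k"
    proof (cases "bruhat_le y w")
      case True
      show ?thesis
      proof (cases "0 \<le> ?d y - k \<and> even (?d y - k)")
        case even: True
        then obtain m where "?d y - k = 2 * m" by (elim conjE evenE)
        then have "?d y - 2 * int (nat ((?d y - k) div 2)) = k" using even by simp
        then show ?thesis using True even 
          by (simp add: lookup_nc_kl_element lookup_eval_q coeffP flip: mult.assoc power_add)
      next
        case False
        then have "lookup (nc (C w) y) k = 0" using C_props(6)[OF w, of y k] by fastforce
        then show ?thesis using False True by (auto simp: lookup_nc_kl_element lookup_eval_q)
      qed
    next
      case False
      then have "nc (C w) y = 0" using C_props(7)[OF w] by blast
      then show ?thesis using False by (simp add: nc_kl_element)
    qed
  qed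
  have "P w = 1"
  proof (rule poly_eqI)
    fix i show "coeff (P w) i = coeff 1 i"
      using coeffP[of w i] C_props(3)[OF w] w
      by (auto simp: lookup_one_laurent)
  qed
  moreover have "2 * degree (P y) + len y + 1 \<le> len w" if "bruhat_less y w" for y
  proof -
    have y: "bruhat_le y w" "y \<noteq> w" "len y < len w"
      using that bruhat_le_len by (auto simp: bruhat_less_def)
    show ?thesis
    proof (cases "P y = 0")
      case False
      then have "coeff (P y) (degree (P y)) \<noteq> 0" by simp
      then have "\<not> ?d y - 2 * int (degree (P y)) \<le> 0"
        using C_props(5)[OF w y(2)] by (auto simp: coeffP[OF y(1)])
      then show ?thesis by linarith
    qed (use y in simp)
  qed
  moreover have "\<forall>y. \<not> bruhat_le y w \<longrightarrow> P y = 0" by (simp add: P_def)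
  moreover have "hecke_bar (kl_element w P) = kl_element w P" unfolding e by (rule C_props(2)[OF w])
  ultimately have "is_kl_family w P" unfolding is_kl_family_def by blast
  then show ?thesis by blast
qed

lemma is_kl_family_unique:
  assumes w: "w \<in> carrier W" and "is_kl_family w P" "is_kl_family w P'" shows "P = P'"
proof
  fix y
  show "P y = P' y"
  proof (cases "bruhat_le y w")
    case True
    have e: "kl_element w P = kl_element w P'"
      using is_kl_basis_unique is_kl_family_imp_basis[OF w] assms by blast
    have "lookup (eval_q (P y)) j = lookup (eval_q (P' y)) j" for j
    proof -
      have "(-1) ^ (len w + len y) * lookup (eval_q (P y)) j = (-1) ^ (len w + len y) * lookup (eval_q (P' y)) j"
        using lookup_nc_kl_element[of w P y "int (len w) - int (len y) - j"]
          lookup_nc_kl_element[of w P' y "int (len w) - int (len y) - j"] e True by simp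
      then show ?thesis by simp
    qed
    then show ?thesis using eval_q_inject poly_mapping_eqI by metis
  qed (use assms in \<open>auto simp: is_kl_family_def\<close>)
qed

lemma kl_poly_family:
  assumes "w \<in> carrier W" shows "is_kl_family w (\<lambda>y. kl_poly y w)"
proof -
  have "\<exists>!P. is_kl_family w P" using is_kl_family_exists is_kl_family_unique assms by blast
  from theI'[OF this] show ?thesis by (simp add: kl_poly_def)
qed

lemma kl_element_kl_poly: "w \<in> carrier W \<Longrightarrow> kl_element w (\<lambda>y. kl_poly y w) = C w"
  using is_kl_basis_unique is_kl_family_imp_basis kl_poly_family is_kl_basis_C by blast

text \<open>The exponent 1 corresponds to the largest degree allowed, (l(w) - l(y) - 1)/2. The
  condition on the leading coefficient covers the zero polynomial, whose degree counts as 0.\<close>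

lemma kl_prec_c1:
  assumes w: "w \<in> carrier W"
  shows "c1 y w \<noteq> 0 \<longleftrightarrow> kl_prec y w \<and> lead_coeff (kl_poly y w) \<noteq> 0"
proof -
  let ?P = "kl_poly y w" and ?d = "int (len w) - int (len y)"
  have c1: "c1 y w = (if bruhat_le y w then (-1) ^ (len w + len y) * 
      (if 0 \<le> ?d - 1 \<and> even (?d - 1) then coeff ?P (nat ((?d - 1) div 2)) else 0) else 0)"
    unfolding c1_def kl_element_kl_poly[OF w, symmetric] by (simp add: lookup_nc_kl_element lookup_eval_q)
  have deg: "2 * degree ?P + len y + 1 \<le> len w" if "bruhat_less y w"
    using kl_poly_family[OF w] that by (auto simp: is_kl_family_def)
  show ?thesis
  proof
    assume nz: "c1 y w \<noteq> 0"
    then have less: "bruhat_less y w" using c1_bruhat[OF w] by (simp add: bruhat_less_def)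
    have cf: "0 \<le> ?d - 1" "even (?d - 1)" "coeff ?P (nat ((?d - 1) div 2)) \<noteq> 0"
      using nz by (auto simp: c1 split: if_splits)
    then have "nat ((?d - 1) div 2) \<le> degree ?P" by (intro le_degree)
    moreover obtain m where "?d - 1 = 2 * m" using cf(2) by (elim evenE)
    ultimately have "2 * degree ?P + len y + 1 = len w" using deg[OF less] cf(1) by simp
    then show "kl_prec y w \<and> lead_coeff ?P \<noteq> 0" using less cf(3) by (auto simp: kl_prec_def)
  next
    assume *: "kl_prec y w \<and> lead_coeff ?P \<noteq> 0"
    then have "int (len w) = 2 * int (degree ?P) + int (len y) + 1" "bruhat_le y w"
      by (auto simp: kl_prec_def bruhat_less_def)
    then show "c1 y w \<noteq> 0" using * by (simp add: c1)
  qed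
qed

lemma mu_nonzero_iff:
  assumes "y \<in> carrier W" "w \<in> carrier W"
  shows "mu y w \<noteq> 0 \<longleftrightarrow> c1 y w \<noteq> 0 \<or> c1 w y \<noteq> 0"
proof -
  have "\<not> (kl_prec y w \<and> kl_prec w y)"
    using bruhat_le_len[of y w] bruhat_le_len[of w y] by (auto simp: kl_prec_def bruhat_less_def)
  then show ?thesis using kl_prec_c1[of w y] kl_prec_c1[of y w] assms by (auto simp: mu_def)
qed

end

section \<open>The left preorder in the Kazhdan--Lusztig basis\<close>

context coxeter_system
begin

abbreviation (input) lact :: "'a \<Rightarrow> 'a \<Rightarrow> 'a" where "lact s \<equiv> \<lambda>w. s \<otimes> w"

lemma nc_C_above: "w \<in> carrier W \<Longrightarrow> y \<noteq> w \<Longrightarrow> len w \<le> len y \<Longrightarrow> nc (C w) y = 0"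
  using C_props(7)[of w y] bruhat_le_len[of y w] by auto

lemma nc_linear_ext: "nc (linear_ext f g) y = (\<Sum>w\<in>keys g. lookup g w * nc (f w) y)"
  by (simp add: linear_ext_def nc_sum)

text \<open>Linear independence of the C_w by triangularity: at a y of maximal length in the support
  of g, only C_y has a coefficient.\<close>

lemma linear_ext_C_zero:
  assumes "g \<in> H" "linear_ext C g = 0" shows "g = 0"
proof (rule ccontr)
  assume "g \<noteq> 0"
  then have ne: "keys g \<noteq> {}" by (metis in_keys_iff empty_iff lookup_zero poly_mapping_eqI)
  define m where "m = Max (len ` keys g)"
  have "m \<in> len ` keys g" unfolding m_def by (rule Max_in) (use ne in auto)
  then obtain y where y: "y \<in> keys g" "len y = m" by blast
  have max: "len w \<le> len y" if "w \<in> keys g" for w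
    unfolding y m_def using that by simp
  have cl: "w \<in> carrier W" if "w \<in> keys g" for w using assms that by (auto simp: free_on_def)
  have "nc (linear_ext C g) y = (\<Sum>w\<in>keys g. if w = y then lookup g w else 0)"
    unfolding nc_linear_ext
  proof (rule sum.cong)
    fix w assume w: "w \<in> keys g"
    show "lookup g w * nc (C w) y = (if w = y then lookup g w else 0)"
      using nc_C_above[OF cl[OF w]] max[OF w] C_props(3)[OF cl[OF w]] by auto
  qed simp
  then show False using y assms by (simp add: in_keys_iff)
qed

lemma linear_ext_C_inject: "g \<in> H \<Longrightarrow> g' \<in> H \<Longrightarrow> linear_ext C g = linear_ext C g' \<Longrightarrow> g = g'"
  using linear_ext_C_zero[of "g - g'"] linear_opD(5)[OF linear_ext_linear, of C g g'] by simp

text \<open>The coordinate vector of C_s C_w, or of C_w C_s: the basis element \<open>T z\<close>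
  stands for C_z, and \<open>linear_ext C\<close> turns coordinates back into an element.\<close>

definition FC :: "('a \<Rightarrow> 'a) \<Rightarrow> 'a \<Rightarrow> 'a \<Rightarrow>\<^sub>0 laurent" where
  "FC a w = (if len w < len (a w)
     then T (a w) - (\<Sum>z | z \<in> keys (C w) \<and> len (a z) < len z. scale (of_int (c1 z w)) (T z))
     else scale (- (qhalf_pow 1 + qhalf_pow (-1))) (T w))"

lemma keys_C_closed: "w \<in> carrier W \<Longrightarrow> z \<in> keys (C w) \<Longrightarrow> z \<in> carrier W"
  using C_closed[of w] by (auto simp: free_on_def)

lemma FC_closed [simp]: 
  assumes "a \<in> acts" "w \<in> carrier W" shows "FC a w \<in> H"
proof -
  have "(\<Sum>z | z \<in> keys (C w) \<and> len (a z) < len z. scale (of_int (c1 z w)) (T z)) \<in> H"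
    using assms keys_C_closed by (intro free_on_sum free_on_scale free_on_single) auto
  then show ?thesis using assms by (simp add: FC_def)
qed

lemma F_C: "a \<in> acts \<Longrightarrow> w \<in> carrier W \<Longrightarrow> F a (C w) = linear_ext C (FC a w)"
  using F_C_up[of a w] F_C_down[of a w] act_len_neq[of a w]
  by (simp add: FC_def linear_opD[OF linear_ext_linear])

lemma lookup_FC:
  assumes "a \<in> acts" "w \<in> carrier W" "len w < len (a w)"
  shows "lookup (FC a w) y = (if y = a w then 1 else 0) -
    (if len (a y) < len y then of_int (c1 y w) else 0)"
proof -
  let ?Z = "{z \<in> keys (C w). len (a z) < len z}"
  have "lookup (\<Sum>z\<in>?Z. scale (of_int (c1 z w)) (T z)) y = (\<Sum>z\<in>?Z. if z = y then of_int (c1 y w) else 0)"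
    unfolding lookup_sum by (intro sum.cong) (auto simp: lookup_single when_def)
  also have "\<dots> = (if y \<in> ?Z then of_int (c1 y w) else 0)" by simp
  also have "\<dots> = (if len (a y) < len y then of_int (c1 y w) else 0)"
    using c1_bruhat(5)[OF assms(2), of y] by auto
  finally show ?thesis using assms by (auto simp: FC_def lookup_minus lookup_single when_def)
qed

lemma F_linear_ext_C: 
  assumes "a \<in> acts" "g \<in> H"
  shows "F a (linear_ext C g) = linear_ext C (linear_ext (FC a) g)"
proof (rule linear_op_eqI[where h = g])
  show "linear_op (\<lambda>g. F a (linear_ext C g))" by (rule linear_op_comp[of "F a"]) auto
  show "linear_op (\<lambda>g. linear_ext C (linear_ext (FC a) g))"
    by (rule linear_op_comp[of "linear_ext C"]) auto
qed (use assms in \<open>auto simp: free_on_def F_C\<close>)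

section \<open>The generating relation of the left preorder\<close>

definition left_edge :: "'a \<Rightarrow> 'a \<Rightarrow> bool" where
  "left_edge y w \<longleftrightarrow> y \<in> carrier W \<and> w \<in> carrier W \<and> mu y w \<noteq> 0 \<and> \<not> left_descents y \<subseteq> left_descents w"

lemma left_le_edge: "left_le y w \<longleftrightarrow> y \<in> carrier W \<and> w \<in> carrier W \<and> left_edge\<^sup>*\<^sup>* y w"
  by (simp add: left_le_def left_edge_def[abs_def])

lemma left_le_refl [simp]: "w \<in> carrier W \<Longrightarrow> left_le w w"
  by (simp add: left_le_edge)

lemma left_le_trans: "left_le x y \<Longrightarrow> left_le y z \<Longrightarrow> left_le x z"
  by (auto simp: left_le_edge)

lemma left_edge_le: "left_edge y w \<Longrightarrow> left_le y w"
  unfolding left_le_edge using left_edge_def r_into_rtranclp by metis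

lemma left_le_closed: "left_le y w \<Longrightarrow> y \<in> carrier W \<and> w \<in> carrier W"
  by (auto simp: left_le_edge)

lemma left_equiv_sym: "left_equiv y w \<Longrightarrow> left_equiv w y"
  by (auto simp: left_equiv_def)

lemma left_equiv_trans: "left_equiv x y \<Longrightarrow> left_equiv y z \<Longrightarrow> left_equiv x z"
  by (auto simp: left_equiv_def intro: left_le_trans)

end

context right_angled_system
begin

text \<open>Translates the combinatorial relation into algebra: y is one step below w exactly if C_y
  occurs in C_s C_w for some s that is no left descent of w. Such a y is s w itself or a y < w with
  s y < y and \<mu>(y,w) \<noteq> 0.\<close>

lemma left_edge_iff:
  assumes "y \<in> carrier W" "w \<in> carrier W"
  shows "left_edge y w \<longleftrightarrow> (\<exists>s \<in> S. s \<notin> left_descents w \<and> lookup (FC (lact s) w) y \<noteq> 0)"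
proof
  assume "left_edge y w"
  then obtain s where s: "s \<in> left_descents y" "s \<notin> left_descents w" "mu y w \<noteq> 0"
    by (auto simp: left_edge_def)
  have sS: "s \<in> S" "len (s \<otimes> y) < len y" using s assms by (auto simp: left_descents_iff)
  have up: "len w < len (s \<otimes> w)" using s sS assms act_len_neq[of "lact s" w] by (auto simp: left_descents_iff)
  note l = lookup_FC[OF acts_left[OF sS(1)] assms(2) up, of y]
  have c0: "c1 (s \<otimes> w) w = 0" using c1_bruhat(3)[OF assms(2), of "s \<otimes> w"] up by auto
  have "lookup (FC (lact s) w) y \<noteq> 0"
  \<comment> \<open>If \<mu> is nonzero because of w < y, then s descends from y but not from w, and
    \<open>c1_descent\<close> leaves only y = s w.\<close>
  proof (cases "c1 y w = 0")
    case True
    then have "c1 w y \<noteq> 0" using s mu_nonzero_iff assms by blast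
    then have "s \<otimes> w = y" using c1_descent[of "lact s" y w] sS assms up by simp
    then show ?thesis using l c0 by auto
  next
    case False
    then have "y \<noteq> s \<otimes> w" using c0 by auto
    then show ?thesis using l sS False by simp
  qed
  then show "\<exists>s \<in> S. s \<notin> left_descents w \<and> lookup (FC (lact s) w) y \<noteq> 0" using s sS by blast
next
  assume "\<exists>s \<in> S. s \<notin> left_descents w \<and> lookup (FC (lact s) w) y \<noteq> 0"
  then obtain s where s: "s \<in> S" "s \<notin> left_descents w" "lookup (FC (lact s) w) y \<noteq> 0" by blast
  have up: "len w < len (s \<otimes> w)" using s assms act_len_neq[of "lact s" w] by (auto simp: left_descents_iff)
  note l = lookup_FC[OF acts_left[OF s(1)] assms(2) up, of y]
  show "left_edge y w"
  proof (cases "y = s \<otimes> w")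
    case True
    then have "c1 w y \<noteq> 0" using c1_act[of "lact s" w] s assms up by simp
    moreover have "s \<in> left_descents y" using True up s assms by (simp add: left_descents_iff)
    ultimately show ?thesis using assms s mu_nonzero_iff by (auto simp: left_edge_def)
  next
    case False
    then have "c1 y w \<noteq> 0" "len (s \<otimes> y) < len y" using l s by (auto split: if_splits)
    moreover from this have "s \<in> left_descents y" using s assms by (simp add: left_descents_iff)
    ultimately show ?thesis using assms s mu_nonzero_iff by (auto simp: left_edge_def)
  qed
qed

lemma left_edge_up:
  assumes "s \<in> S" "w \<in> carrier W" "s \<notin> left_descents w" shows "left_edge (s \<otimes> w) w"
proof -
  have up: "len w < len (s \<otimes> w)" using assms act_len_neq[of "lact s" w] by (auto simp: left_descents_iff)
  then have "c1 w (s \<otimes> w) \<noteq> 0" using c1_act[of "lact s" w] assms by simp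
  moreover have "s \<in> left_descents (s \<otimes> w)" using up assms by (simp add: left_descents_iff)
  ultimately show ?thesis using assms mu_nonzero_iff by (auto simp: left_edge_def)
qed

lemma left_edge_down:
  assumes "s \<in> S" "w \<in> carrier W" "s \<notin> left_descents w" "t \<in> left_descents w" "s \<otimes> t \<noteq> t \<otimes> s"
  shows "left_edge w (s \<otimes> w)"
proof -
  have up: "len w < len (s \<otimes> w)" using assms act_len_neq[of "lact s" w] by (auto simp: left_descents_iff)
  then have "c1 w (s \<otimes> w) \<noteq> 0" using c1_act[of "lact s" w] assms by simp
  moreover have "t \<notin> left_descents (s \<otimes> w)" using left_descents_mult[of w s] assms by auto
  ultimately show ?thesis using assms mu_nonzero_iff by (auto simp: left_edge_def)
qed

text \<open>A left descent t of s w that commutes with s would also be one of w. So t and s do not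
  commute, t is lost on passing to w, and there is an edge in either direction.\<close>

lemma left_equiv_strip:
  assumes "w \<in> carrier W" "left_descents w = {s}" "s \<otimes> w \<noteq> \<one>" shows "left_equiv (s \<otimes> w) w"
proof -
  let ?u = "s \<otimes> w"
  have s: "s \<in> S" "len ?u < len w" using assms(2) left_descents_iff[OF assms(1), of s] by auto
  have u: "?u \<in> carrier W" "s \<notin> left_descents ?u" using s assms(1) by (auto simp: left_descents_iff)
  obtain t where t: "t \<in> left_descents ?u" using left_descents_nonempty[OF u(1) assms(3)] by blast
  have "left_descents w = insert s {t \<in> left_descents ?u. s \<otimes> t = t \<otimes> s}"
    using left_descents_mult[OF u(1) s(1) u(2)] s(1) assms(1) by simp
  then have "s \<otimes> t \<noteq> t \<otimes> s" using t u(2) assms(2) by auto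
  then show ?thesis using left_edge_le[OF left_edge_up[OF s(1) u]] left_edge_le[OF left_edge_down[OF s(1) u t]] 
      s(1) assms(1) by (simp add: left_equiv_def)
qed

text \<open>If t in R(w) were missing from R(y), then \<open>c1_descent\<close> would give w = y t
  or y = s w. In the first case s is a left descent of both or of neither, in the second t is a
  right descent of both or of neither, by \<open>descent_left_right\<close>; either contradicts the
  choice of s and t.\<close>

lemma left_edge_right_descents:
  assumes "left_edge y w" shows "right_descents w \<subseteq> right_descents y"
proof (rule ccontr)
  assume "\<not> right_descents w \<subseteq> right_descents y"
  then obtain t where t: "t \<in> right_descents w" "t \<notin> right_descents y" by blast
  obtain s where s: "s \<in> left_descents y" "s \<notin> left_descents w" and mu: "mu y w \<noteq> 0"
    and cl: "y \<in> carrier W" "w \<in> carrier W"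
    using assms by (auto simp: left_edge_def)
  have t': "t \<in> S" "len (w \<otimes> t) < len w" "len y < len (y \<otimes> t)"
    using t cl act_len_neq[of "\<lambda>w. w \<otimes> t" y] by (auto simp: right_descents_iff)
  have s': "s \<in> S" "len (s \<otimes> y) < len y" "len w < len (s \<otimes> w)"
    using s cl act_len_neq[of "lact s" w] by (auto simp: left_descents_iff)
  consider "c1 y w \<noteq> 0" | "c1 w y \<noteq> 0" using mu mu_nonzero_iff cl by blast
  then show False
  proof cases
    case 1
    have w: "y \<otimes> t = w" using c1_descent[of "\<lambda>w. w \<otimes> t" w y] t' cl 1 by simp
    have "s \<otimes> y \<noteq> y \<otimes> t" using s' t' by auto
    then show False using descent_left_right(2)[of s t y] s' t' cl w by auto
  next
    case 2
    have y: "s \<otimes> w = y" using c1_descent[of "lact s" y w] s' cl 2 by simp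
    have "s \<otimes> w \<noteq> w \<otimes> t" using s' t' by auto
    then show False using descent_left_right(1)[of s t w] s' t' cl y by auto
  qed
qed

lemma left_le_right_descents: "left_le y w \<Longrightarrow> right_descents w \<subseteq> right_descents y"
proof -
  have "left_edge\<^sup>*\<^sup>* y w \<Longrightarrow> right_descents w \<subseteq> right_descents y"
    by (induction rule: rtranclp_induct) (auto dest: left_edge_right_descents)
  then show "left_le y w \<Longrightarrow> right_descents w \<subseteq> right_descents y" by (simp add: left_le_edge)
qed

lemma left_equiv_right_descents: "left_equiv y w \<Longrightarrow> right_descents y = right_descents w"
  using left_le_right_descents by (auto simp: left_equiv_def)

lemma FC_free_on:
  assumes "A \<subseteq> carrier W" "\<And>y w. w \<in> A \<Longrightarrow> left_edge y w \<Longrightarrow> y \<in> A" "s \<in> S" "w \<in> A"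
  shows "FC (lact s) w \<in> free_on A"
proof (cases "s \<in> left_descents w")
  case True
  then have "\<not> len w < len (s \<otimes> w)" using assms by (auto simp: left_descents_iff)
  then show ?thesis using assms by (simp add: FC_def)
next
  case False
  have cl: "w \<in> carrier W" using assms by auto
  show ?thesis unfolding free_on_iff
  proof (intro allI impI, rule ccontr)
    fix y assume y: "y \<notin> A" "lookup (FC (lact s) w) y \<noteq> 0"
    then have "y \<in> carrier W" using FC_closed[of "lact s" w] assms cl unfolding free_on_iff by auto
    then show False using left_edge_iff[OF _ cl] False y assms by blast
  qed
qed

text \<open>Coordinates in the Kazhdan--Lusztig basis are unique, so any expression of C_s C_w by
  the C_z with z in A confines the neighbours of w to A.\<close>

lemma left_closedI:
  assumes "A \<subseteq> carrier W" "w \<in> A" "left_edge y w"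
    and "\<And>s. s \<in> S \<Longrightarrow> \<exists>g \<in> free_on A. F (lact s) (C w) = linear_ext C g"
  shows "y \<in> A"
proof -
  have cl: "y \<in> carrier W" "w \<in> carrier W" using assms by (auto simp: left_edge_def)
  obtain s where s: "s \<in> S" "lookup (FC (lact s) w) y \<noteq> 0" using assms(3) left_edge_iff[OF cl] by blast
  obtain g where g: "g \<in> free_on A" "F (lact s) (C w) = linear_ext C g" using assms(4) s by blast
  then have "g \<in> H" using assms(1) by (auto simp: free_on_def)
  moreover have "linear_ext C (FC (lact s) w) = linear_ext C g"
    using g(2) F_C[OF acts_left[OF s(1)] cl(2)] by simp
  ultimately have "FC (lact s) w = g"
    using linear_ext_C_inject FC_closed[OF acts_left[OF s(1)] cl(2)] by blast
  then show ?thesis using g(1) s(2) unfolding free_on_iff by auto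
qed

text \<open>Left multiplication by q^{-1/2} T_s. It is written through \<open>F\<close> because that
  operator acts on Kazhdan--Lusztig coordinates.\<close>

definition N :: "'a \<Rightarrow> ('a \<Rightarrow>\<^sub>0 laurent) \<Rightarrow> ('a \<Rightarrow>\<^sub>0 laurent)" where
  "N s h = F (lact s) h + scale (qhalf_pow 1) h"

definition nT :: "'a \<Rightarrow> 'a \<Rightarrow>\<^sub>0 laurent" where
  "nT w = scale (qhalf_pow (- int (len w))) (T w)"

definition N_word :: "'a list \<Rightarrow> ('a \<Rightarrow>\<^sub>0 laurent) \<Rightarrow> ('a \<Rightarrow>\<^sub>0 laurent)" where
  "N_word ws h = foldr N ws h"

lemma N_word_simps [simp]: "N_word [] h = h" "N_word (s # ws) h = N s (N_word ws h)"
  "N_word (us @ ws) h = N_word us (N_word ws h)"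
  by (simp_all add: N_word_def)

lemma N_linear [simp]: "linear_op (N s)"
proof -
  have "linear_op (\<lambda>h. F (lact s) h + scale (qhalf_pow 1) h)"
    by (intro linear_op_add linear_op_scale) auto
  then show ?thesis by (simp add: N_def linear_op_def)
qed

lemma N_word_linear [simp]: "linear_op (N_word ws)"
proof (induction ws)
  case (Cons s ws)
  then have "linear_op (\<lambda>h. N s (N_word ws h))" using linear_op_comp[of "N s" "N_word ws"] by simp
  then show ?case by (simp add: N_word_def linear_op_def)
qed (simp add: N_word_def linear_op_def)

lemma N_closed [simp]: "s \<in> S \<Longrightarrow> h \<in> H \<Longrightarrow> N s h \<in> H"
  by (simp add: N_def)

lemma nc_nT [simp]: "nc (nT w) y = (if y = w then 1 else 0)"
  by (auto simp: nc_def nT_def lookup_single when_def)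

lemma nT_closed [simp]: "w \<in> carrier W \<Longrightarrow> nT w \<in> H"
  by (simp add: nT_def)

lemma nc_N:
  assumes "s \<in> S" "h \<in> H" "y \<in> carrier W"
  shows "nc (N s h) y = nc h (s \<otimes> y) 
    + (if s \<in> left_descents y then (qhalf_pow 1 - qhalf_pow (-1)) * nc h y else 0)"
proof -
  have "len y < len (s \<otimes> y) \<longleftrightarrow> s \<notin> left_descents y"
    using assms act_len_neq[of "lact s" y] by (auto simp: left_descents_iff)
  then show ?thesis using assms nc_F[of "lact s" h y] by (auto simp: N_def algebra_simps)
qed

lemma N_nT:
  assumes "s \<in> S" "w \<in> carrier W"
  shows "N s (nT w) = nT (s \<otimes> w) 
    + (if s \<in> left_descents w then scale (qhalf_pow 1 - qhalf_pow (-1)) (nT w) else 0)"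
proof (rule nc_eqI)
  fix y
  show "nc (N s (nT w)) y = nc (nT (s \<otimes> w) 
    + (if s \<in> left_descents w then scale (qhalf_pow 1 - qhalf_pow (-1)) (nT w) else 0)) y"
  proof (cases "y \<in> carrier W")
    case True
    then have "s \<otimes> y = w \<longleftrightarrow> y = s \<otimes> w" using assms by auto
    then show ?thesis using assms True by (auto simp: nc_N)
  next
    case False
    have "N s (nT w) \<in> H" using assms by simp
    then have "nc (N s (nT w)) y = 0" using False unfolding nc_eq_0_iff free_on_iff by blast
    moreover have "y \<noteq> w" "y \<noteq> s \<otimes> w" using False assms by auto
    ultimately show ?thesis by simp
  qed
qed

text \<open>The order of vanishing at q^{1/2} = 0; the zero polynomial has every order.\<close>

definition order_ge :: "int \<Rightarrow> laurent \<Rightarrow> bool" where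
  "order_ge m a \<longleftrightarrow> (\<forall>k < m. lookup a k = 0)"

lemma order_ge_simps [simp]: "order_ge m 0" "order_ge m a \<Longrightarrow> order_ge m b \<Longrightarrow> order_ge m (a + b)"
  "order_ge m (- a) \<longleftrightarrow> order_ge m a" "order_ge m (qhalf_pow j * a) \<longleftrightarrow> order_ge (m - j) a"
  "m \<le> 0 \<Longrightarrow> order_ge m 1"
proof -
  show "order_ge m (qhalf_pow j * a) \<longleftrightarrow> order_ge (m - j) a"
  proof
    assume *: "order_ge m (qhalf_pow j * a)"
    show "order_ge (m - j) a" unfolding order_ge_def
    proof (intro allI impI)
      fix k assume "k < m - j"
      then show "lookup a k = 0" using *[unfolded order_ge_def, rule_format, of "k + j"] by simp
    qed
  next
    assume "order_ge (m - j) a"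
    then show "order_ge m (qhalf_pow j * a)" by (simp add: order_ge_def)
  qed
qed (auto simp: order_ge_def lookup_add lookup_one_laurent)

lemma order_ge_mono: "order_ge m a \<Longrightarrow> n \<le> m \<Longrightarrow> order_ge n a"
  by (auto simp: order_ge_def)

lemma order_ge_sum: "(\<And>x. x \<in> A \<Longrightarrow> order_ge m (f x)) \<Longrightarrow> order_ge m (sum f A)"
  by (induction A rule: infinite_finite_induct) auto

lemma order_ge_mult:
  assumes "order_ge m a" "order_ge n b" shows "order_ge (m + n) (a * b)"
proof -
  have "order_ge (m + n) (qhalf_pow i * (of_int (lookup a i) * b))" for i
    using assms by (cases "i < m") (auto simp: order_ge_def)
  then have "order_ge (m + n) (\<Sum>i\<in>keys a. qhalf_pow i * (of_int (lookup a i) * b))"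
    by (intro order_ge_sum) auto
  moreover have "a = (\<Sum>i\<in>keys a. qhalf_pow i * of_int (lookup a i))"
  proof (rule poly_mapping_eqI)
    fix k
    have "lookup (\<Sum>i\<in>keys a. qhalf_pow i * of_int (lookup a i)) k = (\<Sum>i\<in>keys a. if i = k then lookup a i else 0)"
      unfolding lookup_sum by (intro sum.cong) (auto simp: lookup_of_int_laurent)
    then show "lookup a k = lookup (\<Sum>i\<in>keys a. qhalf_pow i * of_int (lookup a i)) k"
      by (auto simp: in_keys_iff)
  qed
  then have "a * b = (\<Sum>i\<in>keys a. qhalf_pow i * (of_int (lookup a i) * b))"
    by (metis (no_types, lifting) sum_distrib_right mult.assoc sum.cong)
  ultimately show ?thesis by simp
qed

definition orders_ge :: "int \<Rightarrow> ('a \<Rightarrow>\<^sub>0 laurent) \<Rightarrow> bool" where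
  "orders_ge m h \<longleftrightarrow> (\<forall>y. order_ge m (nc h y))"

lemma orders_ge_add: "orders_ge m g \<Longrightarrow> orders_ge m h \<Longrightarrow> orders_ge m (g + h)"
  by (auto simp: orders_ge_def)

lemma orders_ge_scale: "order_ge m a \<Longrightarrow> orders_ge n h \<Longrightarrow> orders_ge (m + n) (scale a h)"
  by (simp add: orders_ge_def order_ge_mult)

lemma orders_ge_nT: "orders_ge 0 (nT w)"
  by (auto simp: orders_ge_def)

lemma orders_ge_mono: "orders_ge m a \<Longrightarrow> n \<le> m \<Longrightarrow> orders_ge n a"
  by (auto simp: orders_ge_def intro: order_ge_mono)

lemma order_ge_xi: "order_ge (-1) (qhalf_pow 1 - qhalf_pow (-1))"
  by (simp add: order_ge_def lookup_minus lookup_qhalf_pow)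

lemma reduced_snocD:
  assumes "reduced (ws @ [s])"
  shows "reduced ws" "s \<in> S" "s \<notin> right_descents (word_prod ws)"
proof -
  have l: "ws \<in> lists S" "s \<in> S" using assms by (auto simp: reduced_def)
  have "length (ws @ [s]) = len (word_prod ws \<otimes> s)" using assms l by (simp add: reduced_def)
  moreover have "len (word_prod ws \<otimes> s) \<le> Suc (len (word_prod ws))"
    using len_gen_cases_right[of s "word_prod ws"] l by force
  moreover have "len (word_prod ws) \<le> length ws" using len_word_prod_le l by blast
  ultimately show "reduced ws" "s \<in> S" "s \<notin> right_descents (word_prod ws)"
    using l by (auto simp: reduced_def right_descents_iff)
qed

text \<open>Multiplying \<open>T\<^sub>x\<close> with \<open>T\<^sub>y\<close>, each common descent of \<open>x\<close> and \<open>y\<close> produces at most one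
  factor \<open>q\<^sup>1\<^sup>/\<^sup>2 - q\<^sup>-\<^sup>1\<^sup>/\<^sup>2\<close>, and there are at most two of them.\<close>

lemma N_word_nT:
  assumes "reduced ws" "y \<in> carrier W"
  shows "(right_descents (word_prod ws) \<inter> left_descents y = {} \<longrightarrow> N_word ws (nT y) = nT (word_prod ws \<otimes> y)) \<and>
    (\<not> left_descents y \<subseteq> right_descents (word_prod ws) \<longrightarrow> orders_ge (-1) (N_word ws (nT y))) \<and>
    orders_ge (-2) (N_word ws (nT y))"
  using assms
proof (induction ws arbitrary: y rule: rev_induct)
  case Nil
  then show ?case using orders_ge_nT orders_ge_mono[OF orders_ge_nT] by auto
next
  case (snoc s ws)
  let ?x = "word_prod ws"
  note red = reduced_snocD[OF snoc.prems(1)]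
  have ws: "ws \<in> lists S" using red(1) reduced_lists by blast
  have x: "?x \<in> carrier W" using ws by simp
  have prod: "word_prod (ws @ [s]) = ?x \<otimes> s" using ws red(2) by simp
  have Rx: "right_descents (?x \<otimes> s) = insert s {t \<in> right_descents ?x. s \<otimes> t = t \<otimes> s}"
    by (rule right_descents_mult[OF x red(2,3)])
  note y = snoc.prems(2)
  have sy: "s \<otimes> y \<in> carrier W" using red y by simp
  note IH = snoc.IH[OF red(1), THEN conjunct1, rule_format] 
    snoc.IH[OF red(1), THEN conjunct2, THEN conjunct1, rule_format]
    snoc.IH[OF red(1), THEN conjunct2, THEN conjunct2]
  let ?xi = "qhalf_pow 1 - qhalf_pow (-1)"
  show ?case
  proof (cases "s \<in> left_descents y")
    case False
    have e: "N_word (ws @ [s]) (nT y) = N_word ws (nT (s \<otimes> y))"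
      using False by (simp add: N_nT[OF red(2) y])
    have Ly: "left_descents (s \<otimes> y) = insert s {t \<in> left_descents y. s \<otimes> t = t \<otimes> s}"
      by (rule left_descents_mult[OF y red(2) False])
    \<comment> \<open>The letter s is a left descent of s y but, as the word is reduced, no right
      descent of x; the middle clause therefore gives order -1.\<close>
    have "\<not> left_descents (s \<otimes> y) \<subseteq> right_descents ?x" using red(3) unfolding Ly by auto
    then have "orders_ge (-1) (N_word ws (nT (s \<otimes> y)))" by (rule IH(2)[OF sy])
    moreover have "N_word ws (nT (s \<otimes> y)) = nT (?x \<otimes> s \<otimes> y)"
      if "right_descents (?x \<otimes> s) \<inter> left_descents y = {}"
    proof -
      have "right_descents ?x \<inter> left_descents (s \<otimes> y) = {}" using that red(3) unfolding Rx Ly by auto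
      then show ?thesis using IH(1)[OF sy] m_assoc[OF x _ y, of s] red(2) by simp
    qed
    ultimately show ?thesis unfolding e prod using IH(3)[OF sy] by simp
  next
    case True
    have e: "N_word (ws @ [s]) (nT y) = N_word ws (nT (s \<otimes> y)) + scale ?xi (N_word ws (nT y))"
      using True by (simp add: N_nT[OF red(2) y] linear_opD[OF N_word_linear])
    have nsy: "s \<notin> left_descents (s \<otimes> y)" using True y red(2) by (auto simp: left_descents_iff)
    have Ly: "left_descents y = insert s {t \<in> left_descents (s \<otimes> y). s \<otimes> t = t \<otimes> s}"
      using left_descents_mult[OF sy red(2) nsy] red(2) y by simp
    have "\<not> left_descents y \<subseteq> right_descents ?x" using True red(3) by blast
    then have "orders_ge (-1) (N_word ws (nT y))" by (rule IH(2)[OF y])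
    from orders_ge_add[OF IH(3)[OF sy]] orders_ge_scale[OF order_ge_xi this]
    have 2: "orders_ge (-2) (N_word (ws @ [s]) (nT y))" unfolding e by simp
    \<comment> \<open>Such an a commutes with s, and then L(y) is contained in {a, s} since three
      generators cannot commute pairwise. Neither is a right descent of x, so the second summand is
      a multiple of a single basis element and the factor \<open>?xi\<close> costs only one.\<close>
    have "orders_ge (-1) (N_word (ws @ [s]) (nT y))" 
      if a: "a \<in> left_descents y" "a \<notin> right_descents (?x \<otimes> s)" for a
    proof -
      have as: "s \<otimes> a = a \<otimes> s" "a \<noteq> s" using left_descents_commute[OF y True] a unfolding Rx by auto
      then have ax: "a \<notin> right_descents ?x" using a unfolding Rx by simp
      have "a \<in> left_descents (s \<otimes> y)" using a as unfolding Ly by simp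
      then have "\<not> left_descents (s \<otimes> y) \<subseteq> right_descents ?x" using ax by blast
      then have 1: "orders_ge (-1) (N_word ws (nT (s \<otimes> y)))" by (rule IH(2)[OF sy])
      have "left_descents y \<subseteq> {a, s}"
      proof
        fix t assume "t \<in> left_descents y"
        then show "t \<in> {a, s}"
          using no_triangle[of s a t] left_descents_commute[OF y] left_descents_gens[of y] a True as by blast
      qed
      then have "right_descents ?x \<inter> left_descents y = {}" using ax red(3) by blast
      then have "orders_ge 0 (N_word ws (nT y))" using IH(1)[OF y] orders_ge_nT by simp
      from orders_ge_add[OF 1] orders_ge_scale[OF order_ge_xi this] show ?thesis unfolding e by simp
    qed
    moreover have "s \<in> right_descents (?x \<otimes> s) \<inter> left_descents y" using True unfolding Rx by simp
    ultimately show ?thesis unfolding prod using 2 by auto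
  qed
qed

end

section \<open>Elements with two right descents\<close>

context right_angled_system
begin

definition commuting_pair :: "'a set \<Rightarrow> bool" where
  "commuting_pair A \<longleftrightarrow> (\<exists>s \<in> S. \<exists>t \<in> S. s \<noteq> t \<and> s \<otimes> t = t \<otimes> s \<and> A = {s, t})"

lemma commuting_pair_max:
  assumes "commuting_pair A" "A \<subseteq> B" "B \<subseteq> S" "\<And>s t. s \<in> B \<Longrightarrow> t \<in> B \<Longrightarrow> s \<otimes> t = t \<otimes> s"
  shows "B = A"
proof -
  obtain s t where A: "s \<noteq> t" "A = {s, t}" using assms(1) by (auto simp: commuting_pair_def)
  have "r \<in> A" if "r \<in> B" for r
    using no_triangle[of s t r] assms(2-4) A that by (metis insert_iff insert_subset subsetD)
  then show ?thesis using assms(2) by blast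
qed

lemma right_descents_pair:
  "commuting_pair A \<Longrightarrow> w \<in> carrier W \<Longrightarrow> A \<subseteq> right_descents w \<Longrightarrow> right_descents w = A"
  by (rule commuting_pair_max) (auto simp: right_descents_commute intro: subsetD[OF right_descents_gens])

lemma left_descents_pair:
  "commuting_pair A \<Longrightarrow> w \<in> carrier W \<Longrightarrow> A \<subseteq> left_descents w \<Longrightarrow> left_descents w = A"
  by (rule commuting_pair_max) (auto simp: left_descents_commute intro: subsetD[OF left_descents_gens])

lemma right_descents_gen [simp]: "s \<in> S \<Longrightarrow> right_descents s = {s}"
  using right_descents_mult[of \<one> s] by simp

lemma left_descents_gen [simp]: "s \<in> S \<Longrightarrow> left_descents s = {s}"
  using left_descents_mult[of \<one> s] by simp

lemma gen_neq_one [simp]: "s \<in> S \<Longrightarrow> s \<noteq> \<one>"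
proof
  assume "s \<in> S" "s = \<one>"
  then have "len \<one> = 1" using len_gen by blast
  then show False by simp
qed

lemma pair_descents:
  assumes "s \<in> S" "t \<in> S" "s \<noteq> t" "s \<otimes> t = t \<otimes> s"
  shows "right_descents (s \<otimes> t) = {s, t}" "left_descents (s \<otimes> t) = {s, t}" "len (s \<otimes> t) = 2"
proof -
  have c: "s \<in> carrier W" "t \<in> carrier W" using assms by auto
  have n: "t \<notin> right_descents s" "s \<notin> left_descents t" using assms(1-3) by auto
  have "{r \<in> {s}. t \<otimes> r = r \<otimes> t} = {s}" "{r \<in> {t}. s \<otimes> r = r \<otimes> s} = {t}"
    using assms(4) by auto
  then show "right_descents (s \<otimes> t) = {s, t}" "left_descents (s \<otimes> t) = {s, t}"
    using right_descents_mult[OF c(1) assms(2) n(1)] left_descents_mult[OF c(2) assms(1) n(2)]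
    unfolding right_descents_gen[OF assms(1)] left_descents_gen[OF assms(2)] by auto
  have "\<not> len (s \<otimes> t) < len s" using n(1) assms(2) c(1) by (simp add: right_descents_iff)
  then show "len (s \<otimes> t) = 2"
    using len_gen[OF assms(1)] by (rule_tac len_gen_cases_right[OF assms(2) c(1)]) auto
qed

lemma len_right_descent: "w \<in> carrier W \<Longrightarrow> s \<in> right_descents w \<Longrightarrow> len w = Suc (len (w \<otimes> s))"
  by (rule len_gen_cases_right[of s w]) (auto simp: right_descents_iff)

lemma len_left_descent: "w \<in> carrier W \<Longrightarrow> s \<in> left_descents w \<Longrightarrow> len w = Suc (len (s \<otimes> w))"
  by (rule len_gen_cases[of s w]) (auto simp: left_descents_iff)

lemma left_le_extend:
  assumes "ws \<in> lists S" "z \<in> carrier W" "len (word_prod ws \<otimes> z) = length ws + len z"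
  shows "left_le (word_prod ws \<otimes> z) z"
  using assms
proof (induction ws)
  case Nil then show ?case by simp
next
  case (Cons s ws)
  let ?u = "word_prod ws \<otimes> z"
  have u: "?u \<in> carrier W" "word_prod (s # ws) \<otimes> z = s \<otimes> ?u" using Cons by (auto simp: m_assoc)
  have "len ?u \<le> length ws + len z"
    using len_mult_le[of "word_prod ws" z] len_word_prod_le[of ws] Cons by auto
  moreover have "len (s \<otimes> ?u) \<le> Suc (len ?u)" using len_mult_le[of s ?u] Cons u by simp
  ultimately have l: "len ?u = length ws + len z" "len ?u < len (s \<otimes> ?u)" using Cons u by auto
  then have "left_le (s \<otimes> ?u) ?u"
    using left_edge_le left_edge_up[of s ?u] Cons u by (auto simp: left_descents_iff)
  then show ?case using Cons l u left_le_trans by metis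
qed

definition with_right_descents :: "'a set \<Rightarrow> 'a set" where
  "with_right_descents A = {x \<in> carrier W. right_descents x = A}"

text \<open>Splitting off both right descents leaves w = y s t with lengths adding up, and letters
  added on the left lead down in the preorder.\<close>

lemma left_le_pair_upper:
  assumes "commuting_pair {s, t}" "w \<in> with_right_descents {s, t}" shows "left_le w (s \<otimes> t)"
proof -
  have st: "s \<in> S" "t \<in> S" "s \<noteq> t" "s \<otimes> t = t \<otimes> s"
    using assms(1) by (auto simp: commuting_pair_def doubleton_eq_iff)
  have w: "w \<in> carrier W" "right_descents w = {s, t}" using assms(2) by (auto simp: with_right_descents_def)
  then have "s \<in> right_descents w" by simp
  then have l1: "len w = Suc (len (w \<otimes> s))" by (rule len_right_descent[OF w(1)])
  have "s \<notin> right_descents (w \<otimes> s)" using l1 w st by (simp add: right_descents_iff)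
  then have Rw: "right_descents w = insert s {r \<in> right_descents (w \<otimes> s). s \<otimes> r = r \<otimes> s}"
    using right_descents_mult[of "w \<otimes> s" s] w st by simp
  have "t \<in> right_descents w" using w(2) by simp
  then have "t \<in> insert s {r \<in> right_descents (w \<otimes> s). s \<otimes> r = r \<otimes> s}" unfolding Rw .
  then have "t \<in> right_descents (w \<otimes> s)" using st(3) by simp
  then have l2: "len (w \<otimes> s) = Suc (len (w \<otimes> s \<otimes> t))" 
    using w(1) st(1) by (intro len_right_descent) auto
  let ?y = "w \<otimes> s \<otimes> t"
  have y: "?y \<in> carrier W" "?y \<otimes> (s \<otimes> t) = w"
    using w(1) st(1,2) unfolding st(4) by (auto simp: m_assoc gen_sq)
  have "left_le (word_prod (red_word ?y) \<otimes> (s \<otimes> t)) (s \<otimes> t)"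
    using red_word[OF y(1)] y l1 l2 st pair_descents(3)[OF st] by (intro left_le_extend) auto
  then show ?thesis using red_word[OF y(1)] y by simp
qed

lemma F_span:
  assumes "A \<subseteq> carrier W" "\<And>y w. w \<in> A \<Longrightarrow> left_edge y w \<Longrightarrow> y \<in> A" "s \<in> S" "g \<in> free_on A"
  shows "\<exists>g' \<in> free_on A. F (lact s) (linear_ext C g) = linear_ext C g'"
proof
  have "g \<in> H" using assms by (auto simp: free_on_def)
  then show "F (lact s) (linear_ext C g) = linear_ext C (linear_ext (FC (lact s)) g)"
    using assms by (simp add: F_linear_ext_C)
  show "linear_ext (FC (lact s)) g \<in> free_on A"
    by (rule linear_op_closed[where A = A]) (use FC_free_on assms in auto)
qed

lemma N_word_span:
  assumes "A \<subseteq> carrier W" "\<And>y w. w \<in> A \<Longrightarrow> left_edge y w \<Longrightarrow> y \<in> A" "ws \<in> lists S" "g \<in> free_on A"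
  shows "\<exists>g' \<in> free_on A. N_word ws (linear_ext C g) = linear_ext C g'"
  using assms(3)
proof (induction ws)
  case Nil then show ?case using assms by auto
next
  case (Cons s ws)
  then obtain g1 where g1: "g1 \<in> free_on A" "N_word ws (linear_ext C g) = linear_ext C g1" by auto
  obtain g2 where g2: "g2 \<in> free_on A" "F (lact s) (linear_ext C g1) = linear_ext C g2"
    using F_span[of A s g1] assms(1,2) Cons(1) g1(1) by blast
  have "N_word (s # ws) (linear_ext C g) = linear_ext C (g2 + scale (qhalf_pow 1) g1)"
    using g1 g2 by (simp add: N_def linear_opD[OF linear_ext_linear])
  then show ?case using g1 g2 by (intro bexI[of _ "g2 + scale (qhalf_pow 1) g1"]) auto
qed

lemma order_ge_nc_C:
  assumes "w \<in> carrier W" shows "order_ge 0 (nc (C w) y)" "y \<noteq> w \<Longrightarrow> order_ge 1 (nc (C w) y)"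
  using C_props(3,5)[OF assms] by (cases "y = w"; auto simp: order_ge_def lookup_one_laurent)+

text \<open>Let k0 be the lowest exponent among all coordinates, attained at z, and suppose k0 < 0.
  Coefficients of C_w at z with w \<noteq> z have only positive exponents, so nothing cancels the
  exponent k0 that C_z brings to z.\<close>

lemma orders_ge_coords:
  assumes g: "g \<in> H" and h: "orders_ge 0 (linear_ext C g)" shows "order_ge 0 (lookup g y)"
proof (rule ccontr)
  assume "\<not> order_ge 0 (lookup g y)"
  then obtain k where k: "k < 0" "lookup (lookup g y) k \<noteq> 0" by (auto simp: order_ge_def)
  define K where "K = (\<Union>y\<in>keys g. keys (lookup g y))"
  have "k \<in> K" using k by (force simp: K_def in_keys_iff)
  define k0 where "k0 = Min K"
  have fin: "finite K" by (simp add: K_def)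
  have "K \<noteq> {}" using \<open>k \<in> K\<close> by blast
  then have "k0 \<in> K" "k0 \<le> k" using fin \<open>k \<in> K\<close> Min_in[of K] by (simp_all add: k0_def)
  then obtain z where z: "z \<in> keys g" "lookup (lookup g z) k0 \<noteq> 0" "k0 < 0"
    using k by (auto simp: K_def in_keys_iff)
  have ord: "order_ge k0 (lookup g w)" for w
    unfolding order_ge_def
  proof (intro allI impI, rule ccontr)
    fix j assume j: "j < k0" "lookup (lookup g w) j \<noteq> 0"
    then have "j \<in> K" by (force simp: K_def in_keys_iff)
    then show False using j Min_le[OF fin, of j] by (simp add: k0_def)
  qed
  have cl: "w \<in> carrier W" if "w \<in> keys g" for w using g that by (auto simp: free_on_def)
  have "lookup (nc (linear_ext C g) z) k0 = (\<Sum>w\<in>keys g. if w = z then lookup (lookup g z) k0 else 0)"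
    unfolding nc_linear_ext lookup_sum
  proof (rule sum.cong)
    fix w assume w: "w \<in> keys g"
    have "lookup (lookup g w * nc (C w) z) k0 = 0" if "w \<noteq> z"
      using order_ge_mult[OF ord[of w] order_ge_nc_C(2)[OF cl[OF w]], of z] that by (auto simp: order_ge_def)
    then show "lookup (lookup g w * nc (C w) z) k0 = (if w = z then lookup (lookup g z) k0 else 0)"
      using C_props(3)[OF cl[OF w]] by auto
  qed simp
  then show False using z h by (simp add: orders_ge_def order_ge_def)
qed

lemma reduced_rev:
  assumes "reduced ws" shows "reduced (rev ws)" "word_prod (rev ws) = inv (word_prod ws)"
  using assms word_prod_rev[of ws] by (auto simp: reduced_def)

text \<open>Each \<open>N s\<close> moves the coefficient from s y to y. Reducedness makes y an
  ascent at that moment, so no term with q^{1/2} - q^{-1/2} interferes.\<close>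

lemma nc_N_word_one:
  assumes "reduced ws" "h \<in> H" shows "nc (N_word (rev ws) h) \<one> = nc h (word_prod ws)"
  using assms
proof (induction ws arbitrary: h)
  case (Cons s ws)
  note red = reduced_ConsD[OF Cons.prems(1)]
  have ws: "s \<in> S" "ws \<in> lists S" using Cons.prems by (auto simp: reduced_def)
  have "nc (N_word (rev (s # ws)) h) \<one> = nc (N s h) (word_prod ws)"
    using Cons.IH[OF red(1), of "N s h"] Cons.prems ws by simp
  also have "\<dots> = nc h (word_prod (s # ws))"
    using nc_N[OF ws(1) Cons.prems(2), of "word_prod ws"] red(2) ws by (simp add: left_descents_iff)
  finally show ?case .
qed simp

lemma expand_nT: "h = (\<Sum>u\<in>keys h. scale (nc h u) (nT u))"
proof (rule nc_eqI)
  fix y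
  have "nc (\<Sum>u\<in>keys h. scale (nc h u) (nT u)) y = (\<Sum>u\<in>keys h. if u = y then nc h y else 0)"
    unfolding nc_sum by (intro sum.cong) auto
  also have "\<dots> = nc h y" by (auto simp: in_keys_iff simp flip: nc_eq_0_iff)
  finally show "nc h y = nc (\<Sum>u\<in>keys h. scale (nc h u) (nT u)) y" by simp
qed

lemma nc_C_left_descent:
  assumes "w \<in> carrier W" "s \<in> left_descents w" "y \<in> carrier W" "s \<notin> left_descents y"
  shows "nc (C w) y = - qhalf_pow 1 * nc (C w) (s \<otimes> y)"
proof -
  have "s \<in> S" using assms(2) left_descents_gens by blast
  then show ?thesis
    using nc_C_descent[of "lact s" w y] assms act_len_neq[of "lact s" y] by (auto simp: left_descents_iff)
qed

lemma nc_C_right_descent: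
  assumes "w \<in> carrier W" "s \<in> right_descents w" "y \<in> carrier W" "s \<notin> right_descents y"
  shows "nc (C w) y = - qhalf_pow 1 * nc (C w) (y \<otimes> s)"
proof -
  have "s \<in> S" using assms(2) right_descents_gens by blast
  then show ?thesis
    using nc_C_descent[of "\<lambda>w. w \<otimes> s" w y] assms act_len_neq[of "\<lambda>w. w \<otimes> s" y] by (auto simp: right_descents_iff)
qed

text \<open>With \<open>w = a b y\<close> reduced, the element \<open>T\<^bsub>y\<^sup>-\<^sup>1\<^esub> C\<^sub>w\<close> (normalised) has coefficients without
  negative powers of \<open>q\<^sup>1\<^sup>/\<^sup>2\<close>, and \<open>q\<close> as its coefficient of \<open>T\<^sub>1\<close>.  Among all \<open>C\<^sub>z\<close> with \<open>\<R>(z) = {s, t}\<close>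
  only \<open>C\<^bsub>st\<^esub>\<close> has a coefficient of \<open>T\<^sub>1\<close> that is not divisible by \<open>q\<^sup>3\<^sup>/\<^sup>2\<close>.\<close>

lemma left_le_pair_lower_aux:
  assumes st: "commuting_pair {s, t}" and w: "w \<in> with_right_descents {s, t}"
    and ab: "commuting_pair {a, b}" and Lw: "left_descents w = {a, b}"
  shows "left_le (s \<otimes> t) w"
proof (rule ccontr)
  assume not_le: "\<not> left_le (s \<otimes> t) w"
  have abS: "a \<in> S" "b \<in> S" "a \<noteq> b" "a \<otimes> b = b \<otimes> a"
    using ab by (auto simp: commuting_pair_def doubleton_eq_iff)
  have stS: "s \<in> S" "t \<in> S" "s \<noteq> t" "s \<otimes> t = t \<otimes> s"
    using st by (auto simp: commuting_pair_def doubleton_eq_iff)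
  have wc: "w \<in> carrier W" "right_descents w = {s, t}" using w by (auto simp: with_right_descents_def)
  \<comment> \<open>The C_z with z below w span a left ideal, because M is closed under edges. It
    contains C_w, and by assumption s t is not in M.\<close>
  define M where "M = {y. left_le y w}"
  have M: "M \<subseteq> carrier W" "\<And>y z. z \<in> M \<Longrightarrow> left_edge y z \<Longrightarrow> y \<in> M" "w \<in> M"
    using left_le_closed left_le_trans[OF left_edge_le] wc by (auto simp: M_def)
  define y where "y = b \<otimes> (a \<otimes> w)"
  have yc: "y \<in> carrier W" "b \<otimes> y = a \<otimes> w" "a \<otimes> (b \<otimes> y) = w" using abS wc by (auto simp: y_def)
  have na: "a \<notin> left_descents (a \<otimes> w)" using Lw abS wc left_descents_iff[of w a] by (auto simp: left_descents_iff)
  have Lw': "left_descents w = insert a {r \<in> left_descents (a \<otimes> w). a \<otimes> r = r \<otimes> a}"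
    using left_descents_mult[OF _ abS(1) na] abS wc by simp
  have "b \<in> left_descents w" using Lw by simp
  then have "b \<in> insert a {r \<in> left_descents (a \<otimes> w). a \<otimes> r = r \<otimes> a}" unfolding Lw' .
  then have baw: "b \<in> left_descents (a \<otimes> w)" using abS(3) by simp
  have nb: "b \<notin> left_descents y" using baw abS wc by (auto simp: left_descents_iff y_def)
  have "left_descents (a \<otimes> w) = insert b {r \<in> left_descents y. b \<otimes> r = r \<otimes> b}"
    using left_descents_mult[OF yc(1) abS(2) nb] yc(2) by simp
  then have nay: "a \<notin> left_descents y" using na abS(4) by auto
  define ws where "ws = rev (red_word y)"
  have ws: "reduced ws" "word_prod ws = inv y" using reduced_rev red_word[OF yc(1)] by (auto simp: ws_def)
  have Rws: "right_descents (word_prod ws) = left_descents y" using ws right_descents_inv yc by simp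
  define h where "h = N_word ws (C w)"
  have "nc h \<one> = nc (C w) y" 
    using nc_N_word_one[of "red_word y" "C w"] red_word[OF yc(1)] wc by (simp add: h_def ws_def)
  \<comment> \<open>From y to w there are two ascents, by b and then by a, and each contributes the
    factor -q^{1/2}.\<close>
  also have "\<dots> = - qhalf_pow 1 * (- qhalf_pow 1 * nc (C w) w)"
    using nc_C_left_descent[OF wc(1), of b y] nc_C_left_descent[OF wc(1), of a "a \<otimes> w"] Lw yc nb na abS wc by simp
  finally have one: "nc h \<one> = qhalf_pow 2" using C_props(3)[OF wc(1)] by simp
  \<comment> \<open>Two effects balance. Neither a nor b is a right descent of y^{-1}, so having a
    or b in L(u) limits the negative order of T_{y^{-1}} T_u. Each of a, b that is missing from L(u)
    makes the coefficient of C_w at u divisible by one more factor q^{1/2}.\<close>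
  have "orders_ge 0 (scale (nc (C w) u) (N_word ws (nT u)))" if "u \<in> keys (C w)" for u
  proof -
    have u: "u \<in> carrier W" using keys_C_closed[OF wc(1) that] .
    note Nu = N_word_nT[OF ws(1) u, unfolded Rws]
    have ord: "order_ge 0 (nc (C w) z)" for z by (rule order_ge_nc_C[OF wc(1)])
    consider "a \<in> left_descents u" "b \<in> left_descents u" 
      | "a \<in> left_descents u" "b \<notin> left_descents u"
      | "a \<notin> left_descents u" "b \<in> left_descents u" 
      | "a \<notin> left_descents u" "b \<notin> left_descents u" by blast
    then show ?thesis
    proof cases
      case 1
      then have "left_descents u = {a, b}" using left_descents_pair[OF ab u] by simp
      then have "orders_ge 0 (N_word ws (nT u))" using Nu nb nay orders_ge_nT by auto
      from orders_ge_scale[OF ord this] show ?thesis by simp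
    next
      case 2
      then have 1: "orders_ge (-1) (N_word ws (nT u))" using Nu nay by auto
      have "order_ge 1 (nc (C w) u)"
        using nc_C_left_descent[OF wc(1) _ u 2(2)] Lw ord[of "b \<otimes> u"] by simp
      from orders_ge_scale[OF this 1] show ?thesis by simp
    next
      case 3
      then have 1: "orders_ge (-1) (N_word ws (nT u))" using Nu nb by auto
      have "order_ge 1 (nc (C w) u)"
        using nc_C_left_descent[OF wc(1) _ u 3(1)] Lw ord[of "a \<otimes> u"] by simp
      from orders_ge_scale[OF this 1] show ?thesis by simp
    next
      case 4
      have 1: "orders_ge (-2) (N_word ws (nT u))" using Nu by blast
      have au: "a \<otimes> u \<in> carrier W" "b \<notin> left_descents (a \<otimes> u)"
        using left_descents_mult[OF u abS(1) 4(1)] 4(2) abS u by auto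
      have "order_ge 2 (nc (C w) u)"
        using nc_C_left_descent[OF wc(1) _ u 4(1)] nc_C_left_descent[OF wc(1) _ au] Lw ord[of "b \<otimes> (a \<otimes> u)"] by simp
      from orders_ge_scale[OF this 1] show ?thesis by simp
    qed
  qed
  then have "orders_ge 0 (\<Sum>u\<in>keys (C w). scale (nc (C w) u) (N_word ws (nT u)))"
    unfolding orders_ge_def nc_sum by (auto intro!: order_ge_sum)
  moreover have "h = (\<Sum>u\<in>keys (C w). scale (nc (C w) u) (N_word ws (nT u)))"
    unfolding h_def by (subst expand_nT[of "C w"]) (simp add: linear_opD[OF N_word_linear])
  ultimately have h0: "orders_ge 0 h" by simp
  \<comment> \<open>Multiplication by normalised T_s is \<open>F\<close> plus a scalar, so h stays
    in the span of the C_z with z in M.\<close>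
  obtain g where g: "g \<in> free_on M" "h = linear_ext C g"
    using N_word_span[of M ws "T w"] reduced_lists[OF ws(1)] M by (auto simp: h_def)
  have gH: "g \<in> H" using g M by (auto simp: free_on_def)
  have "order_ge 3 (lookup g z * nc (C z) \<one>)" if "z \<in> keys g" for z
  proof -
    have "z \<in> M" using g that by (auto simp: free_on_def)
    then have z: "z \<in> carrier W" "left_le z w" using left_le_closed by (auto simp: M_def)
    then have "z \<noteq> s \<otimes> t" using not_le by blast
    have Rz: "right_descents z = {s, t}"
      using left_le_right_descents[OF z(2)] right_descents_pair[OF st z(1)] wc by simp
    \<comment> \<open>The two right ascents from 1 to s t give a factor q, and since z is not s t
      the coefficient at s t itself contributes at least another q^{1/2}.\<close>
    have "order_ge 3 (nc (C z) \<one>)"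
      using nc_C_right_descent[OF z(1), of s \<one>] nc_C_right_descent[OF z(1), of t s] Rz stS
        order_ge_nc_C(2)[OF z(1), of "s \<otimes> t"] \<open>z \<noteq> s \<otimes> t\<close> by simp
    from order_ge_mult[OF orders_ge_coords[OF gH] this] h0 show ?thesis unfolding g(2) by simp
  qed
  then have "order_ge 3 (nc h \<one>)" unfolding g(2) nc_linear_ext by (intro order_ge_sum)
  then have "lookup (qhalf_pow 2) 2 = 0" unfolding one order_ge_def by simp
  then show False by (simp add: lookup_qhalf_pow)
qed

text \<open>As long as w has a single left descent, removing it stays in the same class and keeps
  the right descents. Induction thus reduces to two left descents, which is the case treated
  above.\<close>

lemma left_le_pair_lower:
  assumes "commuting_pair {s, t}" "w \<in> with_right_descents {s, t}" shows "left_le (s \<otimes> t) w"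
  using assms(2)
proof (induction "len w" arbitrary: w rule: less_induct)
  case less
  have st: "s \<noteq> t" using assms(1) by (auto simp: commuting_pair_def doubleton_eq_iff)
  have w: "w \<in> carrier W" "right_descents w = {s, t}" using less.prems by (auto simp: with_right_descents_def)
  show ?case
  proof (rule left_descents_cases[OF w(1)])
    assume "w = \<one>" then show ?thesis using w by simp
  next
    fix r assume L: "left_descents w = {r}"
    then have r: "r \<in> S" "len (r \<otimes> w) < len w" using left_descents_iff[OF w(1), of r] by auto
    have ne: "r \<otimes> w \<noteq> \<one>"
    proof
      assume "r \<otimes> w = \<one>"
      then have "r \<otimes> (r \<otimes> w) = r" using r by simp
      then have "w = r" using r w by simp
      then show False using w(2) st r(1) by auto
    qed
    note eq = left_equiv_strip[OF w(1) L ne]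
    then have "r \<otimes> w \<in> with_right_descents {s, t}"
      using left_equiv_right_descents r w by (simp add: with_right_descents_def)
    then show ?thesis using less.hyps[OF r(2)] eq left_le_trans by (auto simp: left_equiv_def)
  next
    fix a b assume "left_descents w = {a, b}" "a \<noteq> b" "a \<in> S" "b \<in> S" "a \<otimes> b = b \<otimes> a"
    then show ?thesis using left_le_pair_lower_aux[OF assms(1) less.prems, of a b]
      by (auto simp: commuting_pair_def)
  qed
qed

lemma left_equiv_with_right_descents:
  assumes "commuting_pair A" "x \<in> with_right_descents A" "y \<in> with_right_descents A"
  shows "left_equiv x y"
proof -
  obtain s t where A: "A = {s, t}" using assms(1) by (auto simp: commuting_pair_def)
  note p = assms[unfolded A]
  show ?thesis unfolding left_equiv_def
    using left_le_trans[OF left_le_pair_upper[OF p(1,2)] left_le_pair_lower[OF p(1,3)]]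
      left_le_trans[OF left_le_pair_upper[OF p(1,3)] left_le_pair_lower[OF p(1,2)]] by simp
qed

lemma left_edge_with_right_descents:
  assumes "commuting_pair A" "x \<in> with_right_descents A" "left_edge y x" shows "y \<in> with_right_descents A"
  using left_edge_right_descents[OF assms(3)] right_descents_pair[OF assms(1), of y] assms
  by (auto simp: with_right_descents_def left_edge_def)

end

section \<open>Translation by lines, and the left cells\<close>

context right_angled_system
begin

text \<open>The words that may follow an element with right descent set A in such a way that each
  new letter becomes the only right descent. A letter commutes with itself, so the noncommutation
  also rules out repetitions. The right descent set reached in this way is
  \<open>ends A u\<close>.\<close>

fun tail :: "'a set \<Rightarrow> 'a list \<Rightarrow> bool" where
  "tail A [] \<longleftrightarrow> True"
| "tail A (d # u) \<longleftrightarrow> d \<in> S \<and> (\<forall>t \<in> A. d \<otimes> t \<noteq> t \<otimes> d) \<and> tail {d} u"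

definition ends :: "'a set \<Rightarrow> 'a list \<Rightarrow> 'a set" where
  "ends A u = (if u = [] then A else {last u})"

lemma ends_simps [simp]: "ends A [] = A" "ends A (u @ [d]) = {d}"
  by (simp_all add: ends_def)

lemma ends_Cons: "ends A (d # u) = ends {d} u"
  by (simp add: ends_def)

lemma tail_snoc: "tail A (u @ [d]) \<longleftrightarrow> tail A u \<and> d \<in> S \<and> (\<forall>t \<in> ends A u. d \<otimes> t \<noteq> t \<otimes> d)"
  by (induction A u rule: tail.induct) (auto simp: ends_Cons)

lemma tail_lists: "tail A u \<Longrightarrow> u \<in> lists S"
  by (induction A u rule: tail.induct) auto

lemma noncommuting_notin:
  "w \<in> carrier W \<Longrightarrow> \<forall>t \<in> right_descents w. d \<otimes> t \<noteq> t \<otimes> d \<Longrightarrow> d \<notin> right_descents w"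
  by auto

text \<open>A letter that commutes with none of the current right descents is no descent itself,
  hence adds one to the length, and by \<open>right_descents_mult\<close> it replaces all of
  them.\<close>

lemma tail_mult:
  assumes "x \<in> carrier W" "right_descents x = A" "tail A u"
  shows "right_descents (x \<otimes> word_prod u) = ends A u" "len (x \<otimes> word_prod u) = len x + length u"
proof -
  have "right_descents (x \<otimes> word_prod u) = ends A u \<and> len (x \<otimes> word_prod u) = len x + length u"
    using assms(3)
  proof (induction u rule: rev_induct)
    case Nil then show ?case using assms by simp
  next
    case (snoc d u)
    let ?w = "x \<otimes> word_prod u"
    have u: "u \<in> lists S" "d \<in> S" "\<forall>t \<in> ends A u. d \<otimes> t \<noteq> t \<otimes> d" "tail A u"
      using snoc.prems tail_lists[of A u] by (auto simp: tail_snoc)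
    have w: "?w \<in> carrier W" "right_descents ?w = ends A u" "len ?w = len x + length u"
      using snoc.IH u assms by auto
    have d: "d \<notin> right_descents ?w" using noncommuting_notin w u by auto
    have e: "x \<otimes> word_prod (u @ [d]) = ?w \<otimes> d" using u assms by (simp add: m_assoc)
    have "right_descents (?w \<otimes> d) = {d}"
      using right_descents_mult[OF w(1) u(2) d] u(3) w(2) by auto
    moreover have "len (?w \<otimes> d) = Suc (len ?w)"
      using len_right_descent[of "?w \<otimes> d" d] right_descents_mult[OF w(1) u(2) d] w(1) u(2) by simp
    ultimately show ?case using w(3) unfolding e by simp
  qed
  then show "right_descents (x \<otimes> word_prod u) = ends A u" "len (x \<otimes> word_prod u) = len x + length u" by auto
qed

abbreviation (input) ract :: "'a \<Rightarrow> 'a \<Rightarrow> 'a" where "ract d \<equiv> \<lambda>w. w \<otimes> d"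

text \<open>A correction z has d as right descent, hence not t, since the two do not commute;
  \<open>c1_descent\<close> for t then leaves one candidate.\<close>

lemma c1_noncommuting:
  assumes "w \<in> carrier W" "t \<in> right_descents w" "d \<in> S" "d \<otimes> t \<noteq> t \<otimes> d" 
    and "len (z \<otimes> d) < len z" "c1 z w \<noteq> 0"
  shows "z = w \<otimes> t"
proof -
  have z: "z \<in> carrier W" using c1_bruhat(4)[OF assms(1,6)] .
  have t: "t \<in> S" "len (w \<otimes> t) < len w" using assms(1,2) by (auto simp: right_descents_iff)
  have "d \<in> right_descents z" using assms z by (simp add: right_descents_iff)
  then have "t \<notin> right_descents z" using right_descents_commute[OF z] assms(4) by blast
  then have "len z < len (z \<otimes> t)" using act_len_neq[of "ract t" z] t z by (auto simp: right_descents_iff)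
  then have "z \<otimes> t = w" using c1_descent[of "ract t" w z] t z assms by simp
  then show ?thesis using t z by auto
qed

text \<open>With two right descents s and t, a correction z would have to equal both w s and w
  t.\<close>

lemma C_mult_pair:
  assumes "commuting_pair A" "w \<in> carrier W" "right_descents w = A" "d \<in> S" "\<forall>t \<in> A. d \<otimes> t \<noteq> t \<otimes> d"
  shows "C (w \<otimes> d) = F (ract d) (C w)"
proof -
  obtain s t where A: "A = {s, t}" "s \<noteq> t" "s \<in> S" "t \<in> S" using assms(1) by (auto simp: commuting_pair_def)
  have "d \<notin> right_descents w" using noncommuting_notin assms by blast
  then have up: "len w < len (w \<otimes> d)" using act_len_neq[of "ract d" w] assms by (auto simp: right_descents_iff)
  have "c1 z w = 0" if "len (z \<otimes> d) < len z" for z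
  proof (rule ccontr)
    assume "c1 z w \<noteq> 0"
    then have "z = w \<otimes> s" "z = w \<otimes> t"
      using c1_noncommuting[OF assms(2) _ assms(4) _ that] A assms(3,5) by blast+
    then show False using A assms(2) by simp
  qed
  then show ?thesis using F_C_up[of "ract d" w] up assms by simp
qed

text \<open>With e as the only right descent of z0 e, the single candidate for a correction is z0.
  It occurs exactly if d is a right descent of z0, and its \<mu> is known from
  \<open>c1_act\<close>.\<close>

lemma C_mult_single:
  assumes z0: "z0 \<in> carrier W" "e \<in> S" "e \<notin> right_descents z0" "right_descents (z0 \<otimes> e) = {e}"
    and d: "d \<in> S" "d \<otimes> e \<noteq> e \<otimes> d"
  shows "C (z0 \<otimes> e \<otimes> d) = F (ract d) (C (z0 \<otimes> e)) - (if d \<in> right_descents z0 then C z0 else 0)"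
proof -
  let ?w = "z0 \<otimes> e"
  have w: "?w \<in> carrier W" using z0 by simp
  have "d \<notin> right_descents ?w" using noncommuting_notin[OF w, of d] z0 d by auto
  then have up: "len ?w < len (?w \<otimes> d)" using act_len_neq[of "ract d" ?w] w d by (auto simp: right_descents_iff)
  have z0up: "len z0 < len ?w" using act_len_neq[of "ract e" z0] z0 by (auto simp: right_descents_iff)
  then have c: "c1 z0 ?w = -1" using c1_act[of "ract e" z0] z0 by simp
  have only: "c1 z ?w = 0" if "len (z \<otimes> d) < len z" "z \<noteq> z0" for z
    using c1_noncommuting[OF w _ d(1) _ that(1), of e] z0 d that by auto
  let ?Z = "{z \<in> keys (C ?w). len (z \<otimes> d) < len z}"
  have mem: "z0 \<in> ?Z \<longleftrightarrow> d \<in> right_descents z0"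
    using c1_bruhat(5)[OF w, of z0] c d z0 by (auto simp: right_descents_iff)
  have "(\<Sum>z\<in>?Z. scale (of_int (c1 z ?w)) (C z)) = (\<Sum>z\<in>?Z. if z = z0 then - C z0 else 0)"
  proof (rule sum.cong)
    fix z assume "z \<in> ?Z"
    then show "scale (of_int (c1 z ?w)) (C z) = (if z = z0 then - C z0 else 0)"
      using only[of z] c by (auto intro!: poly_mapping_eqI)
  qed simp
  also have "\<dots> = (if d \<in> right_descents z0 then - C z0 else 0)" using mem by simp
  finally show ?thesis using F_C_up[of "ract d" ?w] up w d by (simp split: if_splits)
qed

text \<open>Right multiplication by a fixed Hecke element appears here as an operator commuting with
  left multiplications. The operator for u is built from those for u without its last letter and
  without its last two letters, which is why the induction is over all shorter tails.\<close>

lemma translation: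
  assumes "commuting_pair A" "tail A u"
  shows "\<exists>\<Phi>. linear_op \<Phi> \<and> (\<forall>s\<in>S. \<forall>h\<in>H. \<Phi> (F (lact s) h) = F (lact s) (\<Phi> h)) \<and> (\<forall>h\<in>H. \<Phi> h \<in> H) \<and>
    (\<forall>x\<in>with_right_descents A. \<Phi> (C x) = C (x \<otimes> word_prod u))"
  using assms(2)
proof (induction "length u" arbitrary: u rule: less_induct)
  case less
  show ?case
  proof (cases u rule: rev_cases)
    case Nil
    then show ?thesis by (intro exI[of _ "\<lambda>h. h"]) (auto simp: with_right_descents_def)
  next
    case (snoc v d)
    have v: "tail A v" "d \<in> S" "\<forall>t \<in> ends A v. d \<otimes> t \<noteq> t \<otimes> d" "v \<in> lists S"
      using less.prems tail_lists[of A v] by (auto simp: snoc tail_snoc)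
    obtain \<Phi> where \<Phi>: "linear_op \<Phi>" "\<And>s h. s \<in> S \<Longrightarrow> h \<in> H \<Longrightarrow> \<Phi> (F (lact s) h) = F (lact s) (\<Phi> h)"
      "\<And>h. h \<in> H \<Longrightarrow> \<Phi> h \<in> H" "\<And>x. x \<in> with_right_descents A \<Longrightarrow> \<Phi> (C x) = C (x \<otimes> word_prod v)"
      using less.hyps[of v] v(1) snoc by auto
    have d\<Phi>: "linear_op (\<lambda>h. F (ract d) (\<Phi> h))" by (rule linear_op_comp[of "F (ract d)"]) (use \<Phi> in auto)
    have prod: "x \<otimes> word_prod u = x \<otimes> word_prod v \<otimes> d" if "x \<in> carrier W" for x
      using that v snoc by (simp add: m_assoc)
    show ?thesis
    proof (cases v rule: rev_cases)
      case Nil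
      have "F (ract d) (\<Phi> (C x)) = C (x \<otimes> word_prod u)" if "x \<in> with_right_descents A" for x
        using C_mult_pair[OF assms(1), of x d] \<Phi>(4)[OF that] prod[of x] that v Nil
        by (simp add: with_right_descents_def)
      then show ?thesis using d\<Phi> \<Phi> v(2)
        by (intro exI[of _ "\<lambda>h. F (ract d) (\<Phi> h)"]) (auto simp: F_left_right)
    next
      case (snoc v' e)
      have v': "tail A v'" "e \<in> S" "\<forall>t \<in> ends A v'. e \<otimes> t \<noteq> t \<otimes> e" "v' \<in> lists S"
        using v(1) tail_lists[of A v'] by (auto simp: snoc tail_snoc)
      obtain \<Psi> where \<Psi>: "linear_op \<Psi>" "\<And>s h. s \<in> S \<Longrightarrow> h \<in> H \<Longrightarrow> \<Psi> (F (lact s) h) = F (lact s) (\<Psi> h)"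
        "\<And>h. h \<in> H \<Longrightarrow> \<Psi> h \<in> H" "\<And>x. x \<in> with_right_descents A \<Longrightarrow> \<Psi> (C x) = C (x \<otimes> word_prod v')"
        using less.hyps[of v'] v'(1) \<open>u = v @ [d]\<close> snoc by auto
      \<comment> \<open>The correction C_{x v'} is present exactly if d is in R(x v'). By
        \<open>tail_mult\<close> this set is \<open>ends A v'\<close>, the same for all x, so one
        operator serves them all.\<close>
      let ?\<Theta> = "\<lambda>h. F (ract d) (\<Phi> h) - (if d \<in> ends A v' then \<Psi> h else 0)"
      have "?\<Theta> (C x) = C (x \<otimes> word_prod u)" if x: "x \<in> with_right_descents A" for x
      proof -
        have xc: "x \<in> carrier W" "right_descents x = A" using x by (auto simp: with_right_descents_def)
        let ?z = "x \<otimes> word_prod v'"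
        have z: "?z \<in> carrier W" "right_descents ?z = ends A v'" using tail_mult(1)[OF xc v'(1)] xc v' by auto
        have ze: "?z \<otimes> e = x \<otimes> word_prod v" using snoc v' xc by (simp add: m_assoc)
        have "right_descents (?z \<otimes> e) = {e}" using tail_mult(1)[OF xc v(1)] unfolding ze snoc by simp
        moreover have "e \<notin> right_descents ?z" using noncommuting_notin[OF z(1)] v'(3) z(2) by simp
        moreover have "d \<otimes> e \<noteq> e \<otimes> d" using v(3) snoc by simp
        ultimately show ?thesis
          using C_mult_single[OF z(1) v'(2) _ _ v(2)] \<Phi>(4)[OF x] \<Psi>(4)[OF x] prod[OF xc(1)] z(2) ze by simp
      qed
      moreover have "linear_op ?\<Theta>"
        using linear_op_diff[OF d\<Phi> \<Psi>(1)] d\<Phi> by (cases "d \<in> ends A v'") simp_all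
      moreover have "?\<Theta> (F (lact s) h) = F (lact s) (?\<Theta> h)" if "s \<in> S" "h \<in> H" for s h
        using that \<Phi> \<Psi> v(2) by (simp add: F_simps F_left_right)
      moreover have "?\<Theta> h \<in> H" if "h \<in> H" for h using that \<Phi> \<Psi> v(2) by simp
      ultimately show ?thesis by (intro exI[of _ ?\<Theta>]) blast
    qed
  qed
qed

section \<open>The sets X(A) u as left cells\<close>

definition translate :: "'a set \<Rightarrow> 'a list \<Rightarrow> 'a set" where
  "translate A u = (\<lambda>x. x \<otimes> word_prod u) ` with_right_descents A"

lemma with_right_descents_closed: "with_right_descents A \<subseteq> carrier W"
  by (auto simp: with_right_descents_def)

text \<open>The translating operator commutes with left multiplication by C_s, so the expansion of
  C_s C_x is carried over term by term, each z being replaced by z u. This relabelling is injective,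
  so no coordinates merge.\<close>

lemma F_C_translate:
  assumes "commuting_pair A" "tail A u" "x \<in> with_right_descents A" "s \<in> S"
  defines "g \<equiv> linear_ext (\<lambda>z. T (z \<otimes> word_prod u)) (FC (lact s) x)"
  shows "F (lact s) (C (x \<otimes> word_prod u)) = linear_ext C g" "g \<in> free_on (translate A u)"
    "y \<in> with_right_descents A \<Longrightarrow> lookup g (y \<otimes> word_prod u) = lookup (FC (lact s) x) y"
proof -
  obtain \<Phi> where \<Phi>: "linear_op \<Phi>" "\<And>s h. s \<in> S \<Longrightarrow> h \<in> H \<Longrightarrow> \<Phi> (F (lact s) h) = F (lact s) (\<Phi> h)"
    "\<And>x. x \<in> with_right_descents A \<Longrightarrow> \<Phi> (C x) = C (x \<otimes> word_prod u)"
    using translation[OF assms(1,2)] by blast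
  have x: "x \<in> carrier W" using assms(3) with_right_descents_closed by blast
  have u: "u \<in> lists S" using assms(2) tail_lists by blast
  have FC: "FC (lact s) x \<in> free_on (with_right_descents A)"
    using FC_free_on[of "with_right_descents A" s x] with_right_descents_closed
      left_edge_with_right_descents[OF assms(1)] assms(3,4) by blast
  have "F (lact s) (C (x \<otimes> word_prod u)) = \<Phi> (linear_ext C (FC (lact s) x))"
    using \<Phi>(2)[OF assms(4) C_closed[OF x]] \<Phi>(3)[OF assms(3)] F_C[OF acts_left[OF assms(4)] x] by simp
  also have "\<dots> = linear_ext C g"
    unfolding g_def
  proof (rule linear_op_eqI[where h = "FC (lact s) x"])
    show "linear_op (\<lambda>h. \<Phi> (linear_ext C h))" by (rule linear_op_comp[OF \<Phi>(1)]) simp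
    show "linear_op (\<lambda>h. linear_ext C (linear_ext (\<lambda>z. T (z \<otimes> word_prod u)) h))"
      by (rule linear_op_comp[of "linear_ext C"]) auto
    fix z assume "z \<in> keys (FC (lact s) x)"
    then have "z \<in> with_right_descents A" using FC by (auto simp: free_on_def)
    then show "\<Phi> (linear_ext C (T z)) = linear_ext C (linear_ext (\<lambda>z. T (z \<otimes> word_prod u)) (T z))"
      using \<Phi>(3) by simp
  qed
  finally show "F (lact s) (C (x \<otimes> word_prod u)) = linear_ext C g" .
  show "g \<in> free_on (translate A u)" unfolding g_def
    by (rule linear_op_closed[where A = "with_right_descents A"]) (use FC in \<open>auto simp: translate_def\<close>)
  show "lookup g (y \<otimes> word_prod u) = lookup (FC (lact s) x) y" if y: "y \<in> with_right_descents A"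
  proof -
    have "z \<otimes> word_prod u = y \<otimes> word_prod u \<longleftrightarrow> z = y" if "z \<in> keys (FC (lact s) x)" for z
      using that FC y with_right_descents_closed u by (auto simp: free_on_def subset_iff)
    then have "lookup g (y \<otimes> word_prod u) = (\<Sum>z\<in>keys (FC (lact s) x). if z = y then lookup (FC (lact s) x) y else 0)"
      unfolding g_def linear_ext_def lookup_sum by (intro sum.cong) (auto simp: lookup_single when_def)
    then show ?thesis by (simp add: in_keys_iff)
  qed
qed

lemma translate_closed: 
  assumes "tail A u" shows "translate A u \<subseteq> carrier W"
  using tail_lists[OF assms] by (auto simp: translate_def with_right_descents_def)

lemma left_edge_translate:
  assumes "commuting_pair A" "tail A u" "w \<in> translate A u" "left_edge y w" shows "y \<in> translate A u"
proof (rule left_closedI[OF translate_closed[OF assms(2)] assms(3,4)])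
  fix s assume "s \<in> S"
  moreover obtain x where "x \<in> with_right_descents A" "w = x \<otimes> word_prod u" using assms(3) by (auto simp: translate_def)
  ultimately show "\<exists>g\<in>free_on (translate A u). F (lact s) (C w) = linear_ext C g"
    using F_C_translate(1,2)[OF assms(1,2)] by blast
qed

lemma left_le_translate:
  assumes "commuting_pair A" "tail A u" "w \<in> translate A u" "left_le y w" shows "y \<in> translate A u"
proof -
  have "left_edge\<^sup>*\<^sup>* y w" using assms(4) by (simp add: left_le_edge)
  then show ?thesis using assms(3)
    by (induction rule: converse_rtranclp_induct) (auto intro: left_edge_translate[OF assms(1,2)])
qed

lemma left_edge_translate_mono:
  assumes "commuting_pair A" "tail A u" "x \<in> with_right_descents A" "left_edge y x"
  shows "left_edge (y \<otimes> word_prod u) (x \<otimes> word_prod u)"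
proof -
  have y: "y \<in> with_right_descents A" using left_edge_with_right_descents assms by blast
  have xy: "x \<in> carrier W" "y \<in> carrier W" using y assms(3) with_right_descents_closed by auto
  have u: "u \<in> lists S" using assms(2) tail_lists by blast
  let ?x = "x \<otimes> word_prod u" and ?y = "y \<otimes> word_prod u"
  have xyu: "?x \<in> carrier W" "?y \<in> carrier W" using xy u by auto
  obtain s where s: "s \<in> S" "s \<notin> left_descents x" "lookup (FC (lact s) x) y \<noteq> 0"
    using assms(4) left_edge_iff[OF xy(2,1)] by blast
  note g = F_C_translate[OF assms(1-3) s(1)]
  have "FC (lact s) ?x = linear_ext (\<lambda>z. T (z \<otimes> word_prod u)) (FC (lact s) x)"
  proof (rule linear_ext_C_inject)
    show "linear_ext (\<lambda>z. T (z \<otimes> word_prod u)) (FC (lact s) x) \<in> H"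
      using g(2) translate_closed[OF assms(2)] by (auto simp: free_on_def)
    show "linear_ext C (FC (lact s) ?x) = linear_ext C (linear_ext (\<lambda>z. T (z \<otimes> word_prod u)) (FC (lact s) x))"
      using g(1) F_C[OF acts_left[OF s(1)] xyu(1)] by simp
  qed (use s xyu in simp)
  then have nz: "lookup (FC (lact s) ?x) ?y \<noteq> 0" using g(3)[OF y] s(3) by simp
  \<comment> \<open>If s were a left descent of x u, the expansion would consist of C_{xu} alone.
    That gives y = x, although C_x does not occur in C_s C_x for an ascent s of x.\<close>
  have "s \<notin> left_descents ?x"
  proof
    assume sx: "s \<in> left_descents ?x"
    then have "FC (lact s) ?x = scale (- (qhalf_pow 1 + qhalf_pow (-1))) (T ?x)"
      using left_descents_iff[OF xyu(1)] by (simp add: FC_def)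
    then have "?y = ?x" using nz by (auto simp: lookup_single when_def split: if_splits)
    then have "y = x" using xy u by simp
    moreover have up: "len x < len (s \<otimes> x)" 
      using s xy act_len_neq[of "lact s" x] by (auto simp: left_descents_iff)
    ultimately show False using lookup_FC[OF acts_left[OF s(1)] xy(1) up, of x] s(3) up by (auto split: if_splits)
  qed
  then show ?thesis using left_edge_iff[OF xyu(2,1)] s nz by blast
qed

lemma left_le_translate_mono:
  assumes "commuting_pair A" "tail A u" "x \<in> with_right_descents A" "left_le y x"
  shows "left_le (y \<otimes> word_prod u) (x \<otimes> word_prod u)"
proof -
  have "left_edge\<^sup>*\<^sup>* y x" using assms(4) by (simp add: left_le_edge)
  then have "y \<in> with_right_descents A \<and> left_le (y \<otimes> word_prod u) (x \<otimes> word_prod u)"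
  proof (induction rule: converse_rtranclp_induct)
    case base
    then show ?case using assms(3) tail_lists[OF assms(2)] by (auto simp: with_right_descents_def)
  next
    case (step y z)
    then show ?case using left_edge_with_right_descents[OF assms(1)] left_edge_translate_mono[OF assms(1,2)]
        left_edge_le left_le_trans by blast
  qed
  then show ?thesis by simp
qed

text \<open>Closure under the preorder bounds the class from above; that X(A) is a single class,
  together with monotonicity of the translation, fills the whole set.\<close>

lemma left_equiv_translate:
  assumes "commuting_pair A" "tail A u" "w \<in> translate A u" shows "{y. left_equiv w y} = translate A u"
proof (intro equalityI subsetI)
  fix y assume "y \<in> {y. left_equiv w y}"
  then show "y \<in> translate A u" using left_le_translate[OF assms] by (auto simp: left_equiv_def)
next
  fix y assume "y \<in> translate A u"
  then obtain x x' where "x \<in> with_right_descents A" "x' \<in> with_right_descents A"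
    "w = x \<otimes> word_prod u" "y = x' \<otimes> word_prod u" using assms(3) by (auto simp: translate_def)
  then show "y \<in> {y. left_equiv w y}"
    using left_equiv_with_right_descents[OF assms(1)] left_le_translate_mono[OF assms(1,2)]
    by (auto simp: left_equiv_def)
qed

section \<open>Normal forms: a head followed by a tail\<close>

definition is_head :: "'a \<Rightarrow> bool" where
  "is_head x \<longleftrightarrow> x \<in> S \<or> x \<in> carrier W \<and> commuting_pair (right_descents x)"

lemma is_head_closed: "is_head x \<Longrightarrow> x \<in> carrier W"
  by (auto simp: is_head_def)

lemma is_head_neq_one: "is_head x \<Longrightarrow> x \<noteq> \<one>"
  using gen_neq_one[of \<one>] by (auto simp: is_head_def commuting_pair_def)

text \<open>As long as there is only one right descent a, it is removed. The right descents
  uncovered by this do not commute with a, as otherwise they would have been visible before, so a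
  extends the tail.\<close>

lemma normal_form_exists:
  assumes "w \<in> carrier W" "w \<noteq> \<one>"
  shows "\<exists>x u. is_head x \<and> tail (right_descents x) u \<and> w = x \<otimes> word_prod u"
  using assms
proof (induction "len w" arbitrary: w rule: less_induct)
  case less
  show ?case
  proof (rule right_descents_cases[OF less.prems(1)])
    fix s t assume "right_descents w = {s, t}" "s \<noteq> t" "s \<in> S" "t \<in> S" "s \<otimes> t = t \<otimes> s"
    then have "is_head w" using less.prems by (auto simp: is_head_def commuting_pair_def)
    then show ?thesis using less.prems by (intro exI[of _ w] exI[of _ "[]"]) simp
  next
    fix a assume R: "right_descents w = {a}"
    then have a: "a \<in> S" "len (w \<otimes> a) < len w" using right_descents_iff[OF less.prems(1), of a] by auto
    let ?w = "w \<otimes> a"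
    have w': "?w \<in> carrier W" "?w \<otimes> a = w" using a less.prems by auto
    show ?thesis
    proof (cases "?w = \<one>")
      case True
      then have "w = a" using w'(2) a by simp
      then show ?thesis using a by (intro exI[of _ a] exI[of _ "[]"]) (simp add: is_head_def)
    next
      case False
      then obtain x u where xu: "is_head x" "tail (right_descents x) u" "?w = x \<otimes> word_prod u"
        using less.hyps[OF a(2) w'(1)] by blast
      have na: "a \<notin> right_descents ?w" using a w' by (simp add: right_descents_iff)
      have "insert a {t \<in> right_descents ?w. a \<otimes> t = t \<otimes> a} = {a}"
        using right_descents_mult[OF w'(1) a(1) na] R w'(2) by simp
      then have "\<forall>t \<in> right_descents ?w. a \<otimes> t \<noteq> t \<otimes> a" using na by blast
      then have "tail (right_descents x) (u @ [a])"
        using xu tail_mult(1)[OF is_head_closed[OF xu(1)] refl xu(2)] a by (simp add: tail_snoc)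
      moreover have "w = x \<otimes> word_prod (u @ [a])"
        using w'(2) xu tail_lists[OF xu(2)] is_head_closed[OF xu(1)] a by (simp add: m_assoc)
      ultimately show ?thesis using xu(1) by blast
    qed
  qed (use less.prems in simp)
qed

lemma normal_form_unique:
  assumes "is_head x" "is_head x'" "tail (right_descents x) u" "tail (right_descents x') u'"
    and "x \<otimes> word_prod u = x' \<otimes> word_prod u'"
  shows "x = x' \<and> u = u'"
proof -
  \<comment> \<open>A head with a nonempty tail has a single right descent and length at least two,
    so it is not a head itself. Hence the two tails have to be exhausted at the same time.\<close>
  have no: False if "is_head x" "is_head x'" "tail (right_descents x') (v @ [d])" "x = x' \<otimes> word_prod (v @ [d])"
    for x x' v d
  proof -
    note m = tail_mult[OF is_head_closed[OF that(2)] refl that(3), folded that(4)]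
    then have "\<not> commuting_pair (right_descents x)" by (auto simp: commuting_pair_def doubleton_eq_iff)
    then have "len x = 1" using that(1) by (auto simp: is_head_def)
    then show False using m(2) is_head_neq_one[OF that(2)] is_head_closed[OF that(2)] by simp
  qed
  show ?thesis using assms(3-5)
  proof (induction u arbitrary: u' rule: rev_induct)
    case Nil
    then have x: "x = x' \<otimes> word_prod u'" using is_head_closed[OF assms(1)] by simp
    then have "u' = []" using no[OF assms(1,2)] Nil(2) by (cases u' rule: rev_cases) blast+
    then show ?case using x is_head_closed[OF assms(2)] by simp
  next
    case (snoc d u)
    show ?case
    proof (cases u' rule: rev_cases)
      case Nil
      then show ?thesis using no[OF assms(2,1) snoc.prems(1)] snoc.prems(3) is_head_closed[OF assms(2)] by simp
    next
      case (snoc v e)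
      have "{d} = {e}" 
        using tail_mult(1)[OF is_head_closed[OF assms(1)] refl snoc.prems(1)]
          tail_mult(1)[OF is_head_closed[OF assms(2)] refl snoc.prems(2)] snoc.prems(3) snoc by simp
      then have e: "e = d" by simp
      have t: "tail (right_descents x) u" "tail (right_descents x') v" "d \<in> S"
        using snoc.prems snoc by (auto simp: tail_snoc)
      have l: "u \<in> lists S" "v \<in> lists S" using tail_lists t by blast+
      have c: "x \<in> carrier W" "x' \<in> carrier W" using is_head_closed assms by auto
      have "x \<otimes> word_prod u \<otimes> d = x' \<otimes> word_prod v \<otimes> d" 
        using snoc.prems(3) snoc e l c t(3) by (simp add: m_assoc)
      then have "x \<otimes> word_prod u = x' \<otimes> word_prod v" using l c t(3) by simp
      then show ?thesis using snoc.IH[OF t(1,2)] snoc e by simp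
    qed
  qed
qed

section \<open>Lines and the cells of the generators\<close>

definition lines_to :: "'a \<Rightarrow> 'a set" where
  "lines_to s = {x \<otimes> word_prod u | x u. x \<in> S \<and> tail {x} u \<and> ends {x} u = {s}}"

lemma line_left_descents:
  "x \<in> S \<Longrightarrow> tail {x} u \<Longrightarrow> left_descents (x \<otimes> word_prod u) = {x}"
proof (induction u arbitrary: x)
  case (Cons y u)
  then have y: "y \<in> S" "y \<otimes> x \<noteq> x \<otimes> y" "tail {y} u" by auto
  have L: "left_descents (y \<otimes> word_prod u) = {y}" using Cons.IH y by blast
  have c: "y \<otimes> word_prod u \<in> carrier W" using y tail_lists[OF y(3)] by simp
  have "x \<notin> left_descents (y \<otimes> word_prod u)" using L y by auto
  from left_descents_mult[OF c Cons.prems(1) this] show ?case using L y by auto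
qed simp

lemma line_left_equiv:
  "x \<in> S \<Longrightarrow> tail {x} u \<Longrightarrow> left_equiv (x \<otimes> word_prod u) (last (x # u))"
proof (induction u arbitrary: x)
  case Nil then show ?case by (simp add: left_equiv_def)
next
  case (Cons y u)
  then have y: "y \<in> S" "y \<otimes> x \<noteq> x \<otimes> y" "tail {y} u" by auto
  let ?w = "y \<otimes> word_prod u"
  have c: "?w \<in> carrier W" using y tail_lists[OF y(3)] by simp
  have L: "left_descents (x \<otimes> ?w) = {x}" using line_left_descents[OF Cons.prems] by simp
  have "?w \<noteq> \<one>" using line_left_descents[OF y(1,3)] by auto
  then have "left_equiv (x \<otimes> (x \<otimes> ?w)) (x \<otimes> ?w)" using L c Cons.prems(1) by (intro left_equiv_strip) auto
  then have "left_equiv ?w (x \<otimes> ?w)" using c Cons.prems(1) by simp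
  from left_equiv_trans[OF left_equiv_sym[OF this] Cons.IH[OF y(1,3)]] show ?case by simp
qed

lemma left_equiv_lines:
  assumes s: "s \<in> S" and w: "w \<in> lines_to s" shows "{y. left_equiv w y} = lines_to s"
proof -
  have eqs: "left_equiv y s" "y \<in> carrier W" if yl: "y \<in> lines_to s" for y
  proof -
    obtain x u where y: "y = x \<otimes> word_prod u" "x \<in> S" "tail {x} u" "ends {x} u = {s}"
      using yl unfolding lines_to_def by blast
    then have "last (x # u) = s" by (auto simp: ends_def split: if_splits)
    then show "left_equiv y s" using line_left_equiv[OF y(2,3)] y(1) by simp
    then show "y \<in> carrier W" using left_le_closed by (auto simp: left_equiv_def)
  qed
  show ?thesis
  proof (intro equalityI subsetI)
    fix y assume "y \<in> lines_to s"
    from left_equiv_trans[OF eqs(1)[OF w] left_equiv_sym[OF eqs(1)[OF this]]]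
    show "y \<in> {y. left_equiv w y}" by simp
  next
    fix y assume "y \<in> {y. left_equiv w y}"
    then have y: "left_equiv w y" "y \<in> carrier W" using left_le_closed by (auto simp: left_equiv_def)
    then have ys: "left_equiv y s" using left_equiv_trans[OF left_equiv_sym eqs(1)[OF w]] by blast
    then have R: "right_descents y = {s}" using left_equiv_right_descents[OF ys] s by simp
    then have "y \<noteq> \<one>" by auto
    then obtain x u where xu: "is_head x" "tail (right_descents x) u" "y = x \<otimes> word_prod u"
      using normal_form_exists y by blast
    \<comment> \<open>If the head were a pair, the class of y would be a set X(A) u; it would
      contain s, giving s a second normal form.\<close>
    have "x \<in> S"
    proof (rule ccontr)
      assume "x \<notin> S"
      then have p: "commuting_pair (right_descents x)" "x \<in> carrier W" using xu by (auto simp: is_head_def)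
      then have "y \<in> translate (right_descents x) u" using xu by (auto simp: translate_def with_right_descents_def)
      then have "s \<in> translate (right_descents x) u"
        using left_equiv_translate[OF p(1) xu(2)] ys by blast
      then obtain x' where x': "x' \<in> carrier W" "right_descents x' = right_descents x" "s = x' \<otimes> word_prod u"
        by (auto simp: translate_def with_right_descents_def)
      then have "is_head x'" "is_head s" using p s by (auto simp: is_head_def)
      then have "s = x'" using normal_form_unique[of s x' "[]" u] x' xu s by simp
      then show False using p(1) x'(2) s by (auto simp: commuting_pair_def doubleton_eq_iff)
    qed
    then show "y \<in> lines_to s" using xu R tail_mult(1)[OF gen_closed refl xu(2)] by (auto simp: lines_to_def)
  qed
qed

end

section \<open>Segments and roots of left precells\<close>

context right_angled_system
begin

lemma len_left_ascent: "w \<in> carrier W \<Longrightarrow> s \<in> S \<Longrightarrow> s \<notin> left_descents w \<Longrightarrow> len (s \<otimes> w) = Suc (len w)"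
  using len_left_descent[of "s \<otimes> w" s] left_descents_mult[of w s] by simp

lemma reduced_appendD:
  assumes "reduced (us @ ws)" shows "reduced us" "reduced ws"
proof -
  have l: "us \<in> lists S" "ws \<in> lists S" using assms by (auto simp: reduced_def)
  have "length us + length ws = len (word_prod us \<otimes> word_prod ws)" using assms l by (simp add: reduced_def)
  moreover have "len (word_prod us \<otimes> word_prod ws) \<le> len (word_prod us) + len (word_prod ws)"
    using l by (intro len_mult_le) auto
  ultimately show "reduced us" "reduced ws"
    using len_word_prod_le[OF l(1)] len_word_prod_le[OF l(2)] l by (auto simp: reduced_def)
qed

lemma reduced_hd_descent:
  assumes "reduced (a # ws)" shows "a \<in> left_descents (a \<otimes> word_prod ws)"
  using reduced_ConsD[OF assms] assms by (auto simp: left_descents_iff reduced_def)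

text \<open>A one-sided version of \<open>fixed_line\<close>, suited to induction on u. The
  requirement that u be a line follows from it, and reversing words covers the other end.\<close>

definition fixed_prefix :: "'a list \<Rightarrow> 'a list \<Rightarrow> bool" where
  "fixed_prefix u v \<longleftrightarrow> reduced (u @ v) \<and> 
    (\<forall>ws. reduced ws \<and> word_prod ws = word_prod (u @ v) \<longrightarrow> (\<exists>v'. ws = u @ v'))"

lemma fixed_prefix_Nil [simp]: "fixed_prefix [] v \<longleftrightarrow> reduced v"
  by (simp add: fixed_prefix_def)

text \<open>Every left descent begins some reduced word, so a common first letter means that there
  is only one left descent.\<close>

lemma fixed_prefix_Cons:
  "fixed_prefix (a # u) v \<longleftrightarrow>
    reduced (a # u @ v) \<and> left_descents (word_prod (a # u @ v)) = {a} \<and> fixed_prefix u v"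
proof
  assume *: "fixed_prefix (a # u) v"
  then have red: "reduced (a # u @ v)" by (simp add: fixed_prefix_def)
  then have l: "a \<in> S" "u @ v \<in> lists S" by (auto simp: reduced_def)
  let ?w = "word_prod (a # u @ v)"
  have wc: "?w \<in> carrier W" using l by (simp del: append_in_lists_conv)
  have "b = a" if b: "b \<in> left_descents ?w" for b
  proof -
    have "b \<in> S" using b left_descents_gens by blast
    then have "reduced (b # red_word (b \<otimes> ?w))" "word_prod (b # red_word (b \<otimes> ?w)) = ?w"
      using reduced_ConsI[OF wc b] red_word[of "b \<otimes> ?w"] wc by simp_all
    then obtain v' where "b # red_word (b \<otimes> ?w) = (a # u) @ v'"
      using * unfolding fixed_prefix_def by auto
    then show "b = a" by simp
  qed
  moreover have "a \<in> left_descents ?w" using reduced_hd_descent[OF red] by simp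
  ultimately have "left_descents ?w = {a}" by blast
  moreover have "fixed_prefix u v"
    unfolding fixed_prefix_def
  proof (intro conjI allI impI)
    show "reduced (u @ v)" using reduced_ConsD[OF red] by simp
    fix ws assume ws: "reduced ws \<and> word_prod ws = word_prod (u @ v)"
    then have "reduced (a # ws)" "word_prod (a # ws) = word_prod ((a # u) @ v)"
      using red reduced_ConsD(1)[OF red] by (auto simp: reduced_def)
    then obtain v' where "a # ws = (a # u) @ v'" using * unfolding fixed_prefix_def by blast
    then show "\<exists>v'. ws = u @ v'" by auto
  qed
  ultimately show "reduced (a # u @ v) \<and> left_descents (word_prod (a # u @ v)) = {a} \<and> fixed_prefix u v"
    using red by blast
next
  assume *: "reduced (a # u @ v) \<and> left_descents (word_prod (a # u @ v)) = {a} \<and> fixed_prefix u v"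
  then have l: "a \<in> S" "u @ v \<in> lists S" by (auto simp: reduced_def)
  show "fixed_prefix (a # u) v"
    unfolding fixed_prefix_def
  proof (intro conjI allI impI)
    show "reduced ((a # u) @ v)" using * by simp
    fix ws assume ws: "reduced ws \<and> word_prod ws = word_prod ((a # u) @ v)"
    show "\<exists>v'. ws = (a # u) @ v'"
    proof (cases ws)
      case Nil
      then have "word_prod (a # u @ v) = \<one>" using ws by simp
      then show ?thesis using * by (simp del: word_prod_Cons)
    next
      case (Cons b zs)
      then have "b \<in> left_descents (word_prod ws)" using reduced_hd_descent[of b zs] ws by simp
      then have b: "b = a" using ws * by simp
      have z: "reduced zs" "zs \<in> lists S" using reduced_ConsD[of b zs] reduced_lists ws Cons by auto
      have "a \<otimes> word_prod zs = a \<otimes> word_prod (u @ v)" using ws Cons b by simp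
      then have "word_prod zs = word_prod (u @ v)" using l z by (simp del: append_in_lists_conv word_prod_append)
      then show ?thesis using * z Cons b unfolding fixed_prefix_def by auto
    qed
  qed
qed

lemma fixed_prefix_appendD: "fixed_prefix (u @ y) v \<Longrightarrow> fixed_prefix y v"
  by (induction u) (auto simp: fixed_prefix_Cons)

lemma tail_mult_left:
  assumes "x \<in> carrier W" "left_descents x = A" "tail A u"
  shows "left_descents (word_prod (rev u) \<otimes> x) = ends A u" "len (word_prod (rev u) \<otimes> x) = len x + length u"
proof -
  have u: "u \<in> lists S" using tail_lists assms by blast
  have e: "inv (inv x \<otimes> word_prod u) = word_prod (rev u) \<otimes> x" 
    using u assms(1) by (simp add: inv_mult_group word_prod_rev)
  have c: "inv x \<otimes> word_prod u \<in> carrier W" using u assms(1) by simp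
  have R: "right_descents (inv x) = A" using assms by (simp add: right_descents_inv)
  note t = tail_mult[OF inv_closed[OF assms(1)] R assms(3)]
  show "left_descents (word_prod (rev u) \<otimes> x) = ends A u"
    using left_descents_inv[OF c] t(1) unfolding e by simp
  show "len (word_prod (rev u) \<otimes> x) = len x + length u"
    using len_inv[OF c] t(2) assms(1) unfolding e by simp
qed

text \<open>Built from v outwards, each letter of u must become the only left descent, which by
  \<open>left_descents_mult\<close> means that it commutes with none of the previous ones.\<close>

lemma fixed_prefix_iff_tail:
  assumes "reduced v"
  shows "fixed_prefix u v \<longleftrightarrow> tail (left_descents (word_prod v)) (rev u)"
proof (induction u)
  case (Cons a u)
  let ?A = "left_descents (word_prod v)" and ?w = "word_prod (u @ v)"
  have v: "v \<in> lists S" using assms reduced_lists by blast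
  show ?case
  proof (cases "tail ?A (rev u) \<and> a \<in> S")
    case False
    then show ?thesis using Cons by (auto simp: fixed_prefix_Cons tail_snoc reduced_def)
  next
    case True
    then have u: "u \<in> lists S" "a \<in> S" "fixed_prefix u v" using tail_lists[of ?A "rev u"] Cons by auto
    have w: "?w = word_prod (rev (rev u)) \<otimes> word_prod v" using u v by simp
    have wc: "?w \<in> carrier W" using u v by simp
    note t = tail_mult_left[OF word_prod_closed[OF v] refl, of "rev u", folded w]
    have lw: "left_descents ?w = ends ?A (rev u)" "len ?w = length (u @ v)"
      using t True assms by (auto simp: reduced_def)
    have red: "reduced (a # u @ v) \<longleftrightarrow> a \<notin> left_descents ?w"
    proof
      assume "reduced (a # u @ v)"
      from reduced_ConsD(2)[OF this] show "a \<notin> left_descents ?w" using wc by (auto simp: left_descents_iff)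
    next
      assume "a \<notin> left_descents ?w"
      then have "len (a \<otimes> ?w) = Suc (len ?w)"
        by (rule len_left_ascent[OF wc u(2)])
      then show "reduced (a # u @ v)" using lw(2) u v by (simp add: reduced_def)
    qed
    have "a \<notin> left_descents ?w \<and> left_descents (a \<otimes> ?w) = {a} \<longleftrightarrow> (\<forall>t \<in> left_descents ?w. a \<otimes> t \<noteq> t \<otimes> a)"
    proof (cases "a \<in> left_descents ?w")
      case False
      show ?thesis unfolding left_descents_mult[OF wc u(2) False] using False by auto
    qed auto
    then show ?thesis using u(2,3) True red lw(1) by (simp add: fixed_prefix_Cons tail_snoc)
  qed
qed (use assms in simp)

text \<open>Comparing lengths forces the subword u to stand at the beginning. Conversely, a second
  reduced word for u would give a reduced word not beginning with u, so u is a line.\<close>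

lemma fixed_line_prefix: "fixed_line [] u v \<longleftrightarrow> fixed_prefix u v"
proof
  assume *: "fixed_line [] u v"
  then have red: "reduced (u @ v)" by (simp add: fixed_line_def)
  show "fixed_prefix u v" unfolding fixed_prefix_def
  proof (intro conjI allI impI red)
    fix ws assume ws: "reduced ws \<and> word_prod ws = word_prod (u @ v)"
    then obtain w0 w1 where w: "ws = w0 @ u @ w1" "word_prod w1 = word_prod v"
      using * unfolding fixed_line_def by auto
    have "length ws = length (u @ v)" using ws red by (simp add: reduced_def)
    moreover have "length v \<le> length w1"
      using reduced_appendD[of "w0 @ u" w1] reduced_appendD(2)[OF red] ws w by (auto simp: reduced_def)
    moreover have "length ws = length w0 + length u + length w1" using w(1) by simp
    ultimately have "length w0 = 0" unfolding length_append by linarith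
    then show "\<exists>v'. ws = u @ v'" using w(1) by simp
  qed
next
  assume *: "fixed_prefix u v"
  then have red: "reduced (u @ v)" by (simp add: fixed_prefix_def)
  then have uv: "u \<in> lists S" "v \<in> lists S" "reduced u" using reduced_appendD(1)[OF red] by (auto simp: reduced_def)
  have "ws = u" if ws: "reduced ws" "word_prod ws = word_prod u" for ws
  proof -
    have l: "ws \<in> lists S" "length ws = length u" using ws uv(3) by (auto simp: reduced_def)
    then have "reduced (ws @ v)" "word_prod (ws @ v) = word_prod (u @ v)"
      using red ws uv by (auto simp: reduced_def)
    then obtain v' where "ws @ v = u @ v'" using * unfolding fixed_prefix_def by blast
    then show ?thesis using l(2) by simp
  qed
  then have "is_line (word_prod u)" using uv by (auto simp: is_line_def)
  moreover have "\<exists>w0' w1'. ws = w0' @ u @ w1' \<and> word_prod w0' = word_prod [] \<and> word_prod w1' = word_prod v"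
    if ws: "reduced ws" "word_prod ws = word_prod ([] @ u @ v)" for ws
  proof -
    obtain v' where v': "ws = u @ v'" using * ws unfolding fixed_prefix_def by auto
    then have "v' \<in> lists S" using ws(1) by (auto simp: reduced_def)
    then have "word_prod v' = word_prod v" using ws(2) uv v' by simp
    then show ?thesis using v' by (intro exI[of _ "[]"] exI[of _ v']) simp
  qed
  ultimately show "fixed_line [] u v" using red unfolding fixed_line_def by auto
qed

lemma fixed_line_suffix: "fixed_line w0 u [] \<longleftrightarrow> fixed_prefix (rev u) (rev w0)"
proof
  assume *: "fixed_line w0 u []"
  then have red: "reduced (w0 @ u)" by (simp add: fixed_line_def)
  show "fixed_prefix (rev u) (rev w0)" unfolding fixed_prefix_def
  proof (intro conjI allI impI)
    show "reduced (rev u @ rev w0)" using reduced_rev(1)[OF red] by simp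
    fix ws assume ws: "reduced ws \<and> word_prod ws = word_prod (rev u @ rev w0)"
    then have "word_prod (rev ws) = inv (word_prod (rev (w0 @ u)))" "reduced (rev ws)" using reduced_rev by auto
    then have "reduced (rev ws)" "word_prod (rev ws) = word_prod (w0 @ u)"
      using reduced_rev[OF reduced_rev(1)[OF red]] by (simp_all del: rev_append)
    then obtain a b where w: "rev ws = a @ u @ b" "word_prod a = word_prod w0"
      using * unfolding fixed_line_def by auto
    have "length ws = length (w0 @ u)"
      using \<open>reduced (rev ws)\<close> \<open>word_prod (rev ws) = word_prod (w0 @ u)\<close> red by (simp add: reduced_def)
    moreover have "length w0 \<le> length a"
      using reduced_appendD(1)[of a "u @ b"] reduced_appendD(1)[OF red] \<open>reduced (rev ws)\<close> w by (auto simp: reduced_def)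
    moreover have "length ws = length a + length u + length b" using arg_cong[OF w(1), of length] by simp
    ultimately have "length b = 0" unfolding length_append by linarith
    then have "rev ws = a @ u" using w(1) by simp
    then have "ws = rev u @ rev a" by (metis rev_append rev_rev_ident)
    then show "\<exists>v'. ws = rev u @ v'" by blast
  qed
next
  assume *: "fixed_prefix (rev u) (rev w0)"
  then have "reduced (rev (w0 @ u))" by (simp add: fixed_prefix_def)
  from reduced_rev(1)[OF this] have red: "reduced (w0 @ u)" by simp
  then have uv: "u \<in> lists S" "w0 \<in> lists S" "reduced u" using reduced_appendD(2)[OF red] by (auto simp: reduced_def)
  have suffix: "\<exists>a. ws = a @ u" if ws: "reduced ws" "word_prod ws = word_prod (w0 @ u)" for ws
  proof -
    have "reduced (rev ws)" "word_prod (rev ws) = word_prod (rev u @ rev w0)"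
      using reduced_rev[OF ws(1)] reduced_rev(2)[OF red] ws(2) by simp_all
    then obtain v' where "rev ws = rev u @ v'" using * unfolding fixed_prefix_def by blast
    then have "ws = rev v' @ u" by (metis rev_append rev_rev_ident)
    then show ?thesis by blast
  qed
  have "ws = u" if ws: "reduced ws" "word_prod ws = word_prod u" for ws
  proof -
    have l: "ws \<in> lists S" "length ws = length u" using ws uv(3) by (auto simp: reduced_def)
    then have "reduced (w0 @ ws)" "word_prod (w0 @ ws) = word_prod (w0 @ u)"
      using red ws uv by (auto simp: reduced_def)
    then obtain a where "w0 @ ws = a @ u" using suffix by blast
    then show ?thesis using l(2) by simp
  qed
  then have "is_line (word_prod u)" using uv by (auto simp: is_line_def)
  moreover have "\<exists>w0' w1'. ws = w0' @ u @ w1' \<and> word_prod w0' = word_prod w0 \<and> word_prod w1' = word_prod []"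
    if ws: "reduced ws" "word_prod ws = word_prod (w0 @ u @ [])" for ws
  proof -
    obtain a where a: "ws = a @ u" using suffix ws by auto
    then have "a \<in> lists S" using ws(1) by (auto simp: reduced_def)
    then have "word_prod a = word_prod w0" using ws(2) uv a by simp
    then show ?thesis using a by (intro exI[of _ a] exI[of _ "[]"]) simp
  qed
  ultimately show "fixed_line w0 u []" using red unfolding fixed_line_def by auto
qed

lemma segment_prefix_iff:
  assumes "reduced v" "v \<noteq> []"
  shows "segment [] u v \<longleftrightarrow> commuting_pair (left_descents (word_prod v)) \<and> tail (left_descents (word_prod v)) (rev u)"
proof
  let ?A = "left_descents (word_prod v)"
  assume *: "segment [] u v"
  then have fp: "tail ?A (rev u)" using fixed_prefix_iff_tail[OF assms(1)] fixed_line_prefix by (auto simp: segment_def)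
  obtain c v' where v: "v = c # v'" using assms(2) by (cases v) auto
  have l: "c \<in> S" "v' \<in> lists S" using assms(1) v by (auto simp: reduced_def)
  have v': "reduced v'" "c \<notin> left_descents (word_prod v')" "word_prod v' \<in> carrier W"
    using reduced_ConsD[of c v'] assms v l by (auto simp: left_descents_iff)
  have cA: "c \<in> ?A" using reduced_hd_descent[of c v'] assms v by simp
  \<comment> \<open>With a single left descent c of v, the word u could be lengthened by c, against
    its maximality.\<close>
  have "?A \<noteq> {c}"
  proof
    assume A: "?A = {c}"
    have "\<forall>t \<in> left_descents (word_prod v'). c \<otimes> t \<noteq> t \<otimes> c"
      using left_descents_mult[OF v'(3) l(1) v'(2)] A v v'(2) by auto
    then have "tail (left_descents (word_prod v')) (rev (u @ [c]))" using fp A l by simp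
    then have "fixed_line [] (u @ [c]) v'" using fixed_prefix_iff_tail[OF v'(1)] fixed_line_prefix by blast
    then show False using * v unfolding segment_def by (metis append.left_neutral append_Cons append_Nil2 not_Cons_self2)
  qed
  moreover have "word_prod v \<in> carrier W" using reduced_lists[OF assms(1)] by simp
  ultimately have "commuting_pair ?A"
    using left_descents_cases[of "word_prod v"] cA unfolding commuting_pair_def
    by (metis left_descents_one empty_iff singletonD)
  then show "commuting_pair ?A \<and> tail ?A (rev u)" using fp by blast
next
  let ?A = "left_descents (word_prod v)"
  assume *: "commuting_pair ?A \<and> tail ?A (rev u)"
  then have "fixed_line [] u v" using fixed_prefix_iff_tail[OF assms(1)] fixed_line_prefix by blast
  moreover have "x = [] \<and> y = []" if h: "[] = a @ x" "v = y @ b" "fixed_line a (x @ u @ y) b" for a x y b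
  proof -
    \<comment> \<open>A first letter of v shared by all its reduced words would be the only left
      descent of v, but v has two.\<close>
    have "fixed_prefix y b" using fixed_prefix_appendD h fixed_line_prefix by auto
    then have "y = []" 
      using * h(2) by (cases y) (auto simp: fixed_prefix_Cons commuting_pair_def doubleton_eq_iff)
    then show ?thesis using h by simp
  qed
  ultimately show "segment [] u v" unfolding segment_def by blast
qed

text \<open>Reversal reduces this to prefixes in front of t s. The two left descents of t s also
  stop any extension of u into the pair, so maximality is automatic.\<close>

lemma segment_suffix_iff:
  assumes "s \<in> S" "t \<in> S" "s \<noteq> t" "s \<otimes> t = t \<otimes> s"
  shows "segment [s, t] u [] \<longleftrightarrow> tail {s, t} u"
proof -
  have rs: "reduced [t, s]" "word_prod [t, s] = t \<otimes> s" 
    using pair_descents(3)[of t s] assms by (auto simp: reduced_def)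
  have L: "left_descents (word_prod [t, s]) = {s, t}" 
    using pair_descents(2)[of t s] assms rs by auto
  have fl: "fixed_line [s, t] u [] \<longleftrightarrow> tail {s, t} u"
    using fixed_prefix_iff_tail[OF rs(1), of "rev u"] L fixed_line_suffix[of "[s, t]" u] by simp
  have "x = []" if h: "[s, t] = a @ x" "fixed_line a (x @ u) []" for a x
  proof (rule ccontr)
    assume "x \<noteq> []"
    have "fixed_prefix (rev u @ rev x) (rev a)" using h(2) by (simp add: fixed_line_suffix)
    then have fp: "fixed_prefix (rev x) (rev a)" by (rule fixed_prefix_appendD)
    obtain c z where z: "rev x = c # z" using \<open>x \<noteq> []\<close> by (cases "rev x") auto
    have "rev x @ rev a = [t, s]" using arg_cong[OF h(1), of rev] by simp
    then show False using fp L assms(3) unfolding z fixed_prefix_Cons by (auto simp: doubleton_eq_iff)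
  qed
  then show ?thesis unfolding segment_def fl by auto
qed

text \<open>The normal form of the inverse of w, read backwards: x is the inverted head, and the
  letters in front of it form a reversed tail.\<close>

definition root_of :: "'a \<Rightarrow> 'a \<Rightarrow> bool" where
  "root_of w x \<longleftrightarrow> w = \<one> \<and> x = \<one> \<or> x \<in> carrier W \<and> is_head (inv x) \<and>
     (\<exists>u. tail (left_descents x) u \<and> w = word_prod (rev u) \<otimes> x)"

text \<open>
  The root of \<open>w\<close> is reached by removing the only left descent for as long as there is just one and the
  length exceeds \<open>1\<close>. The left precells are the fibers of this map.
\<close>

definition root :: "'a \<Rightarrow> 'a" where
  "root w = (THE x. root_of w x)"

lemma root_of_inv:
  assumes "w \<in> carrier W" "w \<noteq> \<one>"
  shows "root_of w x \<longleftrightarrow> x \<in> carrier W \<and> is_head (inv x) \<and>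
    (\<exists>u. tail (right_descents (inv x)) u \<and> inv w = inv x \<otimes> word_prod u)"
proof -
  have "w = word_prod (rev u) \<otimes> x \<longleftrightarrow> inv w = inv x \<otimes> word_prod u" if "u \<in> lists S" "x \<in> carrier W" for u
  proof -
    have "inv (word_prod (rev u) \<otimes> x) = inv x \<otimes> word_prod u"
      using that by (simp add: inv_mult_group word_prod_rev)
    then show ?thesis using inv_inj assms(1) that by (metis inv_inv m_closed word_prod_closed rev_in_lists_iff)
  qed
  then have "(tail (left_descents x) u \<and> w = word_prod (rev u) \<otimes> x) \<longleftrightarrow>
      (tail (right_descents (inv x)) u \<and> inv w = inv x \<otimes> word_prod u)" if "x \<in> carrier W" for u
    using tail_lists[of "left_descents x" u] that by (auto simp: right_descents_inv)
  then show ?thesis using assms(2) unfolding root_of_def by blast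
qed

lemma root_of_exists: 
  assumes "w \<in> carrier W" shows "\<exists>x. root_of w x"
proof (cases "w = \<one>")
  case False
  then obtain x u where "is_head x" "tail (right_descents x) u" "inv w = x \<otimes> word_prod u"
    using normal_form_exists[of "inv w"] assms inv_eq_1_iff by auto
  then have "root_of w (inv x)" using root_of_inv[OF assms False] is_head_closed by auto
  then show ?thesis by blast
next
  case True
  then have "root_of w \<one>" by (simp add: root_of_def)
  then show ?thesis by blast
qed

lemma root_of_unique:
  assumes "w \<in> carrier W" "root_of w x" "root_of w y" shows "x = y"
proof (cases "w = \<one>")
  case True
  have "z = \<one>" if z: "root_of \<one> z" for z
  proof (rule ccontr)
    assume "z \<noteq> \<one>"
    then obtain u where u: "z \<in> carrier W" "tail (left_descents z) u" "\<one> = word_prod (rev u) \<otimes> z"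
      using z by (auto simp: root_of_def)
    then have "len \<one> = len z + length u" using tail_mult_left(2)[OF u(1) refl u(2)] by (simp only:)
    then have "len z = 0" by simp
    then show False using u(1) \<open>z \<noteq> \<one>\<close> by simp
  qed
  then show ?thesis using assms True by blast
next
  case False
  then show ?thesis using assms(2,3) normal_form_unique[of "inv x" "inv y"] 
    unfolding root_of_inv[OF assms(1) False] by (metis inv_inv)
qed

lemma root: "w \<in> carrier W \<Longrightarrow> root_of w (root w)"
  unfolding root_def using root_of_exists root_of_unique by (metis theI)

lemma root_eqI: "w \<in> carrier W \<Longrightarrow> root_of w x \<Longrightarrow> root w = x"
  using root root_of_unique by blast

lemma root_of_closed: "root_of w x \<Longrightarrow> x \<in> carrier W"
  by (auto simp: root_of_def)

lemma root_closed [simp]: "w \<in> carrier W \<Longrightarrow> root w \<in> carrier W"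
  using root root_of_closed by blast

lemma root_one [simp]: "root \<one> = \<one>"
  by (rule root_eqI) (auto simp: root_of_def)

lemma root_head: "x \<in> carrier W \<Longrightarrow> is_head (inv x) \<Longrightarrow> root x = x"
  by (rule root_eqI) (auto simp: root_of_def intro!: exI[of _ "[]"])

lemma is_head_inv_iff: "x \<in> carrier W \<Longrightarrow> is_head (inv x) \<longleftrightarrow> x \<in> S \<or> commuting_pair (left_descents x)"
proof -
  assume x: "x \<in> carrier W"
  have "inv x \<in> S \<longleftrightarrow> x \<in> S" using x by (metis gen_inv inv_inv)
  then show ?thesis using x by (auto simp: is_head_def right_descents_inv)
qed

lemma root_cases:
  assumes "w \<in> carrier W"
  obtains "w = \<one>" "root w = \<one>" 
  | "root w \<in> S" | "commuting_pair (left_descents (root w))"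
  using root[OF assms] is_head_inv_iff[of "root w"] by (auto simp: root_of_def)

lemma root_root [simp]: "w \<in> carrier W \<Longrightarrow> root (root w) = root w"
  using root[of w] root_head[of "root w"] by (auto simp: root_of_def)

lemma root_shortest:
  assumes "w \<in> carrier W" "w \<noteq> root w" shows "len (root w) < len w"
proof -
  have "root_of w (root w)" using root assms by blast
  then obtain u where u: "tail (left_descents (root w)) u" "w = word_prod (rev u) \<otimes> root w"
    using assms by (auto simp: root_of_def)
  then have "u \<noteq> []" using assms by auto
  then have "0 < length u" by simp
  moreover have "len w = len (root w) + length u"
    using tail_mult_left(2)[OF root_closed[OF assms(1)] refl u(1)] u(2) by simp
  ultimately show ?thesis by simp
qed

lemma left_equiv_refl: "w \<in> carrier W \<Longrightarrow> left_equiv w w"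
  by (simp add: left_equiv_def)

text \<open>Each letter in front of the root is, when its turn comes, the only left descent and can
  be removed by \<open>left_equiv_strip\<close>.\<close>

lemma left_equiv_root:
  assumes "w \<in> carrier W" shows "left_equiv w (root w)"
proof -
  have *: "left_equiv (word_prod (rev u) \<otimes> x) x" if "x \<in> carrier W" "x \<noteq> \<one>" "tail (left_descents x) u" for x u
    using that(3)
  proof (induction u rule: rev_induct)
    case Nil then show ?case using that left_equiv_refl by simp
  next
    case (snoc d u)
    then have u: "tail (left_descents x) u" "d \<in> S" "u \<in> lists S" using tail_lists[of _ u] by (auto simp: tail_snoc)
    let ?w = "word_prod (rev u) \<otimes> x" and ?w' = "word_prod (rev (u @ [d])) \<otimes> x"
    have w: "?w \<in> carrier W" "?w' = d \<otimes> ?w" using that u by (auto simp: m_assoc)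
    have "left_descents ?w' = {d}" using tail_mult_left(1)[OF that(1) refl snoc.prems] by simp
    moreover have "d \<otimes> ?w' = ?w" using w u by simp
    moreover have "?w \<noteq> \<one>"
    proof -
      have "len x \<noteq> 0" using that by simp
      then have "len ?w \<noteq> 0" using tail_mult_left(2)[OF that(1) refl u(1)] by simp
      then show ?thesis by auto
    qed
    ultimately have "left_equiv ?w ?w'" using left_equiv_strip[of ?w' d] w u by simp
    then show ?case using left_equiv_trans[OF left_equiv_sym snoc.IH[OF u(1)]] by blast
  qed
  show ?thesis
  proof (cases "w = \<one>")
    case False
    have "root_of w (root w)" using root assms by blast
    then obtain u where u: "tail (left_descents (root w)) u" "w = word_prod (rev u) \<otimes> root w" "is_head (inv (root w))"
      using False by (auto simp: root_of_def)
    then have "root w \<noteq> \<one>" using is_head_neq_one[OF u(3)] by auto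
    then show ?thesis using *[of "root w" u] u assms by simp
  qed (simp add: left_equiv_def)
qed

end

section \<open>Precells and cells of right-angled systems\<close>

context right_angled_system
begin

text \<open>The unique reduced word of a line is a fixed prefix with nothing behind it, so its
  consecutive letters do not commute and the root is its last letter. The set {} in
  \<open>tail {}\<close> leaves that last letter unrestricted.\<close>

lemma is_line_root:
  assumes "is_line w" "right_descents w = {s}" shows "root w = s" "s \<in> S"
proof -
  have w: "w \<in> carrier W" "w \<noteq> \<one>" using assms by (auto simp: is_line_def)
  let ?ws = "red_word w"
  have "fixed_prefix ?ws []"
    using assms(1) red_word[OF w(1)] unfolding fixed_prefix_def is_line_def by (metis append_Nil2)
  then have t: "tail {} (rev ?ws)" using fixed_prefix_iff_tail[of "[]" ?ws] by (simp add: reduced_def)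
  have "?ws \<noteq> []" using red_word(2)[OF w(1)] w(2) by auto
  then obtain u d where d: "?ws = u @ [d]" by (cases ?ws rule: rev_cases) auto
  have dS: "d \<in> S" "tail {d} (rev u)" using t d by auto
  have u: "u \<in> lists S" using red_word(3)[OF w(1)] d by simp
  have "w = word_prod (rev (rev u)) \<otimes> d" using red_word(2)[OF w(1)] d u dS by simp
  moreover have "is_head (inv d)" using dS by (simp add: is_head_def)
  ultimately have "root_of w d" unfolding root_of_def using dS by (metis gen_closed left_descents_gen)
  then have r: "root w = d" using root_eqI w by blast
  have "d \<notin> right_descents (word_prod u)" using reduced_snocD(3) red_word(1)[OF w(1)] d by simp
  then have "d \<in> right_descents (word_prod u \<otimes> d)" using right_descents_mult[of "word_prod u" d] u dS by simp
  then have "d = s" using assms(2) \<open>w = word_prod (rev (rev u)) \<otimes> d\<close> by simp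
  then show "root w = s" "s \<in> S" using r dS by auto
qed

lemma root_segment:
  assumes "reduced (u @ v)" "commuting_pair (left_descents (word_prod v))" "u = [] \<or> segment [] u v"
  shows "root (word_prod (u @ v)) = word_prod v"
proof -
  have v: "reduced v" "v \<in> lists S" "u \<in> lists S"
    using reduced_appendD[OF assms(1)] reduced_lists by auto
  then have vc: "word_prod v \<in> carrier W" by simp
  have "v \<noteq> []" using assms(2) by (auto simp: commuting_pair_def)
  then have t: "tail (left_descents (word_prod v)) (rev u)" using assms(3) segment_prefix_iff[OF v(1)] by auto
  have "is_head (inv (word_prod v))" using assms(2) vc by (simp add: is_head_inv_iff)
  moreover have "word_prod (u @ v) = word_prod (rev (rev u)) \<otimes> word_prod v" using v by simp
  ultimately have "root_of (word_prod (u @ v)) (word_prod v)"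
    using t vc unfolding root_of_def by blast
  then show ?thesis using root_eqI v by simp
qed

lemma reduced_snocI:
  assumes "w \<in> carrier W" "t \<in> right_descents w"
  shows "reduced (red_word (w \<otimes> t) @ [t])" "word_prod (red_word (w \<otimes> t) @ [t]) = w"
proof -
  have t: "t \<in> S" using assms(2) right_descents_gens by blast
  then have r: "word_prod (red_word (w \<otimes> t)) = w \<otimes> t" "red_word (w \<otimes> t) \<in> lists S"
    "length (red_word (w \<otimes> t)) = len (w \<otimes> t)" using red_word[of "w \<otimes> t"] assms(1) by auto
  then show "word_prod (red_word (w \<otimes> t) @ [t]) = w" using t assms(1) by simp
  then show "reduced (red_word (w \<otimes> t) @ [t])"
    using r t len_right_descent[OF assms] by (simp add: reduced_def)
qed

lemma line_of_root:
  assumes "w \<in> carrier W" "root w = s" "s \<in> S"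
  shows "\<exists>u. reduced (u @ [s]) \<and> word_prod (u @ [s]) = w" "is_line w" "right_descents w = {s}"
proof -
  have "root_of w s" using root[OF assms(1)] assms(2) by simp
  then obtain u where u: "tail {s} u" "w = word_prod (rev u) \<otimes> s"
    using assms(3) gen_neq_one by (auto simp: root_of_def)
  have uS: "u \<in> lists S" using tail_lists u by blast
  have w: "w = word_prod (rev u @ [s])" using u uS assms(3) by simp
  have "reduced [s]" using assms(3) by (simp add: reduced_def)
  then have "fixed_prefix (rev u) [s]" using fixed_prefix_iff_tail[of "[s]" "rev u"] u assms(3) by simp
  then have red: "reduced (rev u @ [s])" by (simp add: fixed_prefix_def)
  then show "\<exists>u. reduced (u @ [s]) \<and> word_prod (u @ [s]) = w" using w by blast
  \<comment> \<open>All reduced words of w agree with this one, so w is a line, and any right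
    descent has to be its last letter.\<close>
  have fp: "fixed_prefix (rev u @ [s]) []"
    using fixed_prefix_iff_tail[of "[]" "rev u @ [s]"] u assms(3) by (simp add: reduced_def)
  then show "is_line w" using fixed_line_prefix[of "rev u @ [s]" "[]"] w unfolding fixed_line_def by blast
  have "t = s" if t: "t \<in> right_descents w" for t
  proof -
    obtain v' where "red_word (w \<otimes> t) @ [t] = (rev u @ [s]) @ v'"
      using fp reduced_snocI[OF assms(1) t] w unfolding fixed_prefix_def by auto
    moreover have "length (red_word (w \<otimes> t) @ [t]) = length (rev u @ [s])"
      using reduced_snocI[OF assms(1) t] red w unfolding reduced_def by metis
    ultimately show "t = s" by simp
  qed
  moreover have "w \<noteq> \<one>"
  proof
    assume "w = \<one>"
    then have "s = \<one>" using assms(2) by simp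
    then show False using gen_neq_one[OF assms(3)] by blast
  qed
  then have "right_descents w \<noteq> {}" by (rule right_descents_nonempty[OF assms(1)])
  ultimately show "right_descents w = {s}" by blast
qed

text \<open>In clause (a) a segment in front of w_L gives w_L two commuting left descents, so w_L is
  the root of both elements; in clause (b) both are lines and the root is their last letter. In this
  form it is plain that an equivalence relation is at hand.\<close>

lemma lp_rel_iff: "lp_rel w1 w2 \<longleftrightarrow> w1 \<in> carrier W \<and> w2 \<in> carrier W \<and> root w1 = root w2"
proof
  assume lp: "lp_rel w1 w2"
  show "w1 \<in> carrier W \<and> w2 \<in> carrier W \<and> root w1 = root w2"
  proof (cases "w1 = \<one> \<and> w2 = \<one>")
    case False
    then obtain u1 u2 v where v: "word_prod v \<noteq> \<one>"
      "reduced (u1 @ v)" "word_prod (u1 @ v) = w1" "reduced (u2 @ v)" "word_prod (u2 @ v) = w2"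
      "len (word_prod v) > 1 \<Longrightarrow> (u1 = [] \<or> segment [] u1 v) \<and> (u2 = [] \<or> segment [] u2 v)"
      "len (word_prod v) = 1 \<Longrightarrow> is_line w1 \<and> is_line w2 \<and>
         right_descents w1 = {word_prod v} \<and> right_descents w2 = {word_prod v}"
      using lp unfolding lp_rel_def by blast
    have c: "w1 \<in> carrier W" "w2 \<in> carrier W"
      using v(3,5) reduced_lists[OF v(2)] reduced_lists[OF v(4)] word_prod_closed by blast+
    have vr: "reduced v" "word_prod v \<in> carrier W" "v \<noteq> []"
      using reduced_appendD[OF v(2)] reduced_lists v(1) by auto
    then have "len (word_prod v) \<noteq> 0" using v(1) by simp
    then consider "len (word_prod v) = 1" | "len (word_prod v) > 1" by linarith
    then have "root w1 = root w2"
    proof cases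
      case 1
      then show ?thesis using v(7) is_line_root(1) by metis
    next
      case 2
      show ?thesis
      \<comment> \<open>Two empty words put no restriction on w_L, but then both elements
        coincide.\<close>
      proof (cases "u1 = [] \<and> u2 = []")
        case True then show ?thesis using v by simp
      next
        case False
        then have "commuting_pair (left_descents (word_prod v))"
          using v(6)[OF 2] segment_prefix_iff[OF vr(1,3)] by blast
        then show ?thesis using root_segment v(2-5) v(6)[OF 2] by metis
      qed
    qed
    then show ?thesis using c by blast
  qed simp
next
  assume *: "w1 \<in> carrier W \<and> w2 \<in> carrier W \<and> root w1 = root w2"
  then have c: "w1 \<in> carrier W" "w2 \<in> carrier W" and eq: "root w2 = root w1" by auto
  show "lp_rel w1 w2"
  proof (rule root_cases[OF c(1)])
    assume "w1 = \<one>" "root w1 = \<one>"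
    moreover from this have "w2 = \<one>"
      using eq gen_neq_one[of \<one>] by (auto intro: root_cases[OF c(2)] simp: commuting_pair_def)
    ultimately show ?thesis by (simp add: lp_rel_def)
  next
    let ?s = "root w1"
    assume s: "?s \<in> S"
    note l1 = line_of_root[OF c(1) refl s] and l2 = line_of_root[OF c(2) eq s]
    obtain u1 u2 where u: "reduced (u1 @ [?s])" "word_prod (u1 @ [?s]) = w1"
      "reduced (u2 @ [?s])" "word_prod (u2 @ [?s]) = w2" using l1(1) l2(1) by blast
    have ps: "word_prod [?s] = ?s" using s by simp
    have "word_prod [?s] \<noteq> \<one>" "\<not> len (word_prod [?s]) > 1" "right_descents w1 = {word_prod [?s]}" 
      "right_descents w2 = {word_prod [?s]}"
      unfolding ps using s l1 l2 by auto
    then show ?thesis unfolding lp_rel_def using u l1(2) l2(2) by blast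
  next
    let ?r = "root w1"
    assume p: "commuting_pair (left_descents ?r)"
    have rc: "?r \<in> carrier W" using c by simp
    let ?v = "red_word ?r"
    note v = red_word[OF rc]
    have pv: "commuting_pair (left_descents (word_prod ?v))" using p v by simp
    have vne: "?v \<noteq> []" using pv by (auto simp: commuting_pair_def)
    have ex: "\<exists>u. reduced (u @ ?v) \<and> word_prod (u @ ?v) = w \<and> segment [] u ?v"
      if w: "w \<in> carrier W" "root w = ?r" for w
    proof -
      have "root_of w ?r" using root[OF w(1)] w(2) by simp
      moreover have "?r \<noteq> \<one>" using p by (auto simp: commuting_pair_def)
      ultimately obtain u where u: "tail (left_descents ?r) u" "w = word_prod (rev u) \<otimes> ?r"
        unfolding root_of_def by blast
      then have seg: "segment [] (rev u) ?v" using segment_prefix_iff[OF v(1) vne] pv v(2) by simp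
      moreover from this have "reduced (rev u @ ?v)" by (simp add: segment_def fixed_line_def)
      moreover have "word_prod (rev u @ ?v) = w" using u v tail_lists[OF u(1)] by simp
      ultimately show ?thesis by blast
    qed
    have "word_prod ?v \<noteq> \<one>" using pv by (auto simp: commuting_pair_def)
    \<comment> \<open>Two left descents need length at least two, so clause (b) is vacuous and only
      the segments have to be supplied.\<close>
    moreover have "len (word_prod ?v) \<noteq> 1"
    proof
      assume "len (word_prod ?v) = 1"
      then have "length ?v = 1" using v by simp
      then obtain s where "?v = [s]" by (cases ?v) auto
      then have "word_prod ?v = s" "s \<in> S" using v(3) by auto
      then show False using pv by (auto simp: commuting_pair_def doubleton_eq_iff)
    qed
    ultimately show ?thesis unfolding lp_rel_def using ex[OF c(1) refl] ex[OF c(2) eq] by blast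
  qed
qed

section \<open>Left precells as fibers of the root map\<close>

definition fiber :: "'a \<Rightarrow> 'a set" where
  "fiber r = {y \<in> carrier W. root y = r}"

definition roots :: "'a set" where
  "roots = {r \<in> carrier W. root r = r}"

lemma root_in_roots [simp]: "w \<in> carrier W \<Longrightarrow> root w \<in> roots"
  by (simp add: roots_def)

lemma roots_closed: "r \<in> roots \<Longrightarrow> r \<in> carrier W" "r \<in> roots \<Longrightarrow> root r = r"
  by (auto simp: roots_def)

lemma left_precells_eq: "left_precells = fiber ` roots"
proof -
  have "{(w1, w2). lp_rel w1 w2} `` {w} = fiber (root w)" if "w \<in> carrier W" for w
    using that by (auto simp: lp_rel_iff fiber_def)
  then have "left_precells = (\<lambda>w. fiber (root w)) ` carrier W"
    unfolding left_precells_def quotient_def by auto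
  then show ?thesis using root_in_roots roots_closed by (auto simp: image_iff) metis+
qed

lemma shortest_fiber: 
  assumes "r \<in> roots" shows "shortest (fiber r) = r"
  unfolding shortest_def
proof (rule the_equality)
  show "r \<in> fiber r \<and> (\<forall>v\<in>fiber r. v \<noteq> r \<longrightarrow> len r < len v)"
    using assms root_shortest by (auto simp: roots_def fiber_def)
  then show "w = r" if "w \<in> fiber r \<and> (\<forall>v\<in>fiber r. v \<noteq> w \<longrightarrow> len w < len v)" for w
    using that by (metis less_asym)
qed

lemma fiber_inject: "r \<in> roots \<Longrightarrow> r' \<in> roots \<Longrightarrow> fiber r = fiber r' \<longleftrightarrow> r = r'"
  using shortest_fiber by metis

lemma precell_eq: 
  assumes "r \<in> roots" shows "precell r = fiber r"
  unfolding precell_def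
  by (rule the_equality) (use assms shortest_fiber in \<open>auto simp: left_precells_eq\<close>)

lemma gens_roots: "S \<subseteq> roots"
  using root_head by (auto simp: roots_def is_head_inv_iff)

lemma left_cells_eq: "left_cells = {{y. left_equiv w y} | w. w \<in> carrier W}"
  by (auto simp: left_cells_def quotient_def)

lemma gen_notin_translate:
  assumes "s \<in> S" "commuting_pair A" "tail A u" shows "s \<notin> translate A u"
proof
  assume "s \<in> translate A u"
  then obtain x where x: "x \<in> carrier W" "right_descents x = A" "s = x \<otimes> word_prod u"
    by (auto simp: translate_def with_right_descents_def)
  then have "is_head x" "is_head s" using assms by (auto simp: is_head_def)
  then have "s = x" using normal_form_unique[of s x "[]" u] x assms by simp
  then show False using assms(1,2) x(2) by (auto simp: commuting_pair_def doubleton_eq_iff)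
qed

lemma gen_lines_to: "s \<in> S \<Longrightarrow> s \<in> lines_to s"
  unfolding lines_to_def by (auto intro!: exI[of _ s] exI[of _ "[]"])

text \<open>The precell of a generator is already its entire class. An element equivalent to s has a
  root with right descent set {s} and, being one of these lines, a single left descent, so the root
  is s.\<close>

lemma fiber_gen: 
  assumes "s \<in> S" shows "fiber s = lines_to s"
proof (intro equalityI subsetI)
  fix y assume "y \<in> fiber s"
  then have "left_equiv s y" using left_equiv_sym left_equiv_root[of y] by (auto simp: fiber_def)
  then show "y \<in> lines_to s" using left_equiv_lines[OF assms gen_lines_to[OF assms]] by blast
next
  fix y assume y: "y \<in> lines_to s"
  have "left_equiv s y" using left_equiv_lines[OF assms gen_lines_to[OF assms]] y by blast
  then have yc: "y \<in> carrier W" using left_le_closed by (auto simp: left_equiv_def)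
  have sr: "left_equiv s (root y)" using left_equiv_trans[OF \<open>left_equiv s y\<close> left_equiv_root[OF yc]] .
  then have R: "right_descents (root y) = {s}" using left_equiv_right_descents[OF sr] assms by simp
  have "root y \<in> lines_to s" using left_equiv_lines[OF assms gen_lines_to[OF assms]] sr by blast
  then obtain x u where "root y = x \<otimes> word_prod u" "x \<in> S" "tail {x} u" unfolding lines_to_def by blast
  then have L: "left_descents (root y) = {x}" using line_left_descents by simp
  show "y \<in> fiber s"
  proof (rule root_cases[OF yc])
    assume "root y \<in> S"
    then show ?thesis using R yc by (simp add: fiber_def)
  qed (use L R in \<open>auto simp: commuting_pair_def doubleton_eq_iff\<close>)
qed

lemma word_prod_Cons2:
  "s \<in> S \<Longrightarrow> t \<in> S \<Longrightarrow> u \<in> lists S \<Longrightarrow> word_prod (s # t # u) = s \<otimes> t \<otimes> word_prod u"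
  by (simp add: m_assoc)

lemma fiber_subset_class: "fiber r \<subseteq> {y. left_equiv r y}"
  using left_equiv_sym[OF left_equiv_root] by (auto simp: fiber_def)

text \<open>Supplies the canonical representative s t u of X(A) u. As s and t commute, either can be
  written first; both are left descents, and the element is its own root.\<close>

lemma translate_head:
  assumes "commuting_pair A" "tail A u"
  obtains s t where "A = {s, t}" "s \<in> S" "t \<in> S" "s \<noteq> t" "s \<otimes> t = t \<otimes> s"
    "s \<otimes> t \<otimes> word_prod u \<in> translate A u" "s \<otimes> t \<otimes> word_prod u \<in> roots" "canonical_word (s # t # u)"
    "word_prod (s # t # u) = s \<otimes> t \<otimes> word_prod u"
proof -
  obtain s t where st: "s \<in> S" "t \<in> S" "s \<noteq> t" "s \<otimes> t = t \<otimes> s" "A = {s, t}"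
    using assms(1) by (auto simp: commuting_pair_def)
  have u: "u \<in> lists S" using tail_lists assms by blast
  let ?k = "s \<otimes> t \<otimes> word_prod u"
  note p = pair_descents[OF st(1-4)]
  have m: "s \<otimes> t \<in> with_right_descents A" using p st by (simp add: with_right_descents_def)
  then have k: "?k \<in> translate A u" by (simp add: translate_def)
  have kc: "?k \<in> carrier W" using st u by simp
  have len: "len ?k = 2 + length u" using tail_mult(2)[of "s \<otimes> t" A u] p st assms by simp
  have mem: "a \<in> left_descents (a \<otimes> b \<otimes> word_prod u)" 
    if "a \<in> S" "b \<in> S" "len (a \<otimes> b \<otimes> word_prod u) = 2 + length u" for a b
  proof -
    have "len (b \<otimes> word_prod u) \<le> Suc (length u)"
      using len_word_prod_le[of "b # u"] that u by simp
    then show ?thesis using that u by (simp add: left_descents_iff m_assoc)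
  qed
  have "{s, t} \<subseteq> left_descents ?k"
    using mem[OF st(1,2) len] mem[OF st(2,1)] len st(4) by auto
  then have "left_descents ?k = A" using left_descents_pair[OF assms(1) kc] st by simp
  then have root: "?k \<in> roots" using root_head[OF kc] kc assms(1) by (simp add: roots_def is_head_inv_iff)
  have wp: "word_prod (s # t # u) = ?k" by (rule word_prod_Cons2[OF st(1,2) u])
  then have "reduced (s # t # u)" using len st u by (simp add: reduced_def del: word_prod_Cons)
  then have cw: "canonical_word (s # t # u)"
    using st segment_suffix_iff[OF st(1-4)] assms(2) unfolding canonical_word_def by blast
  show thesis by (rule that[OF st(5,1-4) k root cw wp])
qed

lemma canonical_wordD:
  assumes "canonical_word ws"
  obtains s t u where "ws = s # t # u" "commuting_pair {s, t}" "tail {s, t} u"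
    "s \<in> S" "t \<in> S" "s \<noteq> t" "s \<otimes> t = t \<otimes> s"
    "word_prod ws \<in> translate {s, t} u" "word_prod ws = s \<otimes> t \<otimes> word_prod u"
proof -
  obtain s t u where ws: "ws = s # t # u" "s \<in> S" "t \<in> S" "s \<noteq> t" "s \<otimes> t = t \<otimes> s"
    "u = [] \<or> segment [s, t] u []"
    using assms unfolding canonical_word_def by blast
  have tl: "tail {s, t} u" using ws(6)
    by (elim disjE) (simp_all only: segment_suffix_iff[OF ws(2-5)] tail.simps)
  have cp: "commuting_pair {s, t}" using ws by (auto simp: commuting_pair_def)
  have "s \<otimes> t \<in> with_right_descents {s, t}"
    using pair_descents[OF ws(2-5)] ws by (simp add: with_right_descents_def)
  moreover have wp: "word_prod ws = s \<otimes> t \<otimes> word_prod u"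
    unfolding ws(1) by (rule word_prod_Cons2[OF ws(2,3) tail_lists[OF tl]])
  ultimately have "word_prod ws \<in> translate {s, t} u" unfolding translate_def by blast
  then show thesis by (rule that[OF ws(1) cp tl ws(2-5) _ wp])
qed

lemma canonical_precells_eq:
  "canonical_precells = {fiber (word_prod ws) | ws. canonical_word ws}"
proof (intro equalityI subsetI)
  fix \<Gamma> assume "\<Gamma> \<in> canonical_precells"
  then obtain r ws where r: "r \<in> roots" "\<Gamma> = fiber r" "canonical_word ws" "shortest \<Gamma> = word_prod ws"
    by (auto simp: canonical_precells_def left_precells_eq)
  then show "\<Gamma> \<in> {fiber (word_prod ws) | ws. canonical_word ws}" using shortest_fiber by auto
next
  fix \<Gamma> assume "\<Gamma> \<in> {fiber (word_prod ws) | ws. canonical_word ws}"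
  then obtain ws where ws: "\<Gamma> = fiber (word_prod ws)" "canonical_word ws" by blast
  then obtain s t u where stu: "ws = s # t # u" "commuting_pair {s, t}" "tail {s, t} u"
      "s \<in> S" "t \<in> S" "s \<noteq> t" "s \<otimes> t = t \<otimes> s"
    by (elim canonical_wordD)
  \<comment> \<open>The pair may come back in the other order, which does not change the
    product.\<close>
  obtain s' t' where "{s, t} = {s', t'}" "s' \<noteq> t'" "s' \<otimes> t' = t' \<otimes> s'" 
    and r: "s' \<otimes> t' \<otimes> word_prod u \<in> roots"
    using translate_head[OF stu(2,3)] by metis
  then have "s' \<otimes> t' = s \<otimes> t" using stu(7) by (auto simp: doubleton_eq_iff)
  then have "word_prod ws \<in> roots"
    unfolding stu(1) word_prod_Cons2[OF stu(4,5) tail_lists[OF stu(3)]] using r by simp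
  then show "\<Gamma> \<in> canonical_precells"
    using ws shortest_fiber by (auto simp: canonical_precells_def left_precells_eq)
qed

lemma canonical_word_root: "canonical_word ws \<Longrightarrow> word_prod ws \<in> roots"
proof -
  assume c: "canonical_word ws"
  then have "fiber (word_prod ws) \<in> canonical_precells" unfolding canonical_precells_eq by blast
  then obtain r where r: "r \<in> roots" "fiber (word_prod ws) = fiber r"
    by (auto simp: canonical_precells_def left_precells_eq)
  have "word_prod ws \<in> carrier W"
    using c reduced_lists word_prod_closed unfolding canonical_word_def by blast
  moreover have "r \<in> fiber (word_prod ws)" unfolding r(2) using r(1) by (simp add: fiber_def roots_def)
  ultimately show "word_prod ws \<in> roots" using r(1) by (simp add: fiber_def roots_def)
qed

text \<open>Every element is equivalent to its root, so the precells whose roots are equivalent to r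
  together make up the class of r.\<close>

lemma precell_class:
  assumes "r \<in> roots"
  shows "precell_equiv `` {fiber r} = fiber ` {r' \<in> roots. left_equiv r r'}"
    "\<Union> (precell_equiv `` {fiber r}) = {y. left_equiv r y}"
proof -
  show *: "precell_equiv `` {fiber r} = fiber ` {r' \<in> roots. left_equiv r r'}"
    using assms shortest_fiber by (auto simp: precell_equiv_def left_precells_eq)
  show "\<Union> (precell_equiv `` {fiber r}) = {y. left_equiv r y}"
  proof (intro equalityI subsetI)
    fix y assume "y \<in> \<Union> (precell_equiv `` {fiber r})"
    then obtain r' where r': "left_equiv r r'" "y \<in> carrier W" "root y = r'" unfolding * by (auto simp: fiber_def)
    from left_equiv_trans[OF r'(1)] left_equiv_sym[OF left_equiv_root[OF r'(2)]] r'(3)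
    show "y \<in> {y. left_equiv r y}" by simp
  next
    fix y assume "y \<in> {y. left_equiv r y}"
    then have y: "left_equiv r y" "y \<in> carrier W" using left_le_closed by (auto simp: left_equiv_def)
    have "left_equiv r (root y)" using left_equiv_trans[OF y(1) left_equiv_root[OF y(2)]] .
    then have "fiber (root y) \<in> precell_equiv `` {fiber r}" unfolding * using y by simp
    moreover have "y \<in> fiber (root y)" using y by (simp add: fiber_def)
    ultimately show "y \<in> \<Union> (precell_equiv `` {fiber r})" by blast
  qed
qed

lemma left_equiv_class_cong: "left_equiv w w' \<Longrightarrow> {y. left_equiv w y} = {y. left_equiv w' y}"
  using left_equiv_trans[of w w'] left_equiv_trans[OF left_equiv_sym, of w w'] by blast

lemma canonical_cells_eq: "canonical_cells = {translate A u | A u. commuting_pair A \<and> tail A u}"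
proof (intro equalityI subsetI)
  fix X assume "X \<in> canonical_cells"
  then obtain \<G> \<Gamma> where g: "X = \<Union>\<G>" "\<G> \<in> left_precells // precell_equiv" "\<Gamma> \<in> \<G>" "\<Gamma> \<in> canonical_precells"
    unfolding canonical_cells_def by blast
  then obtain r where r: "r \<in> roots" "\<G> = precell_equiv `` {fiber r}"
    unfolding quotient_def left_precells_eq by auto
  obtain ws where ws: "canonical_word ws" "\<Gamma> = fiber (word_prod ws)" using g(4) unfolding canonical_precells_eq by auto
  then obtain s t u where stu: "commuting_pair {s, t}" "tail {s, t} u" "word_prod ws \<in> translate {s, t} u"
    by (elim canonical_wordD)
  obtain r' where "r' \<in> roots" "left_equiv r r'" "\<Gamma> = fiber r'"
    using g(3) unfolding r(2) precell_class(1)[OF r(1)] by blast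
  then have "left_equiv r (word_prod ws)" using ws canonical_word_root fiber_inject by metis
  then have "X = translate {s, t} u"
    unfolding g(1) r(2) precell_class(2)[OF r(1)]
    using left_equiv_class_cong left_equiv_translate[OF stu] by simp
  then show "X \<in> {translate A u | A u. commuting_pair A \<and> tail A u}" using stu by blast
next
  fix X assume "X \<in> {translate A u | A u. commuting_pair A \<and> tail A u}"
  then obtain A u where X: "X = translate A u" "commuting_pair A" "tail A u" by blast
  obtain s t where k: "s \<otimes> t \<otimes> word_prod u \<in> translate A u" "s \<otimes> t \<otimes> word_prod u \<in> roots" 
    "canonical_word (s # t # u)" "word_prod (s # t # u) = s \<otimes> t \<otimes> word_prod u"
    using translate_head[OF X(2,3)] by metis
  let ?k = "s \<otimes> t \<otimes> word_prod u"
  have "X = \<Union> (precell_equiv `` {fiber ?k})"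
    unfolding X(1) precell_class(2)[OF k(2)] using left_equiv_translate[OF X(2,3) k(1)] by simp
  moreover have "precell_equiv `` {fiber ?k} \<in> left_precells // precell_equiv"
    unfolding quotient_def left_precells_eq using k(2) by blast
  moreover have "fiber ?k \<in> precell_equiv `` {fiber ?k}"
    unfolding precell_class(1)[OF k(2)] using k(2) left_equiv_refl roots_closed by blast
  moreover have "fiber ?k \<in> canonical_precells"
    unfolding canonical_precells_eq k(4)[symmetric] using k(3) by blast
  ultimately show "X \<in> canonical_cells" unfolding canonical_cells_def by blast
qed

lemma unit_cell: "{y. left_equiv \<one> y} = {\<one>}"
proof -
  have "y = \<one>" if "left_equiv \<one> y" for y
  proof -
    have "y \<in> carrier W" using that left_le_closed by (auto simp: left_equiv_def)
    then show ?thesis using left_equiv_right_descents[OF that] right_descents_nonempty[of y] by auto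
  qed
  then show ?thesis using left_equiv_refl by auto
qed

lemma unit_in_left_cells: "{\<one>} \<in> left_cells"
  unfolding left_cells_eq using unit_cell one_closed by blast

text \<open>The head of the normal form decides: a generator leads to a class of lines, a pair A
  with tail u to X(A) u.\<close>

lemma left_cells_decomposition: "left_cells - {{\<one>}} = fiber ` S \<union> canonical_cells"
proof (intro equalityI subsetI)
  fix X assume "X \<in> left_cells - {{\<one>}}"
  then obtain w where w: "w \<in> carrier W" "X = {y. left_equiv w y}" "w \<noteq> \<one>"
    unfolding left_cells_eq using unit_cell by blast
  obtain x u where xu: "is_head x" "tail (right_descents x) u" "w = x \<otimes> word_prod u"
    using normal_form_exists[OF w(1,3)] by blast
  show "X \<in> fiber ` S \<union> canonical_cells"
  proof (cases "x \<in> S")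
    case True
    obtain s where s: "ends {x} u = {s}" by (cases "u = []") (auto simp: ends_def)
    have "right_descents w = {s}" using tail_mult(1)[OF gen_closed[OF True] refl xu(2)] True xu(3) s by simp
    then have sS: "s \<in> S" using right_descents_gens by blast
    have "w \<in> lines_to s" unfolding lines_to_def using True xu s by auto
    then have "X = fiber s" using left_equiv_lines[OF sS] fiber_gen[OF sS] w by simp
    then show ?thesis using sS by blast
  next
    case False
    then have p: "commuting_pair (right_descents x)" "x \<in> carrier W" using xu(1) by (auto simp: is_head_def)
    then have "w \<in> translate (right_descents x) u"
      unfolding xu(3) translate_def with_right_descents_def by blast
    then have "X = translate (right_descents x) u" using left_equiv_translate[OF p(1) xu(2)] w by simp
    then show ?thesis unfolding canonical_cells_eq using p xu by blast
  qed
next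
  fix X assume "X \<in> fiber ` S \<union> canonical_cells"
  then show "X \<in> left_cells - {{\<one>}}"
  proof
    assume "X \<in> fiber ` S"
    then obtain s where s: "s \<in> S" "X = fiber s" by blast
    then have X: "X = {y. left_equiv s y}" using left_equiv_lines[OF s(1) gen_lines_to[OF s(1)]] fiber_gen by simp
    then have "s \<in> X" using left_equiv_refl s by simp
    then have "X \<noteq> {\<one>}" using gen_neq_one[OF s(1)] by blast
    then show ?thesis using X gen_closed[OF s(1)] unfolding left_cells_eq by blast
  next
    assume "X \<in> canonical_cells"
    then obtain A u where X: "X = translate A u" "commuting_pair A" "tail A u" unfolding canonical_cells_eq by blast
    obtain s t where st: "s \<in> S" "t \<in> S" "s \<otimes> t \<otimes> word_prod u \<in> translate A u" 
      using translate_head[OF X(2,3)] by metis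
    let ?k = "s \<otimes> t \<otimes> word_prod u"
    have "?k \<in> carrier W" using st(3) translate_closed[OF X(3)] by blast
    moreover have "X = {y. left_equiv ?k y}" using left_equiv_translate[OF X(2,3) st(3)] X(1) by simp
    moreover have "\<one> \<notin> X"
    proof
      assume "\<one> \<in> X"
      then have "{y. left_equiv \<one> y} = X" using left_equiv_translate[OF X(2,3)] X(1) by simp
      then have "?k = \<one>" "X = {\<one>}" using unit_cell st(3) X(1) by auto
      obtain x where x: "x \<in> carrier W" "right_descents x = A" "\<one> = x \<otimes> word_prod u"
        using \<open>\<one> \<in> X\<close> X(1) by (auto simp: translate_def with_right_descents_def)
      then have "len \<one> = len x + length u" using tail_mult(2)[OF x(1,2) X(3)] by (simp only:)
      then have "x = \<one>" using x(1) by simp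
      then show False using x(2) X(2) by (auto simp: commuting_pair_def)
    qed
    ultimately show ?thesis unfolding left_cells_eq by blast
  qed
qed

lemma fiber_gens_disjoint_canonical: "fiber ` S \<inter> canonical_cells = {}"
proof -
  have "fiber s \<noteq> translate A u" if "s \<in> S" "commuting_pair A" "tail A u" for s A u
    using gen_notin_translate[OF that] fiber_gen[OF that(1)] gen_lines_to[OF that(1)] by blast
  then show ?thesis unfolding canonical_cells_eq by blast
qed

lemma translate_inject:
  assumes "commuting_pair A" "tail A u" "commuting_pair B" "tail B v" 
    and "w \<in> translate A u" "w \<in> translate B v"
  shows "A = B \<and> u = v"
proof -
  obtain x y where xy: "x \<in> carrier W" "right_descents x = A" "y \<in> carrier W" "right_descents y = B"
    "w = x \<otimes> word_prod u" "w = y \<otimes> word_prod v"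
    using assms(5,6) by (auto simp: translate_def with_right_descents_def)
  then have "is_head x" "is_head y" using assms by (auto simp: is_head_def)
  then show ?thesis using normal_form_unique[of x y u v] xy assms by auto
qed

lemma canonical_precell_unique:
  assumes "X \<in> canonical_cells" shows "\<exists>!\<Delta>. \<Delta> \<in> canonical_precells \<and> \<Delta> \<subseteq> X"
proof -
  obtain A u where X: "X = translate A u" "commuting_pair A" "tail A u"
    using assms unfolding canonical_cells_eq by blast
  obtain s t where k: "A = {s, t}" "s \<otimes> t = t \<otimes> s" "s \<otimes> t \<otimes> word_prod u \<in> translate A u" "s \<otimes> t \<otimes> word_prod u \<in> roots" 
    "canonical_word (s # t # u)" "word_prod (s # t # u) = s \<otimes> t \<otimes> word_prod u"
    using translate_head[OF X(2,3)] by metis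
  let ?k = "s \<otimes> t \<otimes> word_prod u"
  show ?thesis
  proof (rule ex1I[of _ "fiber ?k"])
    have "fiber ?k \<subseteq> X" using fiber_subset_class[of ?k]  left_equiv_translate[OF X(2,3) k(3)] X(1) by simp
    then show "fiber ?k \<in> canonical_precells \<and> fiber ?k \<subseteq> X"
      unfolding canonical_precells_eq k(6)[symmetric] using k(5) by blast
    fix \<Delta> assume D: "\<Delta> \<in> canonical_precells \<and> \<Delta> \<subseteq> X"
    then obtain ws where ws: "canonical_word ws" "\<Delta> = fiber (word_prod ws)" unfolding canonical_precells_eq by blast
    then obtain s' t' u' where stu: "commuting_pair {s', t'}" "tail {s', t'} u'" 
      "s' \<otimes> t' = t' \<otimes> s'" "word_prod ws \<in> translate {s', t'} u'" "word_prod ws = s' \<otimes> t' \<otimes> word_prod u'"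
      by (elim canonical_wordD)
    have "word_prod ws \<in> \<Delta>" using canonical_word_root[OF ws(1)] ws(2) by (simp add: fiber_def roots_def)
    \<comment> \<open>The root of a canonical precell lies in it, hence in X, and the normal form of
      that root determines the pair and the tail.\<close>
    then have "{s', t'} = A \<and> u' = u" using translate_inject[OF stu(1,2) X(2,3) stu(4)] D X(1) by blast
    then have "word_prod ws = ?k" using stu(3,5) k(1,2) by (auto simp: doubleton_eq_iff)
    then show "\<Delta> = fiber ?k" using ws by simp
  qed
qed

lemma canonical_precell_subset:
  assumes "\<Delta> \<in> canonical_precells" shows "\<exists>X \<in> canonical_cells. \<Delta> \<subseteq> X"
proof -
  obtain ws where ws: "canonical_word ws" "\<Delta> = fiber (word_prod ws)"
    using assms unfolding canonical_precells_eq by blast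
  then obtain s t u where stu: "commuting_pair {s, t}" "tail {s, t} u" "word_prod ws \<in> translate {s, t} u"
    by (elim canonical_wordD)
  have "\<Delta> \<subseteq> {y. left_equiv (word_prod ws) y}" unfolding ws(2) by (rule fiber_subset_class)
  then have "\<Delta> \<subseteq> translate {s, t} u" using left_equiv_translate[OF stu] by simp
  then show ?thesis unfolding canonical_cells_eq using stu by blast
qed

section \<open>Infinitely many cells\<close>

fun alternating_word :: "'a \<Rightarrow> 'a \<Rightarrow> nat \<Rightarrow> 'a list" where
  "alternating_word s t 0 = []"
| "alternating_word s t (Suc k) = s # alternating_word t s k"

lemma length_alternating_word [simp]: "length (alternating_word s t k) = k"
  by (induction s t k rule: alternating_word.induct) auto

lemma tail_alternating_word:
  "s \<in> S \<Longrightarrow> t \<in> S \<Longrightarrow> s \<otimes> t \<noteq> t \<otimes> s \<Longrightarrow> \<forall>r \<in> A. s \<otimes> r \<noteq> r \<otimes> s \<Longrightarrow> tail A (alternating_word s t k)"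
  by (induction s t k arbitrary: A rule: alternating_word.induct) auto

text \<open>Alternating words of every length are tails after A, and different tails give disjoint
  sets X(A) u.\<close>

lemma infinite_canonical_cells:
  assumes "commuting_pair A" "s \<in> S" "t \<in> S" "s \<otimes> t \<noteq> t \<otimes> s" "\<forall>r \<in> A. s \<otimes> r \<noteq> r \<otimes> s"
  shows "infinite canonical_cells"
proof
  assume fin: "finite canonical_cells"
  let ?f = "\<lambda>k. translate A (alternating_word s t k)"
  have t: "tail A (alternating_word s t k)" for k using tail_alternating_word assms by blast
  have "inj ?f"
  proof (rule injI)
    fix j k assume e: "?f j = ?f k"
    obtain a b where "a \<otimes> b \<otimes> word_prod (alternating_word s t j) \<in> ?f j"
      using translate_head[OF assms(1) t[of j]] by metis
    then have "alternating_word s t j = alternating_word s t k"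
      using translate_inject[OF assms(1) t[of j] assms(1) t[of k]] e by blast
    then show "j = k" by (metis length_alternating_word)
  qed
  moreover have "range ?f \<subseteq> canonical_cells" unfolding canonical_cells_eq using assms(1) t by blast
  ultimately show False using fin finite_subset finite_imageD[of ?f UNIV] by (metis infinite_UNIV_nat)
qed

end

section \<open>The groups \<open>P\<^sub>n\<close>\<close>

lemma pres_rel_lists: "(u, v) \<in> pres_rel X R \<Longrightarrow> u \<in> lists (X \<times> UNIV) \<and> v \<in> lists (X \<times> UNIV)"
  by (induction rule: pres_rel.induct) auto

lemma pres_rel_equiv: "equiv (lists (X \<times> UNIV)) (pres_rel X R)"
proof (rule equivI)
  show "pres_rel X R \<subseteq> lists (X \<times> UNIV) \<times> lists (X \<times> UNIV)"
    by (rule subrelI, drule pres_rel_lists) simp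
  show "refl_on (lists (X \<times> UNIV)) (pres_rel X R)" 
    using pres_rel_lists by (auto simp: refl_on_def intro: pres_refl)
  show "sym (pres_rel X R)" by (auto simp: sym_def intro: pres_sym)
  show "trans (pres_rel X R)" by (auto simp: trans_def intro: pres_trans)
qed

lemma pres_rel_append:
  assumes "(u, u') \<in> pres_rel X R" "(v, v') \<in> pres_rel X R" shows "(u @ v, u' @ v') \<in> pres_rel X R"
  using pres_ctxt[OF assms(1), of "[]" v] pres_ctxt[OF assms(2), of u' "[]"] pres_rel_lists[OF assms(1)]
    pres_rel_lists[OF assms(2)] by (auto intro: pres_trans)

text \<open>The universal property of the presentation in terms of actions: letters act on B, formal
  inverses undo each other and relators act trivially, so equivalent words act alike.\<close>

lemma pres_rel_foldr:
  assumes "(u, v) \<in> pres_rel X R" "b \<in> B"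
    and closed: "\<And>x e b. x \<in> X \<Longrightarrow> b \<in> B \<Longrightarrow> f (x, e) b \<in> B"
    and cancel: "\<And>x e b. x \<in> X \<Longrightarrow> b \<in> B \<Longrightarrow> f (x, e) (f (x, \<not> e) b) = b"
    and relator: "\<And>r b. r \<in> R \<Longrightarrow> r \<in> lists (X \<times> UNIV) \<Longrightarrow> b \<in> B \<Longrightarrow> foldr f r b = b"
  shows "foldr f u b = foldr f v b"
  using assms(1,2)
proof (induction arbitrary: b rule: pres_rel.induct)
  case (pres_ctxt u v c d)
  have "foldr f d b \<in> B" using pres_ctxt(3) pres_ctxt.prems 
    by (induction d) (auto simp: closed)
  then show ?case using pres_ctxt.IH by simp
qed (auto simp: cancel relator)

context
  fixes X :: "'g set" and R :: "'g gword set"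
begin

private abbreviation (input) "Pr \<equiv> presented_group X R"
private abbreviation (input) "word_class u \<equiv> pres_rel X R `` {u}"
private abbreviation (input) "letters \<equiv> lists (X \<times> (UNIV :: bool set))"

lemma presented_group_class_eq: 
  "u \<in> letters \<Longrightarrow> v \<in> letters \<Longrightarrow> word_class u = word_class v \<longleftrightarrow> (u, v) \<in> pres_rel X R"
  using eq_equiv_class_iff[OF pres_rel_equiv] by blast

lemma presented_group_carrier: "carrier Pr = word_class ` letters"
  by (auto simp: presented_group_def quotient_def)

lemma presented_group_mult: 
  assumes "u \<in> letters" "v \<in> letters" shows "word_class u \<otimes>\<^bsub>Pr\<^esub> word_class v = word_class (u @ v)"
proof -
  have "word_class (a @ b) = word_class (u @ v)" if "a \<in> word_class u" "b \<in> word_class v" for a b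
  proof -
    have "(u @ v, a @ b) \<in> pres_rel X R" using that pres_rel_append by blast
    then show ?thesis using equiv_class_eq[OF pres_rel_equiv] by blast
  qed
  then have "(\<Union>a\<in>word_class u. \<Union>b\<in>word_class v. word_class (a @ b))
      = (\<Union>a\<in>word_class u. \<Union>b\<in>word_class v. word_class (u @ v))"
    by (intro SUP_cong refl)
  also have "u \<in> word_class u" "v \<in> word_class v" using assms pres_refl by blast+
  then have "word_class u \<noteq> {}" "word_class v \<noteq> {}" by blast+
  then have "(\<Union>a\<in>word_class u. \<Union>b\<in>word_class v. word_class (u @ v)) = word_class (u @ v)"
    by (simp only: UN_constant if_False)
  finally show ?thesis by (simp add: presented_group_def)
qed

lemma presented_group_one: "\<one>\<^bsub>Pr\<^esub> = word_class []"
  by (simp add: presented_group_def)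

lemma presented_group_group: "group Pr"
proof (rule groupI)
  show "x \<otimes>\<^bsub>Pr\<^esub> y \<in> carrier Pr" if "x \<in> carrier Pr" "y \<in> carrier Pr" for x y
    using that by (auto simp: presented_group_carrier presented_group_mult)
  show "\<one>\<^bsub>Pr\<^esub> \<in> carrier Pr" by (auto simp: presented_group_carrier presented_group_one)
  show "x \<otimes>\<^bsub>Pr\<^esub> y \<otimes>\<^bsub>Pr\<^esub> z = x \<otimes>\<^bsub>Pr\<^esub> (y \<otimes>\<^bsub>Pr\<^esub> z)" 
    if "x \<in> carrier Pr" "y \<in> carrier Pr" "z \<in> carrier Pr" for x y z
    using that by (auto simp: presented_group_carrier presented_group_mult)
  show "\<one>\<^bsub>Pr\<^esub> \<otimes>\<^bsub>Pr\<^esub> x = x" if "x \<in> carrier Pr" for x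
    using that by (auto simp: presented_group_carrier presented_group_one presented_group_mult)
  show "\<exists>y\<in>carrier Pr. y \<otimes>\<^bsub>Pr\<^esub> x = \<one>\<^bsub>Pr\<^esub>" if x: "x \<in> carrier Pr" for x
  proof -
    obtain u where u: "u \<in> letters" "x = word_class u" using x by (auto simp: presented_group_carrier)
    have "\<exists>v \<in> letters. (v @ u, []) \<in> pres_rel X R" using u(1)
    proof (induction u)
      case Nil then show ?case using pres_refl by (intro bexI[of _ "[]"]) auto
    next
      case (Cons a u)
      then obtain v where v: "v \<in> letters" "(v @ u, []) \<in> pres_rel X R" by blast
      obtain i e where a: "a = (i, e)" "i \<in> X" using Cons by (cases a) auto
      have "([(i, \<not> e), (i, e)], []) \<in> pres_rel X R" using pres_cancel[of i X "\<not> e"] a by simp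
      from pres_ctxt[OF this v(1), of u] have "(v @ [(i, \<not> e)] @ a # u, v @ u) \<in> pres_rel X R"
        using Cons a by simp
      then have "((v @ [(i, \<not> e)]) @ a # u, []) \<in> pres_rel X R" using v(2) by (auto intro: pres_trans)
      then show ?case using v a by (intro bexI[of _ "v @ [(i, \<not> e)]"]) auto
    qed
    then obtain v where "v \<in> letters" "(v @ u, []) \<in> pres_rel X R" by blast
    then show ?thesis using u
      by (intro bexI[of _ "word_class v"])
        (auto simp: presented_group_carrier presented_group_mult presented_group_one presented_group_class_eq)
  qed
qed

end

section \<open>The generators of P_n and their commutation\<close>

context
  fixes n :: nat
  assumes n: "n \<ge> 5"
begin

private abbreviation (input) "G \<equiv> P_group n"
private abbreviation (input) "g \<equiv> P_gen n"
private abbreviation (input) "words \<equiv> lists ({1..n} \<times> (UNIV :: bool set))"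
private abbreviation (input) "cl u \<equiv> pres_rel {1..n} (P_relators n) `` {u}"

declare One_nat_def [simp del]

interpretation G: group "P_group n"
  unfolding P_group_def by (rule presented_group_group)

private lemma carrier_G: "carrier G = cl ` words"
  by (simp add: P_group_def presented_group_carrier)

private lemma mult_G: "u \<in> words \<Longrightarrow> v \<in> words \<Longrightarrow> cl u \<otimes>\<^bsub>G\<^esub> cl v = cl (u @ v)"
  by (simp add: P_group_def presented_group_mult)

private lemma one_G: "\<one>\<^bsub>G\<^esub> = cl []"
  by (simp add: P_group_def presented_group_one)

private lemma g_eq: "g i = cl [(i, False)]"
  by (simp add: P_gen_def pres_gen_def)

private lemma g_closed [simp]: "i \<in> {1..n} \<Longrightarrow> g i \<in> carrier G"
  by (auto simp: g_eq carrier_G)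

private lemma relator_one:
  assumes "map (\<lambda>i. (i, False)) l \<in> P_relators n" "set l \<subseteq> {1..n}"
  shows "cl (map (\<lambda>i. (i, False)) l) = \<one>\<^bsub>G\<^esub>"
proof -
  have l: "map (\<lambda>i. (i, False)) l \<in> words" using assms(2) by (auto simp: in_lists_conv_set)
  have "(map (\<lambda>i. (i, False)) l, []) \<in> pres_rel {1..n} (P_relators n)" by (rule pres_relator[OF assms(1) l])
  then show ?thesis using presented_group_class_eq[OF l, of "[]"] one_G by simp
qed

private lemma relators:
  "1 \<le> i \<Longrightarrow> i \<le> n \<Longrightarrow> map (\<lambda>i. (i, False)) [i, i] \<in> P_relators n"
  "1 \<le> j \<Longrightarrow> j \<le> n - 1 \<Longrightarrow> map (\<lambda>i. (i, False)) [j, j + 1, j, j + 1] \<in> P_relators n"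
  "map (\<lambda>i. (i, False)) [n, 1, n, 1] \<in> P_relators n"
  unfolding P_relators_def by (rule imageI; blast)+

private lemma relators_cases:
  assumes "r \<in> P_relators n"
  obtains i where "i \<in> {1..n}" "r = [(i, False), (i, False)]"
  | i j where "i \<in> {1..n}" "j \<in> {1..n}" "j = i + 1 \<or> i = n \<and> j = 1" 
    "r = [(i, False), (j, False), (i, False), (j, False)]"
proof -
  from assms consider i where "1 \<le> i" "i \<le> n" "r = [(i, False), (i, False)]"
    | j where "1 \<le> j" "j \<le> n - 1" "r = [(j, False), (j + 1, False), (j, False), (j + 1, False)]"
    | "r = [(n, False), (1, False), (n, False), (1, False)]"
    unfolding P_relators_def by auto
  then show thesis
  proof cases
    case 1 then show thesis using that(1)[of i] by simp
  next
    case 2 then show thesis using that(2)[of j "j + 1"] n by simp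
  next
    case 3 then show thesis using that(2)[of n 1] n by simp
  qed
qed

private lemma g_sq: 
  assumes "i \<in> {1..n}" shows "g i \<otimes>\<^bsub>G\<^esub> g i = \<one>\<^bsub>G\<^esub>"
  using relator_one[OF relators(1)[of i]] assms by (simp add: g_eq mult_G)

private lemma g_inv: "i \<in> {1..n} \<Longrightarrow> inv\<^bsub>G\<^esub> g i = g i"
  using G.inv_equality[OF g_sq] by simp

private definition adjacent :: "nat \<Rightarrow> nat \<Rightarrow> bool" where
  "adjacent i j \<longleftrightarrow> j = i + 1 \<or> i = j + 1 \<or> i = n \<and> j = 1 \<or> i = 1 \<and> j = n"

private lemma commute_of_sq:
  assumes "i \<in> {1..n}" "j \<in> {1..n}" "cl [(i, False), (j, False), (i, False), (j, False)] = \<one>\<^bsub>G\<^esub>"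
  shows "g i \<otimes>\<^bsub>G\<^esub> g j = g j \<otimes>\<^bsub>G\<^esub> g i"
proof -
  have "(g i \<otimes>\<^bsub>G\<^esub> g j) \<otimes>\<^bsub>G\<^esub> (g i \<otimes>\<^bsub>G\<^esub> g j) = \<one>\<^bsub>G\<^esub>"
    using assms by (simp add: g_eq mult_G)
  then have "inv\<^bsub>G\<^esub> (g i \<otimes>\<^bsub>G\<^esub> g j) = g i \<otimes>\<^bsub>G\<^esub> g j" using assms by (intro G.inv_equality) auto
  then show ?thesis using assms by (simp add: G.inv_mult_group g_inv)
qed

private lemma adjacent_commute:
  assumes "i \<in> {1..n}" "j \<in> {1..n}" "adjacent i j" shows "g i \<otimes>\<^bsub>G\<^esub> g j = g j \<otimes>\<^bsub>G\<^esub> g i"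
proof -
  have succ: "g i \<otimes>\<^bsub>G\<^esub> g (i + 1) = g (i + 1) \<otimes>\<^bsub>G\<^esub> g i" if "i \<in> {1..n}" "i + 1 \<in> {1..n}" for i
    using relator_one[OF relators(2)[of i]] that by (intro commute_of_sq) auto
  have last: "g n \<otimes>\<^bsub>G\<^esub> g 1 = g 1 \<otimes>\<^bsub>G\<^esub> g n"
    using relator_one[OF relators(3)] n by (intro commute_of_sq) auto
  show ?thesis using assms succ[of i] succ[of j] last unfolding adjacent_def by auto
qed

private lemma hom_exists:
  fixes f :: "nat \<Rightarrow> int \<Rightarrow> int"
  assumes inv: "\<And>i x. i \<in> {1..n} \<Longrightarrow> f i (f i x) = x"
    and comm: "\<And>i j x. i \<in> {1..n} \<Longrightarrow> j \<in> {1..n} \<Longrightarrow> adjacent i j \<Longrightarrow> f i (f j x) = f j (f i x)"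
  shows "\<exists>\<psi>. (\<forall>u\<in>carrier G. \<forall>w\<in>carrier G. \<psi> (u \<otimes>\<^bsub>G\<^esub> w) = \<psi> u \<circ> \<psi> w) \<and> (\<forall>i\<in>{1..n}. \<psi> (g i) = f i)"
proof -
  let ?f = "\<lambda>(i, e :: bool). f i"
  define \<psi> where "\<psi> w = foldr ?f (SOME u. u \<in> w)" for w
  have \<psi>: "\<psi> (cl u) = foldr ?f u" if "u \<in> words" for u
  proof
    fix x
    have "u \<in> cl u" using that pres_refl by blast
    then have "(SOME v. v \<in> cl u) \<in> cl u" by (rule someI)
    then have rel: "(u, SOME v. v \<in> cl u) \<in> pres_rel {1..n} (P_relators n)" by blast
    have "foldr ?f u x = foldr ?f (SOME v. v \<in> cl u) x"
    proof (rule pres_rel_foldr[OF rel, of _ UNIV])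
      fix r x assume "r \<in> P_relators n"
      then show "foldr ?f r x = x"
      proof (cases rule: relators_cases)
        case (1 i) then show ?thesis by (simp add: inv)
      next
        case (2 i j)
        then have "adjacent j i" by (auto simp: adjacent_def)
        then have "f j (f i z) = f i (f j z)" for z using comm 2 by blast
        then show ?thesis using 2 by (simp add: inv)
      qed
    qed (auto simp: inv)
    then show "\<psi> (cl u) x = foldr ?f u x" by (simp add: \<psi>_def)
  qed
  have "\<psi> (u \<otimes>\<^bsub>G\<^esub> w) = \<psi> u \<circ> \<psi> w" if "u \<in> carrier G" "w \<in> carrier G" for u w
    using that by (auto simp: carrier_G mult_G \<psi> fun_eq_iff)
  moreover have "\<psi> (g i) = f i" if "i \<in> {1..n}" for i
    unfolding g_eq using that by (simp add: \<psi> fun_eq_iff)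
  ultimately show ?thesis by blast
qed

private lemma dihedral_hom:
  assumes "i \<in> {1..n}" "j \<in> {1..n}" "i \<noteq> j" "\<not> adjacent i j"
  shows "\<exists>\<psi> :: _ \<Rightarrow> int \<Rightarrow> int. (\<forall>u\<in>carrier G. \<forall>w\<in>carrier G. \<psi> (u \<otimes>\<^bsub>G\<^esub> w) = \<psi> u \<circ> \<psi> w) \<and>
    \<psi> (g i) = uminus \<and> \<psi> (g j) = (\<lambda>x. 1 - x)"
proof -
  let ?f = "\<lambda>k. if k = i then uminus else if k = j then (\<lambda>x. 1 - x) else (\<lambda>x. x :: int)"
  have "adjacent a b \<longleftrightarrow> adjacent b a" for a b by (auto simp: adjacent_def)
  then have "\<exists>\<psi>. (\<forall>u\<in>carrier G. \<forall>w\<in>carrier G. \<psi> (u \<otimes>\<^bsub>G\<^esub> w) = \<psi> u \<circ> \<psi> w) \<and> (\<forall>i\<in>{1..n}. \<psi> (g i) = ?f i)"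
    using assms(4) by (intro hom_exists[of ?f]) auto
  then obtain \<psi> where \<psi>: "\<forall>u\<in>carrier G. \<forall>w\<in>carrier G. \<psi> (u \<otimes>\<^bsub>G\<^esub> w) = \<psi> u \<circ> \<psi> w"
    "\<forall>i\<in>{1..n}. \<psi> (g i) = ?f i" by blast
  have "\<psi> (g i) = uminus" "\<psi> (g j) = (\<lambda>x. 1 - x)"
    using \<psi>(2)[rule_format, OF assms(1)] \<psi>(2)[rule_format, OF assms(2)] assms(3) by auto
  then show ?thesis using \<psi>(1) by blast
qed

private lemma g_inject: 
  assumes "i \<in> {1..n}" "j \<in> {1..n}" "g i = g j" shows "i = j"
proof (rule ccontr)
  assume ij: "i \<noteq> j"
  have "\<exists>\<psi>. (\<forall>u\<in>carrier G. \<forall>w\<in>carrier G. \<psi> (u \<otimes>\<^bsub>G\<^esub> w) = \<psi> u \<circ> \<psi> w) \<and>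
      (\<forall>k\<in>{1..n}. \<psi> (g k) = (if k = i then uminus else (\<lambda>x :: int. x)))"
    by (rule hom_exists) auto
  then obtain \<psi> :: "_ \<Rightarrow> int \<Rightarrow> int" where \<psi>: "\<forall>k\<in>{1..n}. \<psi> (g k) = (if k = i then uminus else (\<lambda>x. x))"
    by blast
  have "\<psi> (g i) 1 = -1" "\<psi> (g j) 1 = 1"
    using \<psi>[rule_format, OF assms(1)] \<psi>[rule_format, OF assms(2)] ij by auto
  then show False using assms(3) by simp
qed

private lemma commute_iff:
  assumes "i \<in> {1..n}" "j \<in> {1..n}"
  shows "g i \<otimes>\<^bsub>G\<^esub> g j = g j \<otimes>\<^bsub>G\<^esub> g i \<longleftrightarrow> i = j \<or> adjacent i j"
proof
  assume c: "g i \<otimes>\<^bsub>G\<^esub> g j = g j \<otimes>\<^bsub>G\<^esub> g i"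
  show "i = j \<or> adjacent i j"
  proof (rule ccontr)
    assume "\<not> (i = j \<or> adjacent i j)"
    then obtain \<psi> :: "_ \<Rightarrow> int \<Rightarrow> int" where
      \<psi>: "\<forall>u\<in>carrier G. \<forall>w\<in>carrier G. \<psi> (u \<otimes>\<^bsub>G\<^esub> w) = \<psi> u \<circ> \<psi> w"
      "\<psi> (g i) = uminus" "\<psi> (g j) = (\<lambda>x. 1 - x)"
      using dihedral_hom[OF assms] by auto
    have "\<psi> (g i \<otimes>\<^bsub>G\<^esub> g j) = \<psi> (g i) \<circ> \<psi> (g j)" "\<psi> (g j \<otimes>\<^bsub>G\<^esub> g i) = \<psi> (g j) \<circ> \<psi> (g i)"
      using \<psi>(1) assms by simp_all
    then have "(\<psi> (g i) \<circ> \<psi> (g j)) 0 = (\<psi> (g j) \<circ> \<psi> (g i)) 0" using c by simp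
    then show False using \<psi>(2,3) by simp
  qed
qed (use assms adjacent_commute in auto)

text \<open>This is the usual permutation representation on reflections with signs, extended from reflections
  to all \<open>x\<close>; truth values stand for the signs.\<close>

private definition refl_act :: "nat \<times> bool \<Rightarrow> nat gword set \<times> bool \<Rightarrow> nat gword set \<times> bool" where
  "refl_act = (\<lambda>(i, e) (x, \<epsilon>). (g i \<otimes>\<^bsub>G\<^esub> x \<otimes>\<^bsub>G\<^esub> g i, \<epsilon> \<noteq> (x = g i)))"

private definition refl_cocycle :: "nat gword set \<Rightarrow> nat gword set \<Rightarrow> bool" where
  "refl_cocycle w x = snd (foldr refl_act (SOME u. u \<in> w) (x, False))"

private lemma refl_act_sq:
  assumes "i \<in> {1..n}" "x \<in> carrier G" shows "refl_act (i, e) (refl_act (i, e') (x, \<epsilon>)) = (x, \<epsilon>)"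
proof -
  have "g i \<otimes>\<^bsub>G\<^esub> (g i \<otimes>\<^bsub>G\<^esub> x \<otimes>\<^bsub>G\<^esub> g i) \<otimes>\<^bsub>G\<^esub> g i = x"
    using assms g_sq by (simp add: G.m_assoc) (simp flip: G.m_assoc)
  moreover from this have "g i \<otimes>\<^bsub>G\<^esub> x \<otimes>\<^bsub>G\<^esub> g i = g i \<longleftrightarrow> x = g i"
    using assms g_sq[of i] by (metis G.l_one g_closed)
  ultimately show ?thesis by (auto simp: refl_act_def)
qed

private lemma refl_act_comm:
  assumes "i \<in> {1..n}" "j \<in> {1..n}" "x \<in> carrier G" "g i \<otimes>\<^bsub>G\<^esub> g j = g j \<otimes>\<^bsub>G\<^esub> g i"
  shows "refl_act (i, e) (refl_act (j, e') (x, \<epsilon>)) = refl_act (j, e') (refl_act (i, e) (x, \<epsilon>))"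
proof -
  have conj: "g a \<otimes>\<^bsub>G\<^esub> x \<otimes>\<^bsub>G\<^esub> g a = g b \<longleftrightarrow> x = g b" 
    if "a \<in> {1..n}" "b \<in> {1..n}" "g a \<otimes>\<^bsub>G\<^esub> g b = g b \<otimes>\<^bsub>G\<^esub> g a" for a b
  proof -
    have x: "g a \<otimes>\<^bsub>G\<^esub> (g a \<otimes>\<^bsub>G\<^esub> x \<otimes>\<^bsub>G\<^esub> g a) \<otimes>\<^bsub>G\<^esub> g a = x"
      using that(1) assms(3) g_sq by (simp add: G.m_assoc) (simp flip: G.m_assoc)
    have b: "g a \<otimes>\<^bsub>G\<^esub> g b \<otimes>\<^bsub>G\<^esub> g a = g b" 
      using that(1,2) g_sq unfolding that(3) by (simp add: G.m_assoc)
    show ?thesis using x b by metis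
  qed
  have "g i \<otimes>\<^bsub>G\<^esub> (g j \<otimes>\<^bsub>G\<^esub> x \<otimes>\<^bsub>G\<^esub> g j) \<otimes>\<^bsub>G\<^esub> g i = (g i \<otimes>\<^bsub>G\<^esub> g j) \<otimes>\<^bsub>G\<^esub> x \<otimes>\<^bsub>G\<^esub> (g j \<otimes>\<^bsub>G\<^esub> g i)"
    using assms(1-3) by (simp add: G.m_assoc)
  also have "\<dots> = (g j \<otimes>\<^bsub>G\<^esub> g i) \<otimes>\<^bsub>G\<^esub> x \<otimes>\<^bsub>G\<^esub> (g i \<otimes>\<^bsub>G\<^esub> g j)" by (simp only: assms(4))
  also have "\<dots> = g j \<otimes>\<^bsub>G\<^esub> (g i \<otimes>\<^bsub>G\<^esub> x \<otimes>\<^bsub>G\<^esub> g i) \<otimes>\<^bsub>G\<^esub> g j"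
    using assms(1-3) by (simp add: G.m_assoc)
  finally show ?thesis using conj[of i j] conj[of j i] assms by (auto simp: refl_act_def)
qed

private lemma refl_act_closed: 
  "i \<in> {1..n} \<Longrightarrow> p \<in> carrier G \<times> UNIV \<Longrightarrow> refl_act (i, e) p \<in> carrier G \<times> UNIV"
  by (auto simp: refl_act_def)

private lemma refl_cocycle_class:
  assumes "u \<in> words" "x \<in> carrier G"
  shows "refl_cocycle (cl u) x = snd (foldr refl_act u (x, False))"
proof -
  have "u \<in> cl u" using assms(1) pres_refl by blast
  then have "(SOME v. v \<in> cl u) \<in> cl u" by (rule someI)
  then have rel: "(u, SOME v. v \<in> cl u) \<in> pres_rel {1..n} (P_relators n)" by blast
  have "foldr refl_act u (x, False) = foldr refl_act (SOME v. v \<in> cl u) (x, False)"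
  proof (rule pres_rel_foldr[OF rel, of _ "carrier G \<times> UNIV"])
    fix r p assume r: "r \<in> P_relators n" and p: "p \<in> carrier G \<times> (UNIV :: bool set)"
    obtain y \<epsilon> where y: "p = (y, \<epsilon>)" "y \<in> carrier G" using p by (cases p) auto
    from r show "foldr refl_act r p = p"
    proof (cases rule: relators_cases)
      case (1 i) then show ?thesis using y refl_act_sq by simp
    next
      case (2 i j)
      have "adjacent i j" using 2 by (auto simp: adjacent_def)
      then have c: "g i \<otimes>\<^bsub>G\<^esub> g j = g j \<otimes>\<^bsub>G\<^esub> g i" using adjacent_commute 2 by blast
      obtain z \<delta> where z: "refl_act (j, False) p = (z, \<delta>)" "z \<in> carrier G"
        using refl_act_closed[OF 2(2) p, of False] by (cases "refl_act (j, False) p") auto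
      have "refl_act (i, False) (refl_act (j, False) (refl_act (i, False) (z, \<delta>))) = refl_act (j, False) (z, \<delta>)"
      proof -
        obtain z' \<delta>' where z': "refl_act (j, False) (z, \<delta>) = (z', \<delta>')" "z' \<in> carrier G"
          using refl_act_closed[OF 2(2), of "(z, \<delta>)" False] z(2) by (cases "refl_act (j, False) (z, \<delta>)") auto
        show ?thesis using refl_act_comm[OF 2(2,1) z(2)] c z' refl_act_sq[OF 2(1) z'(2)] by simp
      qed
      also have "\<dots> = p" using z refl_act_sq[OF 2(2) y(2)] y(1) by metis
      finally show ?thesis using 2 z by simp
    qed
  qed (use assms refl_act_closed refl_act_sq in \<open>auto simp del: split_paired_All\<close>)
  then show ?thesis by (simp add: refl_cocycle_def)
qed

private lemma cl_letter: 
  assumes "i \<in> {1..n}" "u \<in> words" shows "cl ((i, e) # u) = g i \<otimes>\<^bsub>G\<^esub> cl u"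
proof -
  have "cl [(i, e)] = g i"
  proof (cases e)
    case True
    have "([(i, True), (i, \<not> True)], []) \<in> pres_rel {1..n} (P_relators n)" by (rule pres_cancel) (use assms in simp)
    then have "cl [(i, True), (i, False)] = \<one>\<^bsub>G\<^esub>" 
      using presented_group_class_eq[of "[(i, True), (i, False)]" "{1..n}" "[]"] assms one_G by simp
    then have "cl [(i, True)] \<otimes>\<^bsub>G\<^esub> g i = \<one>\<^bsub>G\<^esub>" using assms by (simp add: g_eq mult_G)
    moreover have "cl [(i, True)] \<in> carrier G" using assms by (auto simp: carrier_G)
    ultimately have "inv\<^bsub>G\<^esub> (g i) = cl [(i, True)]" using assms by (intro G.inv_equality) auto
    then show ?thesis using g_inv assms True by simp
  qed (simp add: g_eq)
  then show ?thesis using mult_G[of "[(i, e)]" u] assms by simp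
qed

private lemma cl_closed: "u \<in> words \<Longrightarrow> cl u \<in> carrier G"
  by (auto simp: carrier_G)

private lemma fst_refl_act:
  assumes "u \<in> words" "x \<in> carrier G"
  shows "fst (foldr refl_act u (x, \<epsilon>)) = cl u \<otimes>\<^bsub>G\<^esub> x \<otimes>\<^bsub>G\<^esub> inv\<^bsub>G\<^esub> (cl u)"
  using assms(1)
proof (induction u)
  case Nil then show ?case using assms(2) by (simp flip: one_G)
next
  case (Cons a u)
  obtain i e where a: "a = (i, e)" "i \<in> {1..n}" using Cons by (cases a) auto
  have "fst (foldr refl_act (a # u) (x, \<epsilon>)) = g i \<otimes>\<^bsub>G\<^esub> fst (foldr refl_act u (x, \<epsilon>)) \<otimes>\<^bsub>G\<^esub> g i"
    by (simp add: a refl_act_def split: prod.split)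
  also have "\<dots> = cl (a # u) \<otimes>\<^bsub>G\<^esub> x \<otimes>\<^bsub>G\<^esub> inv\<^bsub>G\<^esub> (cl (a # u))"
    using Cons assms(2) a cl_letter[OF a(2), of u e] cl_closed[of u] g_inv
    by (simp add: G.inv_mult_group G.m_assoc)
  finally show ?case .
qed

section \<open>P_n as a right-angled system\<close>

interpretation P: right_angled_system "P_group n" "P_gens n" refl_cocycle
proof
  show "P_gens n \<subseteq> carrier G" by (auto simp: P_gens_def)
  show "\<exists>ws\<in>lists (P_gens n). coxeter.word_prod G ws = w" if w: "w \<in> carrier G" for w
  proof -
    obtain u where u: "u \<in> words" "w = cl u" using w by (auto simp: carrier_G)
    have "map (\<lambda>a. g (fst a)) u \<in> lists (P_gens n) \<and> coxeter.word_prod G (map (\<lambda>a. g (fst a)) u) = cl u"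
      using u(1)
    proof (induction u)
      case Nil then show ?case by (simp add: coxeter.word_prod_def one_G)
    next
      case (Cons a u)
      then show ?case using cl_letter[of "fst a" u "snd a"]
        by (cases a) (auto simp: coxeter.word_prod_def P_gens_def)
    qed
    then show ?thesis using u by blast
  qed
  show "s \<otimes>\<^bsub>G\<^esub> s = \<one>\<^bsub>G\<^esub>" if "s \<in> P_gens n" for s
    using that g_sq by (auto simp: P_gens_def)
  show "\<not> refl_cocycle \<one>\<^bsub>G\<^esub> x" if "x \<in> carrier G" for x
    unfolding one_G using that by (simp add: refl_cocycle_class)
  show "refl_cocycle (s \<otimes>\<^bsub>G\<^esub> w) x \<longleftrightarrow> refl_cocycle w x \<noteq> (w \<otimes>\<^bsub>G\<^esub> x \<otimes>\<^bsub>G\<^esub> inv\<^bsub>G\<^esub> w = s)"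
    if s: "s \<in> P_gens n" and w: "w \<in> carrier G" and x: "x \<in> carrier G" for s w x
  proof -
    obtain i where i: "i \<in> {1..n}" "s = g i" using s by (auto simp: P_gens_def)
    obtain u where u: "u \<in> words" "w = cl u" using w by (auto simp: carrier_G)
    have "s \<otimes>\<^bsub>G\<^esub> w = cl ((i, False) # u)" using cl_letter i u by simp
    then have "refl_cocycle (s \<otimes>\<^bsub>G\<^esub> w) x = snd (refl_act (i, False) (foldr refl_act u (x, False)))"
      using refl_cocycle_class[of "(i, False) # u" x] i u x by simp
    also have "\<dots> = (snd (foldr refl_act u (x, False)) \<noteq> (fst (foldr refl_act u (x, False)) = g i))"
      by (simp add: refl_act_def split: prod.split)
    finally show ?thesis using refl_cocycle_class[OF u(1) x] fst_refl_act[OF u(1) x] u i by simp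
  qed
  show "finite (P_gens n)" by (simp add: P_gens_def)
  show "\<exists>\<psi> :: _ \<Rightarrow> int \<Rightarrow> int. (\<forall>u\<in>carrier G. \<forall>w\<in>carrier G. \<psi> (u \<otimes>\<^bsub>G\<^esub> w) = \<psi> u \<circ> \<psi> w)
      \<and> \<psi> s = uminus \<and> \<psi> t = (\<lambda>x. 1 - x)"
    if "s \<in> P_gens n" "t \<in> P_gens n" "s \<otimes>\<^bsub>G\<^esub> t \<noteq> t \<otimes>\<^bsub>G\<^esub> s" for s t
  proof -
    obtain i j where ij: "i \<in> {1..n}" "j \<in> {1..n}" "s = g i" "t = g j"
      using \<open>s \<in> P_gens n\<close> \<open>t \<in> P_gens n\<close> unfolding P_gens_def by blast
    then have "i \<noteq> j" "\<not> adjacent i j" using \<open>s \<otimes>\<^bsub>G\<^esub> t \<noteq> t \<otimes>\<^bsub>G\<^esub> s\<close> commute_iff by blast+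
    then show ?thesis unfolding ij(3,4) by (rule dihedral_hom[OF ij(1,2)])
  qed
  show "s = t \<or> t = r \<or> s = r"
    if str: "s \<in> P_gens n" "t \<in> P_gens n" "r \<in> P_gens n" "s \<otimes>\<^bsub>G\<^esub> t = t \<otimes>\<^bsub>G\<^esub> s"
      "t \<otimes>\<^bsub>G\<^esub> r = r \<otimes>\<^bsub>G\<^esub> t" "s \<otimes>\<^bsub>G\<^esub> r = r \<otimes>\<^bsub>G\<^esub> s" for s t r
  proof -
    obtain i j k where ijk: "i \<in> {1..n}" "j \<in> {1..n}" "k \<in> {1..n}" "s = g i" "t = g j" "r = g k"
      using str(1-3) unfolding P_gens_def by blast
    then have "i = j \<or> adjacent i j" "j = k \<or> adjacent j k" "i = k \<or> adjacent i k"
      using str(4-6) commute_iff by simp_all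
    \<comment> \<open>A cycle of length at least five contains no triangle.\<close>
    then have "i = j \<or> j = k \<or> i = k" using n unfolding adjacent_def by linarith
    then show ?thesis using ijk by auto
  qed
qed

section \<open>The left cells of P_n\<close>

lemma P_group_cells:
  defines "\<Gamma> \<equiv> \<lambda>i. coxeter.precell (P_group n) (P_gens n) (P_gen n i)"
  shows
    "{\<one>\<^bsub>P_group n\<^esub>} \<in> coxeter.left_cells (P_group n) (P_gens n) \<and>
     coxeter.left_cells (P_group n) (P_gens n) - {{\<one>\<^bsub>P_group n\<^esub>}}
       = \<Gamma> ` {1..n} \<union> coxeter.canonical_cells (P_group n) (P_gens n) \<and>
     \<Gamma> ` {1..n} \<inter> coxeter.canonical_cells (P_group n) (P_gens n) = {} \<and>
     (\<forall>i \<in> {1..n}. \<Gamma> i \<in> coxeter.left_precells (P_group n) (P_gens n) \<and>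
        coxeter.shortest (P_group n) (P_gens n) (\<Gamma> i) = P_gen n i \<and>
        coxeter.dimension (P_group n) (P_gens n) (\<Gamma> i) = 1) \<and>
     card (\<Gamma> ` {1..n}) = n \<and>
     infinite (coxeter.canonical_cells (P_group n) (P_gens n)) \<and>
     (\<forall>C \<in> coxeter.canonical_cells (P_group n) (P_gens n).
        \<exists>!\<Delta>. \<Delta> \<in> coxeter.canonical_precells (P_group n) (P_gens n) \<and> \<Delta> \<subseteq> C) \<and>
     (\<forall>\<Delta> \<in> coxeter.canonical_precells (P_group n) (P_gens n).
        \<exists>C \<in> coxeter.canonical_cells (P_group n) (P_gens n). \<Delta> \<subseteq> C)"
proof -
  have gS: "g i \<in> P_gens n" if "i \<in> {1..n}" for i using that by (auto simp: P_gens_def)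
  then have roots: "g i \<in> P.roots" if "i \<in> {1..n}" for i using P.gens_roots that by blast
  have \<Gamma>: "\<Gamma> i = P.fiber (g i)" if "i \<in> {1..n}" for i
    unfolding \<Gamma>_def by (rule P.precell_eq[OF roots[OF that]])
  have img: "\<Gamma> ` {1..n} = P.fiber ` P_gens n"
    using \<Gamma> by (auto simp: P_gens_def image_iff)
  have "inj_on \<Gamma> {1..n}"
    using \<Gamma> P.fiber_inject roots g_inject by (intro inj_onI) auto
  then have card: "card (\<Gamma> ` {1..n}) = n" by (simp add: card_image)
  have each: "\<Gamma> i \<in> P.left_precells \<and> P.shortest (\<Gamma> i) = g i \<and> P.dimension (\<Gamma> i) = 1"
    if i: "i \<in> {1..n}" for i
    using P.shortest_fiber[OF roots[OF i]] roots[OF i] gS[OF i]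
    by (simp add: \<Gamma>[OF i] P.left_precells_eq P.dimension_def)
  have "infinite P.canonical_cells"
  proof (rule P.infinite_canonical_cells)
    \<comment> \<open>The generators 1 and 2 form the pair; 4 is adjacent to neither, because n
      \<ge> 5 keeps 4 from being the last vertex of the cycle. The letters 4 and 2 do not commute
      and provide the alternating tails.\<close>
    have i: "1 \<in> {1..n}" "2 \<in> {1..n}" "4 \<in> {1..n}" using n by auto
    have "g 1 \<noteq> g 2" using g_inject[OF i(1,2)] by auto
    then show "P.commuting_pair {g 1, g 2}"
      using commute_iff[OF i(1,2)] gS[OF i(1)] gS[OF i(2)] unfolding P.commuting_pair_def
      by (intro bexI[of _ "g 1"] bexI[of _ "g 2"]) (simp_all add: adjacent_def)
    show "g 4 \<otimes>\<^bsub>G\<^esub> g 2 \<noteq> g 2 \<otimes>\<^bsub>G\<^esub> g 4" "\<forall>r\<in>{g 1, g 2}. g 4 \<otimes>\<^bsub>G\<^esub> r \<noteq> r \<otimes>\<^bsub>G\<^esub> g 4"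
      using commute_iff[OF i(3,2)] commute_iff[OF i(3,1)] n by (auto simp: adjacent_def)
    show "g 4 \<in> P_gens n" "g 2 \<in> P_gens n" using gS i by auto
  qed
  moreover have "\<forall>i \<in> {1..n}. \<Gamma> i \<in> P.left_precells \<and> P.shortest (\<Gamma> i) = g i \<and> P.dimension (\<Gamma> i) = 1"
    using each by blast
  moreover have "\<forall>X \<in> P.canonical_cells. \<exists>!\<Delta>. \<Delta> \<in> P.canonical_precells \<and> \<Delta> \<subseteq> X"
    by (rule ballI) (rule P.canonical_precell_unique)
  moreover have "\<forall>\<Delta> \<in> P.canonical_precells. \<exists>X \<in> P.canonical_cells. \<Delta> \<subseteq> X"
    by (rule ballI) (rule P.canonical_precell_subset)
  ultimately show ?thesis
    using P.unit_in_left_cells P.left_cells_decomposition P.fiber_gens_disjoint_canonical card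
    unfolding img by (intro conjI)
qed

end

theorem theorem5p3:
  fixes n :: nat
    and W :: "nat gword set monoid"
    and S :: "nat gword set set"
    and \<Gamma> :: "nat \<Rightarrow> nat gword set set"
  assumes "n \<ge> 5"
    and "W = P_group n"
    and "S = P_gens n"
    and "\<And>i. \<Gamma> i = coxeter.precell W S (P_gen n i)"
  shows
    "{\<one>\<^bsub>W\<^esub>} \<in> coxeter.left_cells W S \<and>
     coxeter.left_cells W S - {{\<one>\<^bsub>W\<^esub>}} = \<Gamma> ` {1..n} \<union> coxeter.canonical_cells W S \<and>
     \<Gamma> ` {1..n} \<inter> coxeter.canonical_cells W S = {} \<and>
     (\<forall>i \<in> {1..n}. \<Gamma> i \<in> coxeter.left_precells W S \<and>
        coxeter.shortest W S (\<Gamma> i) = P_gen n i \<and> coxeter.dimension W S (\<Gamma> i) = 1) \<and>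
     card (\<Gamma> ` {1..n}) = n \<and>
     infinite (coxeter.canonical_cells W S) \<and>
     (\<forall>C \<in> coxeter.canonical_cells W S.
        \<exists>!\<Delta>. \<Delta> \<in> coxeter.canonical_precells W S \<and> \<Delta> \<subseteq> C) \<and>
     (\<forall>\<Delta> \<in> coxeter.canonical_precells W S. \<exists>C \<in> coxeter.canonical_cells W S. \<Delta> \<subseteq> C)"
proof -
  have "\<Gamma> = (\<lambda>i. coxeter.precell (P_group n) (P_gens n) (P_gen n i))" using assms(2-4) by auto
  then show ?thesis using P_group_cells[OF assms(1)] assms(2,3) by simp
qed

end
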